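(* Let $\alpha\in\mathbb{R}\setminus\mathbb{Q}$, $\lambda\in\mathbb{R}\setminus\{0\}$, $\theta\in\mathbb{R}$ and $E\in\Sigma_{\lambda,\alpha}$, and put $A=S_{\lambda,E}$. Suppose there exist $\eta>0$ and a non-zero $\hat u=\{\hat u_k\}_{k\in\mathbb{Z}}$ with $\hat H_{\lambda,\alpha,\theta}\hat u=E\hat u$ and $|\hat u_k|\le e^{-2\pi\eta|k|}$ for all $|k|$ large enough. Then the following hold. (1) If $2\theta\notin\alpha\mathbb{Z}+\mathbb{Z}$, then there exists $B:\mathbb{R}/\mathbb{Z}\to\mathrm{SL}(2,\mathbb{R})$, analytic in $|\Im x|<\eta$, such that $B(x+\alpha)^{-1}A(x)B(x)=R_{\pm\theta}$ (for one choice of sign). In this case, with the same sign, $\rho(\alpha,A)=\pm\theta+\frac m2\alpha\bmod\frac12\mathbb{Z}$, where $m=\deg(B)$, and $2\rho(\alpha,A)\notin\alpha\mathbb{Z}+\mathbb{Z}$. (2) If $2\theta-k\alpha\in\mathbb{Z}$ for some $k\in\mathbb{Z}$ and $\eta>8\beta(\alpha)$, then there exists $B:\mathbb{R}/\mathbb{Z}\to\mathrm{PSL}(2,\mathbb{R})$, analytic in $|\Im x|<\frac\eta4$, such that $B(x+\alpha)^{-1}A(x)B(x)=\begin{pmatrix}\pm1&a\\0&\pm1\end{pmatrix}$ (the same sign in both diagonal entries) with a constant $a\ne0$. In this case $2\rho(\alpha,A)=m\alpha\bmod\mathbb{Z}$, where $m=\deg(B)$; in particular $2\rho(\alpha,A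)\in\alpha\mathbb{Z}+\mathbb{Z}$.
   Context: $(H_{\lambda,\alpha,\theta}u)_n=u_{n+1}+u_{n-1}+2\lambda\cos 2\pi(\theta+n\alpha)u_n$ on $\ell^2(\mathbb{Z})$; for irrational $\alpha$ its spectrum is independent of $\theta$ and denoted $\Sigma_{\lambda,\alpha}$. The Aubry dual operator is $\hat H_{\lambda,\alpha,\theta}=\lambda H_{\lambda^{-1},\alpha,\theta}$, i.e. $(\hat H_{\lambda,\alpha,\theta}\hat u)_k=\lambda(\hat u_{k+1}+\hat u_{k-1})+2\cos 2\pi(\theta+k\alpha)\hat u_k$. $\beta(\alpha)=\limsup_{n\to\infty}\frac{\ln q_{n+1}}{q_n}$, with $p_n/q_n$ the continued fraction convergents of $\alpha$. $S_{\lambda,E}(x)=\begin{pmatrix}E-2\lambda\cos 2\pi x&-1\\1&0\end{pmatrix}$ and $R_\theta=\begin{pmatrix}\cos2\pi\theta&-\sin2\pi\theta\\\sin2\pi\theta&\cos2\pi\theta\end{pmatrix}$. "$B:\mathbb{R}/\mathbb{Z}\to\mathrm{SL}(2,\mathbb{R})$ analytic in $|\Im x|<\eta$" means that $B$ is $1$-periodic, has values in $\mathrm{SL}(2,\mathbb{R})$ for real $x$, and extends analytically to that strip. "$B:\mathbb{R}/\mathbb{Z}\to\mathrm{PSL}(2,\mathbb{R})$" means a matrix function $B$ on $\mathbb{R}$ with real entries, $\det B=1$, and $B(x+1)=\pm B(x)$ (one fixed sign). Such a $B$ is a map $\mathbb{R}/2\mathbb{Z}\to\mathrm{SL}(2,\mathbb{R})$;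 its degree $\deg(B)$ is the integer $k$ such that $x\mapsto B(x)$ is homotopic to $x\mapsto R_{kx/2}$ as maps $\mathbb{R}/2\mathbb{Z}\to\mathrm{SL}(2,\mathbb{R})$. Rotation number: for $A:\mathbb{R}/\mathbb{Z}\to\mathrm{SL}(2,\mathbb{R})$ continuous and homotopic to the identity (as $S_{\lambda,E}$ is), consider the map $(x,\varphi)\mapsto(x+\alpha,\varphi')$ on $\mathbb{R}/\mathbb{Z}\times\mathbb{R}/\frac12\mathbb{Z}$, where $A(x)(\cos 2\pi\varphi,\sin 2\pi\varphi)^T$ spans the line of direction $(\cos 2\pi\varphi',\sin 2\pi\varphi')^T$. It has a continuous lift $\tilde T(x,\varphi)=(x+\alpha,\tilde\varphi(x,\varphi))$ to $\mathbb{R}\times\mathbb{R}$ such that $\tilde\varphi(x,\varphi)-\varphi$ is $1$-periodic in $x$ and $\frac12$-periodic in $\varphi$. Then $\rho(\alpha,A)=\limsup_{n\to\infty}\frac1n(p_2\circ\tilde T^n(x,\varphi)-\varphi)\bmod\frac12\mathbb{Z}$, where $p_2(x,\varphi)=\varphi$; it does not depend on $(x,\varphi)$. *)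

theory Defs
  imports "HOL-Analysis.Analysis" "HOL-Library.Real_Mod"
begin

definition almost_mathieu :: "real \<Rightarrow> real \<Rightarrow> real \<Rightarrow> (int \<Rightarrow> complex) \<Rightarrow> int \<Rightarrow> complex" where
  "almost_mathieu lam \<alpha> \<theta> u n =
     u (n + 1) + u (n - 1) + complex_of_real (2 * lam * cos (2 * pi * (\<theta> + of_int n * \<alpha>))) * u n"

definition aubry_dual :: "real \<Rightarrow> real \<Rightarrow> real \<Rightarrow> (int \<Rightarrow> complex) \<Rightarrow> int \<Rightarrow> complex" where
  "aubry_dual lam \<alpha> \<theta> u k = complex_of_real lam * almost_mathieu (inverse lam) \<alpha> \<theta> u k"

lemma aubry_dual_eq:
  assumes "lam \<noteq> 0"
  shows "aubry_dual lam \<alpha> \<theta> u k =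
     complex_of_real lam * (u (k + 1) + u (k - 1))
       + complex_of_real (2 * cos (2 * pi * (\<theta> + of_int k * \<alpha>))) * u k"
  using assms by (simp add: aubry_dual_def almost_mathieu_def algebra_simps)

definition ell2 :: "(int \<Rightarrow> complex) set" where
  "ell2 = {u. (\<lambda>n. (cmod (u n))\<^sup>2) summable_on UNIV}"

definition ell2_norm :: "(int \<Rightarrow> complex) \<Rightarrow> real" where
  "ell2_norm u = sqrt (\<Sum>\<^sub>\<infinity>n. (cmod (u n))\<^sup>2)"

definition bounded_op_ell2 :: "((int \<Rightarrow> complex) \<Rightarrow> int \<Rightarrow> complex) \<Rightarrow> bool" where
  "bounded_op_ell2 T \<longleftrightarrow>
     (\<forall>u\<in>ell2. T u \<in> ell2) \<and>
     (\<forall>u\<in>ell2. \<forall>v\<in>ell2. T (\<lambda>n. u n + v n) = (\<lambda>n. T u n + T v n)) \<and>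
     (\<forall>c. \<forall>u\<in>ell2. T (\<lambda>n. c * u n) = (\<lambda>n. c * T u n)) \<and>
     (\<exists>C. \<forall>u\<in>ell2. ell2_norm (T u) \<le> C * ell2_norm u)"

definition spectrum_ell2 :: "((int \<Rightarrow> complex) \<Rightarrow> int \<Rightarrow> complex) \<Rightarrow> complex set" where
  "spectrum_ell2 H =
     {z. \<not> (\<exists>T. bounded_op_ell2 T \<and>
              (\<forall>u\<in>ell2. T (\<lambda>n. H u n - z * u n) = u \<and> (\<lambda>n. H (T u) n - z * T u n) = u))}"

(* For irrational \<alpha> all the sets in the union coincide, and they consist of real numbers. *)
definition Sigma_AM :: "real \<Rightarrow> real \<Rightarrow> real set" where
  "Sigma_AM lam \<alpha> =
     {E. complex_of_real E \<in> (\<Union>\<theta>. spectrum_ell2 (almost_mathieu lam \<alpha> \<theta>))}"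

(* Complete quotients x_0 = \<alpha>, x_{n+1} = 1 / frac x_n; the partial quotients are their floors. *)
primrec cf_complete_quotient :: "real \<Rightarrow> nat \<Rightarrow> real" where
  "cf_complete_quotient \<alpha> 0 = \<alpha>"
| "cf_complete_quotient \<alpha> (Suc n) = 1 / frac (cf_complete_quotient \<alpha> n)"

definition cf_quotient :: "real \<Rightarrow> nat \<Rightarrow> int" where
  "cf_quotient \<alpha> n = \<lfloor>cf_complete_quotient \<alpha> n\<rfloor>"

fun cf_denom :: "real \<Rightarrow> nat \<Rightarrow> int" where
  "cf_denom \<alpha> 0 = 1"
| "cf_denom \<alpha> (Suc 0) = cf_quotient \<alpha> 1"
| "cf_denom \<alpha> (Suc (Suc n)) =
     cf_quotient \<alpha> (Suc (Suc n)) * cf_denom \<alpha> (Suc n) + cf_denom \<alpha> n"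

(* May be infinite. *)
definition beta_freq :: "real \<Rightarrow> ereal" where
  "beta_freq \<alpha> =
     limsup (\<lambda>n. ereal (ln (of_int (cf_denom \<alpha> (Suc n))) / of_int (cf_denom \<alpha> n)))"

definition freq_module :: "real \<Rightarrow> real set" where
  "freq_module \<alpha> = {of_int k * \<alpha> + of_int l | k l :: int. True}"

definition mat2 :: "real \<Rightarrow> real \<Rightarrow> real \<Rightarrow> real \<Rightarrow> real^2^2" where
  "mat2 a b c d = vector [vector [a, b], vector [c, d]]"

definition SL2 :: "(real^2^2) set" where
  "SL2 = {M. det M = 1}"

definition S_AM :: "real \<Rightarrow> real \<Rightarrow> real \<Rightarrow> real^2^2" where
  "S_AM lam E x = mat2 (E - 2 * lam * cos (2 * pi * x)) (- 1) 1 0"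

definition R_rot :: "real \<Rightarrow> real^2^2" where
  "R_rot \<theta> = mat2 (cos (2 * pi * \<theta>)) (- sin (2 * pi * \<theta>)) (sin (2 * pi * \<theta>)) (cos (2 * pi * \<theta>))"

definition circle_to_SL2 :: "(real \<Rightarrow> real^2^2) \<Rightarrow> bool" where
  "circle_to_SL2 B \<longleftrightarrow> (\<forall>x. B x \<in> SL2) \<and> (\<forall>x. B (x + 1) = B x)"

definition circle_to_PSL2 :: "(real \<Rightarrow> real^2^2) \<Rightarrow> bool" where
  "circle_to_PSL2 B \<longleftrightarrow>
     (\<forall>x. B x \<in> SL2) \<and> (\<exists>c\<in>{1, -1::real}. \<forall>x. B (x + 1) = c *\<^sub>R B x)"

definition analytic_in_strip :: "real \<Rightarrow> (real \<Rightarrow> real^2^2) \<Rightarrow> bool" where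
  "analytic_in_strip \<delta> B \<longleftrightarrow>
     (\<exists>F :: complex \<Rightarrow> complex^2^2.
        (\<forall>i j. (\<lambda>z. F z $ i $ j) analytic_on {z. \<bar>Im z\<bar> < \<delta>}) \<and>
        (\<forall>x i j. F (complex_of_real x) $ i $ j = complex_of_real (B x $ i $ j)))"

(* Maps from R/2Z are represented by 2-periodic functions on the line; a homotopy of such maps
   is a homotopy of functions on the line that stays 2-periodic throughout. *)
definition homotopic_R_2Z :: "(real \<Rightarrow> real^2^2) \<Rightarrow> (real \<Rightarrow> real^2^2) \<Rightarrow> bool" where
  "homotopic_R_2Z = homotopic_with_canon (\<lambda>f. \<forall>x. f (x + 2) = f x) UNIV SL2"

definition degree_map :: "(real \<Rightarrow> real^2^2) \<Rightarrow> int" where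
  "degree_map B = (THE k. homotopic_R_2Z B (\<lambda>x. R_rot (of_int k * x / 2)))"

definition direction :: "real \<Rightarrow> real^2" where
  "direction \<phi> = vector [cos (2 * pi * \<phi>), sin (2 * pi * \<phi>)]"

(* \<Phi> is the second component of a continuous lift (x, \<phi>) \<mapsto> (x + \<alpha>, \<Phi> (x, \<phi>)) of the projective
   action of A; the first component plays no role in the conditions on \<Phi>. *)
definition is_angle_lift :: "(real \<Rightarrow> real^2^2) \<Rightarrow> (real \<times> real \<Rightarrow> real) \<Rightarrow> bool" where
  "is_angle_lift A \<Phi> \<longleftrightarrow>
     continuous_on UNIV \<Phi> \<and>
     (\<forall>x \<phi>. span {A x *v direction \<phi>} = span {direction (\<Phi> (x, \<phi>))}) \<and>
     (\<forall>x \<phi>. \<Phi> (x + 1, \<phi>) - \<phi> = \<Phi> (x, \<phi>) - \<phi>) \<and>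
     (\<forall>x \<phi>. \<Phi> (x, \<phi> + 1/2) - (\<phi> + 1/2) = \<Phi> (x, \<phi>) - \<phi>)"

definition lifted_cocycle :: "real \<Rightarrow> (real \<times> real \<Rightarrow> real) \<Rightarrow> real \<times> real \<Rightarrow> real \<times> real" where
  "lifted_cocycle \<alpha> \<Phi> p = (fst p + \<alpha>, \<Phi> p)"

(* An element of R/(1/2)Z, given by its representative in [0, 1/2). Lifts differ by a constant
   in (1/2)Z, so modulo 1/2 the limsup depends neither on the lift nor on the starting point.
   Only meaningful for A continuous, 1-periodic and homotopic to the identity in SL(2,R). *)
definition rotation_number :: "real \<Rightarrow> (real \<Rightarrow> real^2^2) \<Rightarrow> real" where
  "rotation_number \<alpha> A =
     (THE r. 0 \<le> r \<and> r < 1/2 \<and>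
        (\<forall>\<Phi>. is_angle_lift A \<Phi> \<longrightarrow>
          (\<forall>x \<phi>. \<exists>r'. [r' = r] (rmod 1/2) \<and>
             limsup (\<lambda>n. ereal ((snd ((lifted_cocycle \<alpha> \<Phi> ^^ n) (x, \<phi>)) - \<phi>) / real n)) = ereal r')))"

end

theory Submission
  imports Defs "HOL-Complex_Analysis.Conformal_Mappings"
begin

text \<open>
  The Fourier series U of the dual eigenvector is analytic in the strip, and the vector with
  components exp(2 pi i theta) U(x) and U(x - alpha) is mapped by the cocycle to
  exp(2 pi i theta) times its translate.  Its real and imaginary parts have a constant Wronskian.

  If the Wronskian vanishes, the vector and its conjugate are proportional; the argument of the
  proportionality factor then forces 2 theta to lie in the frequency module.  In the nonresonant
  case the two parts are therefore, after normalisation, the columns of B.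

  In the resonant case the uniqueness of decaying dual eigenvectors makes the vector real up to a
  factor exp(pi i k x), so that it serves as first column of B.  U and its translate have no common
  zero, hence satisfy a Bezout identity, which yields a second column of determinant one.  The cocycle
  becomes triangular, and the off-diagonal entry is made constant by solving a cohomological equation
  whose small divisors are controlled by beta.  If the constant were zero, the second column would
  produce a second decaying dual eigenvector.

  For the rotation number, B acts on directions with a lift that moves by a bounded amount around the
  linear drift deg(B) x / 2, so that orbits of the cocycle follow those of the constant matrix.
\<close>

subsection \<open>Fourier series in a strip\<close>

text \<open>Each loss of strip width has one source. In the nonresonant case B is read off from U
  directly, so the full width \<eta> survives. In the resonant case the Bezout argument counts zeros
  of U modulo 1, which are finite in number only on a smaller strip; \<eta>/2 is taken. The
  off-diagonal entry lives there, so its Fourier coefficients decay at the rate 3 \<eta>/8. The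
  hypothesis 8 \<beta> < \<eta> bounds the divisors below by a constant times exp(- \<eta> |k| / 8),
  and this loss fits between 3 \<eta>/8 and \<eta>/4. The factor exp(pi i k x) changes sign over one
  period when k is odd, which is why B is only PSL valued there. Uniqueness of decaying dual
  eigenvectors rests on the discrete Wronskian: it is constant, yet tends to 0 at infinity. Degree
  and rotation number are definite descriptions, so each needs existence and uniqueness. In
  particular one angle lift of the cocycle has to be constructed; otherwise the condition on the
  rotation number would be vacuous. All these comparisons of lifts rest on one fact: a continuous
  function with half-integer values on a connected set is constant.\<close>

definition ec :: "complex \<Rightarrow> complex" where
  "ec z = exp (2 * of_real pi * \<i> * z)"

lemma ec_add: "ec (a + b) = ec a * ec b"
  by (simp add: ec_def distrib_left exp_add)

lemma ec_0 [simp]: "ec 0 = 1"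
  by (simp add: ec_def)

lemma ec_nonzero [simp]: "ec z \<noteq> 0"
  by (simp add: ec_def)

lemma ec_minus: "ec (- z) = inverse (ec z)"
  by (simp add: ec_def exp_minus)

lemma ec_diff: "ec (a - b) = ec a / ec b"
  using ec_add[of a "- b"] by (simp add: ec_minus field_simps)

lemma norm_ec: "cmod (ec z) = exp (- 2 * pi * Im z)"
  by (simp add: ec_def)

lemma norm_ec_of_real [simp]: "cmod (ec (of_real x)) = 1"
  by (simp add: norm_ec)

lemma ec_eq_1_iff: "ec z = 1 \<longleftrightarrow> (\<exists>n::int. z = of_int n)"
proof
  assume "ec z = 1"
  then obtain n :: int where n: "Re (2 * of_real pi * \<i> * z) = 0"
      "Im (2 * of_real pi * \<i> * z) = of_int (2 * n) * pi"
    unfolding ec_def exp_eq_1 by auto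
  then have "Im z = 0" "Re z = of_int n"
    by simp_all
  then show "\<exists>n::int. z = of_int n"
    by (auto simp: complex_eq_iff)
next
  assume "\<exists>n::int. z = of_int n"
  then show "ec z = 1"
    by (auto simp: ec_def exp_eq_1)
qed

lemma ec_of_int [simp]: "ec (of_int n) = 1"
  by (auto simp: ec_eq_1_iff)

lemma ec_1 [simp]: "ec 1 = 1"
  using ec_of_int[of 1] by simp

lemma ec_eq_iff: "ec a = ec b \<longleftrightarrow> (\<exists>n::int. a = b + of_int n)"
proof -
  have "ec a = ec b \<longleftrightarrow> ec (a - b) = 1"
    by (simp add: ec_diff)
  also have "\<dots> \<longleftrightarrow> (\<exists>n::int. a = b + of_int n)"
    unfolding ec_eq_1_iff by (simp add: algebra_simps)
  finally show ?thesis .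
qed

lemma ec_half [simp]: "ec (1/2) = -1"
  by (simp add: ec_def mult.commute)

lemma cnj_ec: "cnj (ec z) = ec (- cnj z)"
  by (simp add: ec_def exp_cnj)

lemma ec_of_int_mult: "ec (of_int k * z) = ec z powi k"
  by (simp add: ec_def exp_power_int mult_ac)

lemma ec_holomorphic [holomorphic_intros]:
  "f holomorphic_on S \<Longrightarrow> (\<lambda>z. ec (f z)) holomorphic_on S"
  unfolding ec_def by (intro holomorphic_intros)

lemma ec_continuous [continuous_intros]:
  "continuous_on S f \<Longrightarrow> continuous_on S (\<lambda>z. ec (f z))"
  unfolding ec_def by (intro continuous_intros)

lemma ec_cos: "complex_of_real (2 * cos (2 * pi * x)) = ec (of_real x) + ec (- of_real x)"
  by (simp add: ec_def complex_eq_iff Re_exp Im_exp cos_of_real)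

lemma ec_eq_cis: "ec (of_real x) = cis (2 * pi * x)"
  by (simp add: ec_def cis_conv_exp mult_ac)

definition strip :: "real \<Rightarrow> complex set" where
  "strip r = {z. \<bar>Im z\<bar> < r}"

lemma strip_eq: "strip r = {z. Im z < r} \<inter> {z. Im z > - r}"
  by (auto simp: strip_def)

lemma open_strip [simp]: "open (strip r)"
  unfolding strip_eq by (intro open_Int open_halfspace_Im_lt open_halfspace_Im_gt)

lemma convex_strip: "convex (strip r)"
  unfolding strip_eq by (intro convex_Int convex_halfspace_Im_lt convex_halfspace_Im_gt)

lemma strip_add_real [simp]: "z + of_real a \<in> strip r \<longleftrightarrow> z \<in> strip r"
  "z - of_real a \<in> strip r \<longleftrightarrow> z \<in> strip r"
  by (auto simp: strip_def)

lemma of_real_in_strip: "r > 0 \<Longrightarrow> of_real x \<in> strip r"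
  by (simp add: strip_def)

text \<open>The factor 2 pi matches \<open>norm_ec\<close>: coefficients decaying at rate
  \<open>r\<close> give a Fourier series converging exactly in the range |Im z| < r.\<close>

definition exp_decay :: "real \<Rightarrow> (int \<Rightarrow> complex) \<Rightarrow> bool" where
  "exp_decay r c \<longleftrightarrow> (\<exists>C. \<forall>k. cmod (c k) \<le> C * exp (- 2 * pi * r * of_int \<bar>k\<bar>))"

definition fourier :: "(int \<Rightarrow> complex) \<Rightarrow> complex \<Rightarrow> complex" where
  "fourier c z = (\<Sum>\<^sub>\<infinity>k. c k * ec (of_int k * z))"

text \<open>The split into n and -1 - n counts index 0 once, and it matches the two halves of a
  Laurent expansion, whose powers start at 0 and at -1.\<close>

lemma has_sum_int_halves:
  fixes f :: "int \<Rightarrow> 'a :: {topological_comm_monoid_add, t2_space}"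
  assumes "((\<lambda>n::nat. f (int n)) has_sum S) UNIV"
    and "((\<lambda>n::nat. f (- 1 - int n)) has_sum T) UNIV"
  shows "(f has_sum (S + T)) UNIV"
proof -
  have U: "(UNIV :: int set) = range int \<union> range (\<lambda>n. - 1 - int n)"
  proof -
    have "k \<in> range int \<union> range (\<lambda>n. - 1 - int n)" for k :: int
    proof (cases "k \<ge> 0")
      case True
      then show ?thesis by (metis UnI1 nonneg_int_cases rangeI)
    next
      case False
      then have "k = - 1 - int (nat (- 1 - k))" by simp
      then show ?thesis by blast
    qed
    then show ?thesis by blast
  qed
  have "(f has_sum S) (range int)"
    using assms(1) by (subst has_sum_reindex) (auto simp: o_def inj_on_def)
  moreover have "(f has_sum T) (range (\<lambda>n. - 1 - int n))"
    using assms(2) by (subst has_sum_reindex) (auto simp: o_def inj_on_def)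
  moreover have "range int \<inter> range (\<lambda>n. - 1 - int n) = {}"
    by auto
  ultimately show ?thesis
    unfolding U by (rule has_sum_Un_disjoint)
qed

lemma summable_exp_abs_int:
  assumes "(r::real) > 0"
  shows "(\<lambda>k::int. exp (- r * of_int \<bar>k\<bar>)) summable_on UNIV"
proof -
  have q: "norm (exp (- r)) < 1" using assms by simp
  have g: "((\<lambda>n. exp (- r) ^ n) has_sum (\<Sum>n. exp (- r) ^ n)) UNIV"
    using q by (intro norm_summable_imp_has_sum summable_sums summable_geometric)
      (auto simp: summable_geometric)
  have e: "exp (- (r * real n)) = exp (- r) ^ n" for n
    by (simp add: exp_of_nat_mult [symmetric] mult.commute)
  have "((\<lambda>n::nat. exp (- r * of_int \<bar>int n\<bar>)) has_sum (\<Sum>n. exp (- r) ^ n)) UNIV"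
    using g by (simp add: e)
  moreover have "((\<lambda>n::nat. exp (- r * of_int \<bar>- 1 - int n\<bar>))
      has_sum (exp (- r) * (\<Sum>n. exp (- r) ^ n))) UNIV"
  proof -
    have "exp (- r * of_int \<bar>- 1 - int n\<bar>) = exp (- r) * exp (- r) ^ n" for n
    proof -
      have "\<bar>- 1 - int n\<bar> = int (Suc n)" by simp
      then show ?thesis using e[of "Suc n"] by (simp add: add.commute)
    qed
    then show ?thesis
      using has_sum_cmult_right[OF g, of "exp (- r)"] by simp
  qed
  ultimately show ?thesis
    unfolding summable_on_def by (intro exI, rule has_sum_int_halves)
qed

lemma exp_decay_nonneg:
  assumes "exp_decay r c"
  obtains C where "C \<ge> 0" "\<And>k. cmod (c k) \<le> C * exp (- 2 * pi * r * of_int \<bar>k\<bar>)"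
proof -
  obtain C where C: "\<And>k. cmod (c k) \<le> C * exp (- 2 * pi * r * of_int \<bar>k\<bar>)"
    using assms unfolding exp_decay_def by blast
  have "0 \<le> C"
    by (rule order_trans[OF norm_ge_zero C[of 0, simplified]])
  then show ?thesis using that C by blast
qed

text \<open>A majorant independent of z for |Im z| \<le> r', as the Weierstrass test requires; it is
  summable when r' < r.\<close>

lemma norm_fourier_term:
  assumes C: "\<And>k. cmod (c k) \<le> C * exp (- 2 * pi * r * of_int \<bar>k\<bar>)" "C \<ge> 0" and "\<bar>Im z\<bar> \<le> r'"
  shows "cmod (c k * ec (of_int k * z)) \<le> C * exp (- (2 * pi * (r - r')) * of_int \<bar>k\<bar>)"
proof -
  have "- (of_int k * Im z) \<le> r' * \<bar>of_int k\<bar>"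
  proof -
    have "- (of_int k * Im z) \<le> \<bar>of_int k * Im z\<bar>" by simp
    also have "\<dots> \<le> r' * \<bar>of_int k\<bar>"
      using assms(3) by (simp add: abs_mult mult_mono mult.commute)
    finally show ?thesis .
  qed
  then have "- (2 * pi * (of_int k * Im z)) \<le> 2 * pi * (r' * \<bar>of_int k\<bar>)"
    using mult_left_mono[of "- (of_int k * Im z)" "r' * \<bar>of_int k\<bar>" "2 * pi"] by simp
  then have "cmod (ec (of_int k * z)) \<le> exp (2 * pi * (r' * \<bar>of_int k\<bar>))"
    by (simp add: norm_ec mult.assoc)
  then have "cmod (c k) * cmod (ec (of_int k * z))
      \<le> (C * exp (- 2 * pi * r * of_int \<bar>k\<bar>)) * exp (2 * pi * (r' * \<bar>of_int k\<bar>))"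
    using C by (intro mult_mono) auto
  also have "\<dots> = C * exp (- (2 * pi * (r - r')) * of_int \<bar>k\<bar>)"
    by (simp add: exp_add [symmetric] algebra_simps)
  finally show ?thesis by (simp add: norm_mult)
qed

lemma fourier_has_sum:
  assumes "exp_decay r c" "z \<in> strip r"
  shows "((\<lambda>k. c k * ec (of_int k * z)) has_sum fourier c z) UNIV"
proof -
  obtain C where C: "C \<ge> 0" "\<And>k. cmod (c k) \<le> C * exp (- 2 * pi * r * of_int \<bar>k\<bar>)"
    using exp_decay_nonneg[OF assms(1)] by blast
  have "(\<lambda>k. C * exp (- (2 * pi * (r - \<bar>Im z\<bar>)) * of_int \<bar>k\<bar>)) summable_on UNIV"
    using assms(2) by (intro summable_on_cmult_right summable_exp_abs_int) (simp add: strip_def)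
  then have "(\<lambda>k. norm (c k * ec (of_int k * z))) summable_on UNIV"
    by (rule Infinite_Sum.abs_summable_on_comparison_test') (rule norm_fourier_term[OF C(2,1)], simp)
  then have "(\<lambda>k. c k * ec (of_int k * z)) summable_on UNIV"
    by (rule abs_summable_summable)
  then show ?thesis unfolding fourier_def by simp
qed

lemma fourier_holomorphic:
  assumes "exp_decay r c"
  shows "fourier c holomorphic_on strip r"
proof -
  have "\<forall>z\<in>strip r. \<exists>f'. (fourier c has_field_derivative f') (at z)"
  proof
    fix z assume z: "z \<in> strip r"
    then obtain d where d: "d > 0" "cball z d \<subseteq> strip r"
      using open_strip open_contains_cball by blast
    obtain C where C: "C \<ge> 0" "\<And>k. cmod (c k) \<le> C * exp (- 2 * pi * r * of_int \<bar>k\<bar>)"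
      using exp_decay_nonneg[OF assms] by blast
    define r' where "r' = \<bar>Im z\<bar> + d"
    \<comment> \<open>The highest and lowest points of the closed disc lie in the strip, which
      bounds |Im z| + d strictly by r.\<close>
    have r': "r' < r"
    proof -
      have "z + of_real d * \<i> \<in> cball z d" "z - of_real d * \<i> \<in> cball z d"
        using d(1) by (simp_all add: dist_norm norm_mult)
      then have "z + of_real d * \<i> \<in> strip r" "z - of_real d * \<i> \<in> strip r"
        using d(2) by blast+
      then show ?thesis by (auto simp: strip_def r'_def)
    qed
    have bd: "\<bar>Im w\<bar> \<le> r'" if "w \<in> cball z d" for w
    proof -
      have "\<bar>Im w - Im z\<bar> \<le> d"
        using that abs_Im_le_cmod[of "w - z"] by (simp add: dist_norm norm_minus_commute)
      then show ?thesis by (simp add: r'_def)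
    qed
    have "uniform_limit (cball z d) (\<lambda>X y. \<Sum>k\<in>X. c k * ec (of_int k * y))
        (\<lambda>y. \<Sum>\<^sub>\<infinity>k. c k * ec (of_int k * y)) (finite_subsets_at_top UNIV)"
    proof (rule Weierstrass_m_test_general)
      show "(\<lambda>k. C * exp (- (2 * pi * (r - r')) * of_int \<bar>k\<bar>)) summable_on UNIV"
        using r' by (intro summable_on_cmult_right summable_exp_abs_int) simp
    qed (rule norm_fourier_term[OF C(2,1)], rule bd)
    then have ul: "uniform_limit (cball z d) (\<lambda>X y. \<Sum>k\<in>X. c k * ec (of_int k * y))
        (fourier c) (finite_subsets_at_top UNIV)"
      by (simp add: fourier_def [abs_def])
    have "fourier c holomorphic_on ball z d"
      by (rule holomorphic_uniform_limit[OF _ ul])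
        (auto intro!: always_eventually continuous_intros holomorphic_intros)
    then show "\<exists>f'. (fourier c has_field_derivative f') (at z)"
      using d(1) by (meson centre_in_ball holomorphic_on_open open_ball)
  qed
  then show ?thesis
    by (simp add: holomorphic_on_open[OF open_strip])
qed

lemma fourier_periodic: "fourier c (z + 1) = fourier c z"
  by (simp add: fourier_def distrib_left ec_add)

lemma exp_decay_mono: "exp_decay r c \<Longrightarrow> r' \<le> r \<Longrightarrow> exp_decay r' c"
proof -
  assume "exp_decay r c" and le: "r' \<le> r"
  then obtain C where C: "C \<ge> 0" "\<And>k. cmod (c k) \<le> C * exp (- 2 * pi * r * of_int \<bar>k\<bar>)"
    using exp_decay_nonneg by blast
  have "cmod (c k) \<le> C * exp (- 2 * pi * r' * of_int \<bar>k\<bar>)" for k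
  proof -
    have "r' * \<bar>of_int k\<bar> \<le> r * \<bar>of_int k\<bar>" using le by (simp add: mult_right_mono)
    then have "exp (- 2 * pi * r * of_int \<bar>k\<bar>) \<le> exp (- 2 * pi * r' * of_int \<bar>k\<bar>)"
      by (simp add: mult.assoc)
    then show ?thesis using C(1) C(2)[of k] by (meson mult_left_mono order_trans)
  qed
  then show ?thesis unfolding exp_decay_def by blast
qed

lemma integral_ec_int:
  "((\<lambda>x. ec (of_int j * of_real x)) has_integral (if j = 0 then 1 else 0)) {0..1}"
proof (cases "j = 0")
  case True
  then show ?thesis using has_integral_const_real[of "1::complex" 0 1] by simp
next
  case False
  define a where "a = 2 * of_real pi * \<i> * of_int j"
  have a: "a \<noteq> 0" using False by (simp add: a_def)
  have eq: "ec (of_int j * of_real x) = exp (a * of_real x)" for x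
    by (simp add: ec_def a_def mult_ac)
  have "((\<lambda>x. exp (a * of_real x)) has_integral exp (a * of_real 1) / a - exp (a * of_real 0) / a) {0..1}"
    using a
    by (intro fundamental_theorem_of_calculus)
       (intro derivative_eq_intros has_complex_derivative_imp_has_vector_derivative [unfolded o_def] | simp)+
  moreover have "exp a = 1"
    using eq[of 1] by simp
  ultimately show ?thesis using False by (simp add: eq)
qed

text \<open>A finite partial sum containing the index m is uniformly small on the real line, and its
  integral against the m-th character is exactly \<open>c m\<close>. Working with a finite sum
  avoids integrating the series term by term.\<close>

lemma fourier_unique_zero:
  assumes "exp_decay r c" "r > 0" and zero: "\<And>x::real. fourier c (of_real x) = 0"
  shows "c m = 0"
proof (rule ccontr)
  assume "c m \<noteq> 0"
  \<comment> \<open>Any bound below |c m| would do: the integral over a period of length one gives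
    |c m| \<le> e.\<close>
  define e where "e = cmod (c m) / 2"
  have e: "e > 0" using \<open>c m \<noteq> 0\<close> by (simp add: e_def)
  obtain C where C: "C \<ge> 0" "\<And>k. cmod (c k) \<le> C * exp (- 2 * pi * r * of_int \<bar>k\<bar>)"
    using exp_decay_nonneg[OF assms(1)] by blast
  have "uniform_limit (range complex_of_real) (\<lambda>X y. \<Sum>k\<in>X. c k * ec (of_int k * y))
      (\<lambda>y. \<Sum>\<^sub>\<infinity>k. c k * ec (of_int k * y)) (finite_subsets_at_top UNIV)"
  proof (rule Weierstrass_m_test_general)
    show "(\<lambda>k. C * exp (- (2 * pi * (r - 0)) * of_int \<bar>k\<bar>)) summable_on UNIV"
      using assms(2) by (intro summable_on_cmult_right summable_exp_abs_int) simp
  qed (rule norm_fourier_term[OF C(2,1)], auto)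
  then have "\<forall>\<^sub>F X in finite_subsets_at_top UNIV. \<forall>y\<in>range complex_of_real.
      dist (\<Sum>k\<in>X. c k * ec (of_int k * y)) (\<Sum>\<^sub>\<infinity>k. c k * ec (of_int k * y)) < e"
    using e by (rule uniform_limitD)
  moreover have "\<forall>\<^sub>F X in finite_subsets_at_top UNIV. finite X \<and> m \<in> X"
    unfolding eventually_finite_subsets_at_top by (intro exI[of _ "{m}"]) auto
  ultimately have "\<forall>\<^sub>F X in finite_subsets_at_top UNIV. (\<forall>y\<in>range complex_of_real.
      dist (\<Sum>k\<in>X. c k * ec (of_int k * y)) (\<Sum>\<^sub>\<infinity>k. c k * ec (of_int k * y)) < e) \<and> finite X \<and> m \<in> X"
    by (rule eventually_conj)
  then obtain X where X: "\<forall>y\<in>range complex_of_real. dist (\<Sum>k\<in>X. c k * ec (of_int k * y)) (fourier c y) < e"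
      "finite X" "m \<in> X"
    unfolding fourier_def
    using eventually_happens'[OF finite_subsets_at_top_neq_bot] by blast
  have small: "cmod (\<Sum>k\<in>X. c k * ec (of_int k * of_real x)) \<le> e" for x
  proof -
    have "dist (\<Sum>k\<in>X. c k * ec (of_int k * of_real x)) (fourier c (of_real x)) < e"
      using X(1) by blast
    then show ?thesis by (simp add: zero)
  qed
  have "((\<lambda>x. \<Sum>k\<in>X. c k * ec (of_int (k - m) * of_real x)) has_integral
      (\<Sum>k\<in>X. c k * (if k - m = 0 then 1 else 0))) {0..1}"
    by (rule has_integral_sum[OF X(2)], rule has_integral_mult_right, rule integral_ec_int)
  moreover have "(\<Sum>k\<in>X. c k * (if k - m = 0 then 1 else 0)) = c m"
    using X(2,3) by (simp add: if_distrib sum.delta cong: if_cong)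
  moreover have "(\<Sum>k\<in>X. c k * ec (of_int (k - m) * of_real x))
      = ec (- (of_int m * of_real x)) * (\<Sum>k\<in>X. c k * ec (of_int k * of_real x))" for x
    by (simp add: sum_distrib_left ec_add [symmetric] algebra_simps)
  ultimately have I: "((\<lambda>x. ec (- (of_int m * of_real x)) * (\<Sum>k\<in>X. c k * ec (of_int k * of_real x)))
      has_integral c m) {0..1::real}"
    by simp
  have "cmod (c m) \<le> e * measure lborel (cbox 0 (1::real))"
  proof (rule has_integral_bound[OF _ I[unfolded box_real(2)[symmetric]]])
    fix x :: real
    have "cmod (ec (- (of_int m * of_real x))) = 1"
      by (simp add: norm_ec)
    then show "cmod (ec (- (of_int m * of_real x)) * (\<Sum>k\<in>X. c k * ec (of_int k * of_real x))) \<le> e"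
      using small[of x] by (simp add: norm_mult)
  qed (use e in simp)
  then show False using e \<open>c m \<noteq> 0\<close> by (simp add: e_def)
qed

section \<open>Periodic functions on a strip as functions on an annulus\<close>

definition annulus :: "real \<Rightarrow> complex set" where
  "annulus r = {w. exp (- 2 * pi * r) < cmod w \<and> cmod w < exp (2 * pi * r)}"

lemma open_annulus [simp]: "open (annulus r)"
  unfolding annulus_def by (intro open_Collect_conj open_Collect_less continuous_intros)

lemma connected_annulus_exp: "connected (annulus r)"
  using connected_annulus(1)[of "exp (- 2 * pi * r)" "0::complex" "exp (2 * pi * r)"]
  by (simp add: annulus_def)

lemma zero_notin_annulus [simp]: "0 \<notin> annulus r"
  by (simp add: annulus_def not_less)

lemma ec_in_annulus_iff [simp]: "ec z \<in> annulus r \<longleftrightarrow> z \<in> strip r"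
proof -
  have "- (pi * Im z) < pi * r \<longleftrightarrow> - Im z < r"
    using mult_less_cancel_left_pos[of pi "- Im z" r] by simp
  then show ?thesis by (auto simp: annulus_def strip_def norm_ec)
qed

lemma ec_Ln: "w \<noteq> 0 \<Longrightarrow> ec (Ln w / (2 * of_real pi * \<i>)) = w"
  by (simp add: ec_def)

lemma annulus_imp_ec:
  assumes "w \<in> annulus r"
  obtains z where "z \<in> strip r" "ec z = w"
proof -
  have "w \<noteq> 0" using assms by auto
  then have "ec (Ln w / (2 * of_real pi * \<i>)) = w" by (rule ec_Ln)
  then show ?thesis using that assms ec_in_annulus_iff by metis
qed

lemma periodic_add_of_int:
  assumes "\<And>z. z \<in> strip r \<Longrightarrow> F (z + 1) = F z" "z \<in> strip r"
  shows "F (z + of_int n) = F z"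
proof -
  have nat: "F (w + of_nat m) = F w" if "w \<in> strip r" for w m
  proof (induction m)
    case (Suc m)
    have "w + of_nat m \<in> strip r" using that by (simp add: strip_def)
    then have "F (w + of_nat m + 1) = F (w + of_nat m)" by (rule assms(1))
    then show ?case using Suc by (simp add: algebra_simps)
  qed simp
  show ?thesis
  proof (cases "n \<ge> 0")
    case True
    then show ?thesis using nat[OF assms(2), of "nat n"] by simp
  next
    case False
    have "z + of_int n \<in> strip r" using assms(2) by (simp add: strip_def)
    from nat[OF this, of "nat (- n)"] False show ?thesis by simp
  qed
qed

text \<open>Periodicity makes the value independent of the branch of the logarithm. Holomorphy is
  checked with two branches, cut along the negative and along the positive reals; the two slit
  annuli cover the annulus because 0 is not in it.\<close>

lemma periodic_strip_imp_annulus: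
  assumes F: "F holomorphic_on strip r" and per: "\<And>z. z \<in> strip r \<Longrightarrow> F (z + 1) = F z"
  obtains K where "K holomorphic_on annulus r" "\<And>z. z \<in> strip r \<Longrightarrow> K (ec z) = F z"
proof
  define K where "K = (\<lambda>w. F (Ln w / (2 * of_real pi * \<i>)))"
  have K: "K (ec z) = F z" if "z \<in> strip r" for z
  proof -
    have "ec (Ln (ec z) / (2 * of_real pi * \<i>)) = ec z" by (rule ec_Ln) simp
    then obtain n :: int where "Ln (ec z) / (2 * of_real pi * \<i>) = z + of_int n"
      unfolding ec_eq_iff by blast
    then show ?thesis unfolding K_def using periodic_add_of_int[of r F z n, OF per that] by simp
  qed
  then show "\<And>z. z \<in> strip r \<Longrightarrow> K (ec z) = F z" .
  have "K holomorphic_on annulus r - \<real>\<^sub>\<le>\<^sub>0"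
  proof -
    have "F \<circ> (\<lambda>w. Ln w / (2 * of_real pi * \<i>)) holomorphic_on annulus r - \<real>\<^sub>\<le>\<^sub>0"
    proof (rule holomorphic_on_compose_gen[OF _ F])
      show "(\<lambda>w. Ln w / (2 * of_real pi * \<i>)) ` (annulus r - \<real>\<^sub>\<le>\<^sub>0) \<subseteq> strip r"
      proof safe
        fix w assume w: "w \<in> annulus r" "w \<notin> \<real>\<^sub>\<le>\<^sub>0"
        then have "w \<noteq> 0" by auto
        then show "Ln w / (2 * of_real pi * \<i>) \<in> strip r"
          using w(1) ec_Ln[of w] by (metis ec_in_annulus_iff)
      qed
    qed (intro holomorphic_intros, auto)
    then show ?thesis by (simp add: K_def o_def)
  qed
  moreover have "K holomorphic_on annulus r - \<real>\<^sub>\<ge>\<^sub>0"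
  proof -
    \<comment> \<open>Since \<open>ec (1/2) = -1\<close>, adding 1/2 undoes the sign in
      \<open>Ln (- w)\<close>, giving a branch that is smooth across the negative axis.\<close>
    have e: "ec (Ln (- w) / (2 * of_real pi * \<i>) + 1/2) = w" if "w \<noteq> 0" for w
      using that by (simp only: ec_add ec_half) (simp add: ec_Ln)
    have "F \<circ> (\<lambda>w. Ln (- w) / (2 * of_real pi * \<i>) + 1/2) holomorphic_on annulus r - \<real>\<^sub>\<ge>\<^sub>0"
    proof (rule holomorphic_on_compose_gen[OF _ F])
      show "(\<lambda>w. Ln (- w) / (2 * of_real pi * \<i>) + 1/2) ` (annulus r - \<real>\<^sub>\<ge>\<^sub>0) \<subseteq> strip r"
      proof safe
        fix w assume w: "w \<in> annulus r" "w \<notin> \<real>\<^sub>\<ge>\<^sub>0"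
        then have "w \<noteq> 0" by auto
        then show "Ln (- w) / (2 * of_real pi * \<i>) + 1/2 \<in> strip r"
          using w(1) e[of w] by (metis ec_in_annulus_iff)
      qed
    qed (intro holomorphic_intros, auto simp: complex_nonpos_Reals_iff complex_nonneg_Reals_iff)
    moreover have "(F \<circ> (\<lambda>w. Ln (- w) / (2 * of_real pi * \<i>) + 1/2)) w = K w"
      if w: "w \<in> annulus r - \<real>\<^sub>\<ge>\<^sub>0" for w
    proof -
      have w0: "w \<noteq> 0" using w by auto
      let ?z = "Ln (- w) / (2 * of_real pi * \<i>) + 1/2"
      have "?z \<in> strip r" using w e[OF w0] by (metis DiffD1 ec_in_annulus_iff)
      from K[OF this] show ?thesis unfolding e[OF w0] by simp
    qed
    ultimately show ?thesis by (rule holomorphic_transform)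
  qed
  ultimately have "K holomorphic_on (annulus r - \<real>\<^sub>\<le>\<^sub>0) \<union> (annulus r - \<real>\<^sub>\<ge>\<^sub>0)"
    by (rule holomorphic_on_Un) (auto intro!: open_Diff)
  moreover have "(annulus r - \<real>\<^sub>\<le>\<^sub>0) \<union> (annulus r - \<real>\<^sub>\<ge>\<^sub>0) = annulus r"
  proof -
    have "w = 0" if "w \<in> \<real>\<^sub>\<le>\<^sub>0" "w \<in> \<real>\<^sub>\<ge>\<^sub>0" for w :: complex
      using that by (auto simp: complex_nonpos_Reals_iff complex_nonneg_Reals_iff complex_eq_iff)
    then have "annulus r \<inter> (\<real>\<^sub>\<le>\<^sub>0 \<inter> \<real>\<^sub>\<ge>\<^sub>0) = {}" using zero_notin_annulus[of r] by blast
    then show ?thesis by blast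
  qed
  ultimately show "K holomorphic_on annulus r" by simp
qed

section \<open>Laurent expansion and decay of Fourier coefficients\<close>

text \<open>Uniform convergence of the geometric series on the circle permits exchanging sum and
  integral. It serves both Laurent halves, with q = w0/w on the outer and q = w/w0 on the inner
  circle.\<close>

lemma contour_geometric_sums:
  assumes R: "R > 0" and h: "continuous_on (sphere 0 R) h" and q: "continuous_on (sphere 0 R) q"
    and \<rho>: "\<rho> < 1" "\<And>w. cmod w = R \<Longrightarrow> cmod (q w) \<le> \<rho>"
  shows "(\<lambda>n. contour_integral (circlepath 0 R) (\<lambda>w. h w * q w ^ n)) sums
           contour_integral (circlepath 0 R) (\<lambda>w. h w / (1 - q w))"
proof -
  have \<rho>0: "\<rho> \<ge> 0"
    using \<rho>(2)[of "of_real R"] R by (metis abs_of_pos norm_ge_zero norm_of_real order_trans)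
  have pi: "path_image (circlepath 0 R) = sphere 0 R" using R by simp
  have "compact (h ` sphere 0 R)"
    by (rule compact_continuous_image[OF h]) simp
  then obtain M where M: "\<And>w. cmod w = R \<Longrightarrow> cmod (h w) \<le> M"
    using compact_imp_bounded bounded_iff by (metis imageI mem_sphere_0)
  have M0: "M \<ge> 0"
    using M[of "of_real R"] R by (metis abs_of_pos norm_ge_zero norm_of_real order_trans)
  have int: "(\<lambda>w. h w * q w ^ n) contour_integrable_on circlepath 0 R" for n
    by (rule contour_integrable_continuous_circlepath) (use h q R in \<open>simp add: continuous_intros\<close>)
  have ul: "uniform_limit (sphere 0 R) (\<lambda>N w. \<Sum>n<N. h w * q w ^ n) (\<lambda>w. \<Sum>n. h w * q w ^ n) sequentially"
  proof (rule Weierstrass_m_test)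
    show "summable (\<lambda>n. M * \<rho> ^ n)"
      using \<rho>(1) \<rho>0 by (intro summable_mult summable_geometric) simp
    show "norm (h w * q w ^ n) \<le> M * \<rho> ^ n" if "w \<in> sphere 0 R" for n w
      using that M[of w] \<rho>(2)[of w] \<rho>0 M0 by (auto simp: norm_mult norm_power intro!: mult_mono power_mono)
  qed
  have ev: "(\<Sum>n. h w * q w ^ n) = h w / (1 - q w)" if "w \<in> sphere 0 R" for w
  proof -
    have "cmod (q w) < 1" using that \<rho> by fastforce
    then show ?thesis
      by (subst suminf_mult) (simp_all add: suminf_geometric summable_geometric divide_inverse)
  qed
  have ul': "uniform_limit (sphere 0 R) (\<lambda>N w. \<Sum>n<N. h w * q w ^ n) (\<lambda>w. h w / (1 - q w)) sequentially"
    by (rule uniform_limit_cong'[THEN iffD1, OF _ _ ul]) (simp_all add: ev)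
  have "((\<lambda>N. contour_integral (circlepath 0 R) (\<lambda>w. \<Sum>n<N. h w * q w ^ n))
      \<longlongrightarrow> contour_integral (circlepath 0 R) (\<lambda>w. h w / (1 - q w))) sequentially"
    by (rule contour_integral_uniform_limit_circlepath)
       (use R ul' int in \<open>auto intro!: always_eventually contour_integrable_sum\<close>)
  then show ?thesis
    unfolding sums_def by (simp add: contour_integral_sum int)
qed

text \<open>The difference quotient of K at w0 has a removable singularity, so its integrals over
  the two homotopic circles agree. Splitting off K w0 leaves the integrals of 1/(w - w0), which are
  2 pi i on the outer circle and 0 on the inner one.\<close>

lemma Cauchy_annulus:
  assumes K: "K holomorphic_on annulus r" and r': "0 < r'" "r' < r" and w0: "cmod w0 = 1"
  shows "2 * of_real pi * \<i> * K w0 =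
      contour_integral (circlepath 0 (exp (2 * pi * r'))) (\<lambda>w. K w / (w - w0))
      - contour_integral (circlepath 0 (exp (- 2 * pi * r'))) (\<lambda>w. K w / (w - w0))"
proof -
  define R S where "R = exp (2 * pi * r')" and "S = exp (- 2 * pi * r')"
  have RS: "R > 1" "0 < S" "S < 1" using r' by (simp_all add: R_def S_def)
  have sub: "sphere 0 \<rho> \<subseteq> annulus r" if "S \<le> \<rho>" "\<rho> \<le> R" for \<rho>
  proof
    fix w :: complex assume "w \<in> sphere 0 \<rho>"
    then have "cmod w = \<rho>" by simp
    moreover have "exp (- 2 * pi * r) < S" "R < exp (2 * pi * r)"
      using r' by (simp_all add: R_def S_def)
    ultimately show "w \<in> annulus r" using that by (simp add: annulus_def)
  qed
  define D where "D = (\<lambda>w. if w = w0 then deriv K w0 else (K w - K w0) / (w - w0))"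
  have D: "D holomorphic_on annulus r"
    unfolding D_def by (rule pole_lemma_open[OF K]) simp
  \<comment> \<open>Points with equal parameter lie on the same ray from 0, so the segment between
    them only changes the modulus, from \<open>S\<close> to \<open>R\<close>.\<close>
  have hom: "homotopic_loops (annulus r) (circlepath 0 R) (circlepath 0 S)"
  proof (rule homotopic_loops_linear)
    fix t :: real
    show "closed_segment (circlepath 0 R t) (circlepath 0 S t) \<subseteq> annulus r"
    proof
      fix z assume "z \<in> closed_segment (circlepath 0 R t) (circlepath 0 S t)"
      then obtain u where u: "0 \<le> u" "u \<le> 1"
        "z = (1 - u) *\<^sub>R circlepath 0 R t + u *\<^sub>R circlepath 0 S t"
        by (auto simp: closed_segment_def)
      define \<rho> where "\<rho> = (1 - u) * R + u * S"
      have "z = of_real \<rho> * exp (2 * of_real pi * \<i> * of_real t)"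
        unfolding u(3) by (simp add: circlepath scaleR_conv_of_real \<rho>_def algebra_simps)
      moreover have "S \<le> \<rho>" "\<rho> \<le> R"
        using RS u(1,2) convex_bound_le[of R R S "1 - u" u] convex_bound_le[of "-R" "-S" "-S" "1 - u" u]
        by (simp_all add: \<rho>_def)
      ultimately show "z \<in> annulus r"
        using sub[of \<rho>] RS by (auto simp: norm_mult)
    qed
  qed auto
  have "contour_integral (circlepath 0 R) D = contour_integral (circlepath 0 S) D"
    by (rule Cauchy_theorem_homotopic_loops[OF hom _ D]) auto
  moreover have Dint: "contour_integral (circlepath 0 \<rho>) D =
      contour_integral (circlepath 0 \<rho>) (\<lambda>w. K w / (w - w0))
      - K w0 * contour_integral (circlepath 0 \<rho>) (\<lambda>w. 1 / (w - w0))"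
    if "\<rho> = R \<or> \<rho> = S" for \<rho>
  proof -
    have \<rho>: "\<rho> > 0" "\<rho> \<noteq> 1" "S \<le> \<rho>" "\<rho> \<le> R" using that RS by auto
    have pi: "path_image (circlepath 0 \<rho>) = sphere 0 \<rho>" using \<rho> by simp
    have ne: "w - w0 \<noteq> 0" if "w \<in> sphere 0 \<rho>" for w using that w0 \<rho> by auto
    have cK: "continuous_on (sphere 0 \<rho>) K"
      using K sub[OF \<rho>(3,4)] holomorphic_on_imp_continuous_on continuous_on_subset by blast
    have i1: "(\<lambda>w. K w / (w - w0)) contour_integrable_on circlepath 0 \<rho>"
      by (rule contour_integrable_continuous_circlepath) (use cK ne \<rho>(1) in \<open>auto intro!: continuous_intros\<close>)
    have i2: "(\<lambda>w. 1 / (w - w0)) contour_integrable_on circlepath 0 \<rho>"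
      by (rule contour_integrable_continuous_circlepath) (use ne \<rho>(1) in \<open>auto intro!: continuous_intros\<close>)
    have "contour_integral (circlepath 0 \<rho>) D =
        contour_integral (circlepath 0 \<rho>) (\<lambda>w. K w / (w - w0) - K w0 * (1 / (w - w0)))"
      by (rule contour_integral_cong) (use ne \<rho>(1) in \<open>auto simp: D_def diff_divide_distrib\<close>)
    also have "\<dots> = contour_integral (circlepath 0 \<rho>) (\<lambda>w. K w / (w - w0))
        - contour_integral (circlepath 0 \<rho>) (\<lambda>w. K w0 * (1 / (w - w0)))"
      by (rule contour_integral_diff[OF i1 contour_integrable_lmul[OF i2]])
    also have "contour_integral (circlepath 0 \<rho>) (\<lambda>w. K w0 * (1 / (w - w0)))
        = K w0 * contour_integral (circlepath 0 \<rho>) (\<lambda>w. 1 / (w - w0))"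
      by (rule contour_integral_lmul[OF i2])
    finally show ?thesis .
  qed
  moreover have "contour_integral (circlepath 0 R) (\<lambda>w. 1 / (w - w0)) = 2 * of_real pi * \<i>"
    using Cauchy_integral_circlepath_simple[of "\<lambda>_. 1" 0 R w0] w0 RS
    by (auto intro!: contour_integral_unique)
  moreover have "contour_integral (circlepath 0 S) (\<lambda>w. 1 / (w - w0)) = 0"
  proof (rule contour_integral_unique[OF Cauchy_theorem_disc_simple])
    show "(\<lambda>w. 1 / (w - w0)) holomorphic_on ball 0 1"
      using w0 by (intro holomorphic_intros) auto
  qed (use RS in auto)
  ultimately show ?thesis
    using Dint[of R] Dint[of S] by (simp add: R_def S_def algebra_simps)
qed

text \<open>These are the Laurent coefficients of the function transported to the annulus.
  Integrating over the circles of radius exp(2 pi r') and exp(- 2 pi r') produces precisely the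
  decay rate r'; both circles must lie inside the annulus, hence r' < r.\<close>

lemma fourier_expansion:
  assumes F: "F holomorphic_on strip r" and per: "\<And>z. z \<in> strip r \<Longrightarrow> F (z + 1) = F z"
    and r': "0 < r'" "r' < r"
  obtains c where "exp_decay r' c" "\<And>x::real. F (of_real x) = fourier c (of_real x)"
proof -
  obtain K where K: "K holomorphic_on annulus r" "\<And>z. z \<in> strip r \<Longrightarrow> K (ec z) = F z"
    using periodic_strip_imp_annulus[OF F per] by blast
  define R S where "R = exp (2 * pi * r')" and "S = exp (- 2 * pi * r')"
  have RS: "R > 1" "0 < S" "S < 1" using r' by (simp_all add: R_def S_def)
  have cK: "continuous_on (sphere 0 \<rho>) K" if "S \<le> \<rho>" "\<rho> \<le> R" for \<rho>
  proof -
    have "exp (- 2 * pi * r) < S" "R < exp (2 * pi * r)"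
      using r' by (simp_all add: R_def S_def)
    then have "sphere 0 \<rho> \<subseteq> annulus r"
      using that by (auto simp: annulus_def)
    then show ?thesis
      using K holomorphic_on_imp_continuous_on continuous_on_subset by blast
  qed
  have "bounded (K ` (sphere 0 R \<union> sphere 0 S))"
    using cK[of R] cK[of S] RS unfolding image_Un
    by (intro bounded_Un[THEN iffD2] conjI compact_imp_bounded compact_continuous_image) auto
  then obtain M0 where M0: "\<And>w. w \<in> sphere 0 R \<union> sphere 0 S \<Longrightarrow> cmod (K w) \<le> M0"
    unfolding bounded_iff by blast
  define M where "M = max M0 0"
  have M: "M \<ge> 0" "\<And>w. cmod w = R \<Longrightarrow> cmod (K w) \<le> M" "\<And>w. cmod w = S \<Longrightarrow> cmod (K w) \<le> M"
    using M0 by (force simp: M_def)+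
  \<comment> \<open>Up to the factor 2 pi i, \<open>p n\<close> is the Laurent coefficient of index
    n and \<open>m n\<close> the one of index -1 - n.\<close>
  define p where "p = (\<lambda>n. contour_integral (circlepath 0 R) (\<lambda>w. K w / w * (1 / w) ^ n))"
  define m where "m = (\<lambda>n. contour_integral (circlepath 0 S) (\<lambda>w. K w * w ^ n))"
  have pint: "(\<lambda>w. K w / w * (1 / w) ^ n) contour_integrable_on circlepath 0 R" for n
    by (rule contour_integrable_continuous_circlepath)
      (use cK[of R] RS in \<open>auto intro!: continuous_intros\<close>)
  have mint: "(\<lambda>w. K w * w ^ n) contour_integrable_on circlepath 0 S" for n
    by (rule contour_integrable_continuous_circlepath)
      (use cK[of S] RS in \<open>auto intro!: continuous_intros\<close>)
  have pb: "cmod (p n) \<le> 2 * pi * M * (1 / R) ^ n" for n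
  proof -
    have "cmod (p n) \<le> (M / R * (1 / R) ^ n) * (2 * pi * R)"
    proof (rule has_contour_integral_bound_circlepath)
      show "((\<lambda>w. K w / w * (1 / w) ^ n) has_contour_integral p n) (circlepath 0 R)"
        unfolding p_def by (rule has_contour_integral_integral[OF pint])
      show "cmod (K w / w * (1 / w) ^ n) \<le> M / R * (1 / R) ^ n" if "cmod (w - 0) = R" for w
        using that M(2)[of w] RS
        by (auto simp: norm_mult norm_divide norm_power intro!: mult_right_mono divide_right_mono)
    qed (use RS M in auto)
    then show ?thesis using RS by (simp add: field_simps)
  qed
  have mb: "cmod (m n) \<le> 2 * pi * M * S ^ Suc n" for n
  proof -
    have "cmod (m n) \<le> (M * S ^ n) * (2 * pi * S)"
    proof (rule has_contour_integral_bound_circlepath)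
      show "((\<lambda>w. K w * w ^ n) has_contour_integral m n) (circlepath 0 S)"
        unfolding m_def by (rule has_contour_integral_integral[OF mint])
      show "cmod (K w * w ^ n) \<le> M * S ^ n" if "cmod (w - 0) = S" for w
        using that M(3)[of w] RS
        by (auto simp: norm_mult norm_divide norm_power intro!: mult_right_mono divide_right_mono)
    qed (use RS M in auto)
    then show ?thesis by (simp add: field_simps)
  qed
  define c where "c k = (if k \<ge> 0 then p (nat k) else m (nat (- 1 - k))) / (2 * of_real pi * \<i>)" for k :: int
  have decay: "exp_decay r' c"
    unfolding exp_decay_def
  proof (intro exI[of _ M] allI)
    fix k :: int
    have eR: "(1 / R) ^ n = exp (- 2 * pi * r' * real n)" for n
      by (simp add: R_def exp_minus [symmetric] exp_of_nat_mult [symmetric] divide_inverse mult_ac)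
    have eS: "S ^ n = exp (- 2 * pi * r' * real n)" for n
      by (simp add: S_def exp_of_nat_mult [symmetric] mult_ac)
    show "cmod (c k) \<le> M * exp (- 2 * pi * r' * of_int \<bar>k\<bar>)"
    proof (cases "k \<ge> 0")
      case True
      then have "cmod (c k) = cmod (p (nat k)) / (2 * pi)" by (simp add: c_def norm_divide norm_mult)
      also have "\<dots> \<le> (2 * pi * M * (1 / R) ^ nat k) / (2 * pi)"
        by (rule divide_right_mono[OF pb]) simp
      also have "\<dots> = M * exp (- 2 * pi * r' * of_int \<bar>k\<bar>)"
        unfolding eR using True by simp
      finally show ?thesis .
    next
      case False
      then have "cmod (c k) = cmod (m (nat (- 1 - k))) / (2 * pi)" by (simp add: c_def norm_divide norm_mult)
      also have "\<dots> \<le> (2 * pi * M * S ^ Suc (nat (- 1 - k))) / (2 * pi)"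
        by (rule divide_right_mono[OF mb]) simp
      also have "Suc (nat (- 1 - k)) = nat \<bar>k\<bar>" using False by simp
      also have "(2 * pi * M * S ^ nat \<bar>k\<bar>) / (2 * pi) = M * exp (- 2 * pi * r' * of_int \<bar>k\<bar>)"
        unfolding eS by simp
      finally show ?thesis .
    qed
  qed
  have "F (of_real x) = fourier c (of_real x)" for x
  proof -
    define w0 where "w0 = ec (of_real x)"
    have w0: "cmod w0 = 1" "w0 \<noteq> 0" by (simp_all add: w0_def)
    let ?t = "\<lambda>k. c k * ec (of_int k * of_real x)"
    have hs: "(?t has_sum fourier c (of_real x)) UNIV"
      using fourier_has_sum[OF decay of_real_in_strip[OF r'(1)]] .
    then have sm: "?t summable_on A" for A
      using summable_on_subset[of ?t UNIV A] by (auto simp: summable_on_def)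
    \<comment> \<open>The contour computation only yields convergence in the order of the index.
      Unordered summability is already known from the decay of the coefficients, so the ordered sum
      identifies the unordered one.\<close>
    have half: "((\<lambda>n::nat. ?t (g n)) has_sum T) UNIV" if "inj g" "(\<lambda>n. ?t (g n)) sums T" for g T
    proof -
      have "(\<lambda>n. ?t (g n)) summable_on UNIV"
        using sm[of "range g"] summable_on_reindex[OF that(1), of ?t] by (simp add: o_def)
      then obtain T' where "((\<lambda>n. ?t (g n)) has_sum T') UNIV" unfolding summable_on_def by blast
      moreover from this have "T' = T" using has_sum_imp_sums sums_unique2 that(2) by blast
      ultimately show ?thesis by simp
    qed
    have A: "(\<lambda>n. ?t (int n)) sums (contour_integral (circlepath 0 R) (\<lambda>w. K w / (w - w0)) / (2 * of_real pi * \<i>))"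
    proof -
      have "(\<lambda>n. contour_integral (circlepath 0 R) (\<lambda>w. K w / w * (w0 / w) ^ n)) sums
         contour_integral (circlepath 0 R) (\<lambda>w. K w / w / (1 - w0 / w))"
        by (rule contour_geometric_sums[where \<rho> = "1 / R"])
          (use RS cK[of R] w0 in \<open>auto intro!: continuous_intros simp: norm_divide\<close>)
      moreover have "contour_integral (circlepath 0 R) (\<lambda>w. K w / w * (w0 / w) ^ n) = w0 ^ n * p n" for n
      proof -
        have "contour_integral (circlepath 0 R) (\<lambda>w. K w / w * (w0 / w) ^ n)
            = contour_integral (circlepath 0 R) (\<lambda>w. w0 ^ n * (K w / w * (1 / w) ^ n))"
          by (simp add: power_divide mult_ac)
        then show ?thesis unfolding p_def by (simp only: contour_integral_lmul[OF pint])
      qed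
      moreover have "contour_integral (circlepath 0 R) (\<lambda>w. K w / w / (1 - w0 / w))
          = contour_integral (circlepath 0 R) (\<lambda>w. K w / (w - w0))"
        by (rule contour_integral_cong) (use RS w0 in \<open>auto simp: field_simps\<close>)
      ultimately have "(\<lambda>n. w0 ^ n * p n) sums contour_integral (circlepath 0 R) (\<lambda>w. K w / (w - w0))"
        by simp
      from sums_divide[OF this, of "2 * of_real pi * \<i>"] show ?thesis
        using ec_of_int_mult[of "int _" "of_real x"] by (simp add: c_def w0_def mult_ac)
    qed
    \<comment> \<open>On the inner circle |w| < |w0|, so the kernel is expanded in powers of w/w0;
      one extra factor 1/w0 accounts for the start at index -1.\<close>
    have B: "(\<lambda>n. ?t (- 1 - int n)) sums (- contour_integral (circlepath 0 S) (\<lambda>w. K w / (w - w0)) / (2 * of_real pi * \<i>))"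
    proof -
      have "(\<lambda>n. contour_integral (circlepath 0 S) (\<lambda>w. K w / w0 * (w / w0) ^ n)) sums
         contour_integral (circlepath 0 S) (\<lambda>w. K w / w0 / (1 - w / w0))"
        by (rule contour_geometric_sums[where \<rho> = S])
          (use RS cK[of S] w0 in \<open>auto intro!: continuous_intros simp: norm_divide\<close>)
      moreover have "contour_integral (circlepath 0 S) (\<lambda>w. K w / w0 * (w / w0) ^ n) = inverse w0 ^ Suc n * m n" for n
      proof -
        have "contour_integral (circlepath 0 S) (\<lambda>w. K w / w0 * (w / w0) ^ n)
            = contour_integral (circlepath 0 S) (\<lambda>w. inverse w0 ^ Suc n * (K w * w ^ n))"
          by (simp add: power_divide divide_inverse power_mult_distrib power_inverse mult_ac)
        then show ?thesis unfolding m_def by (simp only: contour_integral_lmul[OF mint])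
      qed
      moreover have "contour_integral (circlepath 0 S) (\<lambda>w. K w / w0 / (1 - w / w0))
          = - contour_integral (circlepath 0 S) (\<lambda>w. K w / (w - w0))"
      proof -
        have "contour_integral (circlepath 0 S) (\<lambda>w. K w / w0 / (1 - w / w0))
          = contour_integral (circlepath 0 S) (\<lambda>w. (-1) * (K w / (w - w0)))"
        proof (rule contour_integral_cong)
          fix w assume "w \<in> path_image (circlepath 0 S)"
          then have "w \<noteq> w0" using RS w0 by auto
          then have "w0 - w \<noteq> 0" "w - w0 \<noteq> 0" by auto
          then show "K w / w0 / (1 - w / w0) = (-1) * (K w / (w - w0))"
            using w0(2) by (simp add: divide_simps) (simp add: algebra_simps)
        qed simp
        also have "\<dots> = (-1) * contour_integral (circlepath 0 S) (\<lambda>w. K w / (w - w0))"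
          by (rule contour_integral_lmul, rule contour_integrable_continuous_circlepath)
            (use cK[of S] RS w0 in \<open>auto intro!: continuous_intros\<close>)
        finally show ?thesis by simp
      qed
      ultimately have "(\<lambda>n. inverse w0 ^ Suc n * m n) sums - contour_integral (circlepath 0 S) (\<lambda>w. K w / (w - w0))"
        by simp
      from sums_divide[OF this, of "2 * of_real pi * \<i>"]
      have "(\<lambda>n. inverse w0 ^ Suc n * m n / (2 * of_real pi * \<i>)) sums
        (- contour_integral (circlepath 0 S) (\<lambda>w. K w / (w - w0)) / (2 * of_real pi * \<i>))" .
      moreover have "inverse w0 ^ Suc n * m n / (2 * of_real pi * \<i>) = ?t (- 1 - int n)" for n
      proof -
        have "ec (of_int (- 1 - int n) * of_real x) = w0 powi (- int (Suc n))"
          unfolding w0_def by (subst ec_of_int_mult [symmetric]) simp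
        also have "\<dots> = inverse w0 ^ Suc n"
          by (simp only: power_int_minus power_int_of_nat power_inverse)
        finally have e: "ec (of_int (- 1 - int n) * of_real x) = inverse w0 ^ Suc n" .
        show ?thesis unfolding e by (simp add: c_def)
      qed
      ultimately show ?thesis by simp
    qed
    have "(?t has_sum (contour_integral (circlepath 0 R) (\<lambda>w. K w / (w - w0)) / (2 * of_real pi * \<i>)
        + - contour_integral (circlepath 0 S) (\<lambda>w. K w / (w - w0)) / (2 * of_real pi * \<i>))) UNIV"
      by (rule has_sum_int_halves; rule half) (use A B in \<open>auto simp: inj_on_def\<close>)
    then have "fourier c (of_real x) = contour_integral (circlepath 0 R) (\<lambda>w. K w / (w - w0)) / (2 * of_real pi * \<i>)
        + - contour_integral (circlepath 0 S) (\<lambda>w. K w / (w - w0)) / (2 * of_real pi * \<i>)"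
      using hs has_sum_unique by blast
    also have "\<dots> = K w0"
      using Cauchy_annulus[OF K(1) r' w0(1)] unfolding R_def S_def
      by (simp add: field_simps)
    also have "\<dots> = F (of_real x)"
      unfolding w0_def by (rule K(2)) (use r' in \<open>simp add: strip_def\<close>)
    finally show ?thesis by simp
  qed
  then show ?thesis using decay that by blast
qed

section \<open>Real functions with a holomorphic extension to a strip\<close>

text \<open>Stated for one real function at a time, so that it is closed under sums, products and
  shifts; the matrix version is recovered entrywise.\<close>

definition strip_ext :: "real \<Rightarrow> (real \<Rightarrow> real) \<Rightarrow> bool" where
  "strip_ext r h \<longleftrightarrow>
     (\<exists>F. F holomorphic_on strip r \<and> (\<forall>x. F (of_real x) = complex_of_real (h x)))"

text \<open>The real part on the line extends as the average of F(z) and the conjugate of F at the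
  conjugate point, which is holomorphic because the strip is symmetric.\<close>

lemma strip_ext_Re:
  assumes "F holomorphic_on strip r"
  shows "strip_ext r (\<lambda>x. Re (F (of_real x)))"
proof -
  have "cnj ` strip r = strip r"
  proof -
    have "strip r \<subseteq> cnj ` strip r"
    proof
      fix z assume "z \<in> strip r"
      then have "cnj z \<in> strip r" "z = cnj (cnj z)" by (auto simp: strip_def)
      then show "z \<in> cnj ` strip r" by blast
    qed
    then show ?thesis by (auto simp: strip_def)
  qed
  then have "cnj \<circ> F \<circ> cnj holomorphic_on strip r"
    using assms by (intro holomorphic_on_compose_cnj_cnj) simp_all
  then have "(\<lambda>z. (F z + (cnj \<circ> F \<circ> cnj) z) / 2) holomorphic_on strip r"
    using assms unfolding o_def by (intro holomorphic_intros) simp_all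
  moreover have "(F (of_real x) + (cnj \<circ> F \<circ> cnj) (of_real x)) / 2 = of_real (Re (F (of_real x)))" for x
    by (simp add: complex_eq_iff)
  ultimately show ?thesis unfolding strip_ext_def by blast
qed

lemma strip_ext_const: "strip_ext r (\<lambda>x. c)"
  unfolding strip_ext_def by (rule exI[of _ "\<lambda>_. of_real c"]) auto

lemma strip_ext_add: "strip_ext r f \<Longrightarrow> strip_ext r g \<Longrightarrow> strip_ext r (\<lambda>x. f x + g x)"
  unfolding strip_ext_def by (elim exE, rule_tac x = "\<lambda>z. F z + Fa z" in exI) (auto intro: holomorphic_on_add)

lemma strip_ext_mult: "strip_ext r f \<Longrightarrow> strip_ext r g \<Longrightarrow> strip_ext r (\<lambda>x. f x * g x)"
  unfolding strip_ext_def by (elim exE, rule_tac x = "\<lambda>z. F z * Fa z" in exI) (auto intro: holomorphic_on_mult)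

lemma strip_ext_cmult: "strip_ext r f \<Longrightarrow> strip_ext r (\<lambda>x. c * f x)"
  using strip_ext_mult[OF strip_ext_const] by blast

lemma strip_ext_diff: "strip_ext r f \<Longrightarrow> strip_ext r g \<Longrightarrow> strip_ext r (\<lambda>x. f x - g x)"
  using strip_ext_add[OF _ strip_ext_cmult[of r g "-1"]] by simp

lemma strip_ext_shift: "strip_ext r f \<Longrightarrow> strip_ext r (\<lambda>x. f (x + a))"
proof -
  assume "strip_ext r f"
  then obtain F where F: "F holomorphic_on strip r" "\<And>x. F (of_real x) = complex_of_real (f x)"
    unfolding strip_ext_def by blast
  have "(F \<circ> (\<lambda>z. z + of_real a)) holomorphic_on strip r"
    by (rule holomorphic_on_compose_gen[OF _ F(1)]) (auto intro!: holomorphic_intros)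
  moreover have "(F \<circ> (\<lambda>z. z + of_real a)) (of_real x) = complex_of_real (f (x + a))" for x
    using F(2)[of "x + a"] by simp
  ultimately show ?thesis unfolding strip_ext_def by blast
qed

lemma strip_ext_mono: "strip_ext r f \<Longrightarrow> r' \<le> r \<Longrightarrow> strip_ext r' f"
proof -
  assume "strip_ext r f" and le: "r' \<le> r"
  then obtain F where F: "F holomorphic_on strip r" "\<forall>x. F (of_real x) = complex_of_real (f x)"
    unfolding strip_ext_def by blast
  have "strip r' \<subseteq> strip r" using le by (auto simp: strip_def)
  then have "F holomorphic_on strip r'" using F(1) holomorphic_on_subset by blast
  then show ?thesis using F(2) unfolding strip_ext_def by blast
qed

lemma strip_ext_imp_continuous:
  assumes "strip_ext r h" "r > 0"
  shows "continuous_on UNIV h"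
proof -
  obtain F where F: "F holomorphic_on strip r" "\<And>x. F (of_real x) = complex_of_real (h x)"
    using assms unfolding strip_ext_def by blast
  have "continuous_on UNIV (\<lambda>x. F (complex_of_real x))"
    by (rule continuous_on_compose2[OF holomorphic_on_imp_continuous_on[OF F(1)]])
      (auto intro!: continuous_intros of_real_in_strip assms(2))
  then have "continuous_on UNIV (\<lambda>x. Re (F (complex_of_real x)))"
    by (intro continuous_intros)
  then show ?thesis by (simp add: F(2))
qed

lemma analytic_in_stripI:
  assumes "\<And>i j. strip_ext \<delta> (\<lambda>x. B x $ i $ j)"
  shows "analytic_in_strip \<delta> B"
proof -
  obtain G where G: "\<And>i j. G i j holomorphic_on strip \<delta>"
    "\<And>i j x. G i j (of_real x) = complex_of_real (B x $ i $ j)"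
    using assms unfolding strip_ext_def by metis
  define F where "F = (\<lambda>z. \<chi> i j. G i j z)"
  have "(\<lambda>z. F z $ i $ j) analytic_on {z. \<bar>Im z\<bar> < \<delta>}" for i j
    using G(1)[of i j] open_strip[of \<delta>] analytic_on_open
    by (simp add: F_def strip_def)
  moreover have "F (of_real x) $ i $ j = complex_of_real (B x $ i $ j)" for x i j
    by (simp add: F_def G(2))
  ultimately show ?thesis unfolding analytic_in_strip_def by blast
qed

text \<open>Periodicity on the real line spreads to the strip by the identity theorem, so an
  extension need not be chosen periodic.\<close>

lemma fourier_expansion_real:
  assumes F: "F holomorphic_on strip r" and per: "\<And>x::real. F (of_real (x + 1)) = F (of_real x)"
    and r': "0 < r'" "r' < r"
  obtains c where "exp_decay r' c" "\<And>x::real. F (of_real x) = fourier c (of_real x)"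
proof -
  have r: "r > 0" using r' by simp
  have "F (z + 1) = F z" if "z \<in> strip r" for z
  proof -
    have "(F \<circ> (\<lambda>z. z + 1)) holomorphic_on strip r"
      by (rule holomorphic_on_compose_gen[OF _ F]) (auto intro!: holomorphic_intros simp: strip_def)
    then have hol: "(\<lambda>z. F (z + 1) - F z) holomorphic_on strip r"
      using F by (auto simp: o_def intro!: holomorphic_intros)
    have lim: "0 islimpt range complex_of_real"
    proof (rule islimptI)
      fix T :: "complex set" assume "0 \<in> T" "open T"
      then obtain e where e: "e > 0" "ball 0 e \<subseteq> T" using open_contains_ball by blast
      have "complex_of_real (e/2) \<in> ball 0 e" "complex_of_real (e/2) \<noteq> 0" using e(1) by auto
      then show "\<exists>y\<in>range complex_of_real. y \<in> T \<and> y \<noteq> 0" using e(2) by blast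
    qed
    moreover have "F (w + 1) - F w = 0" if "w \<in> range complex_of_real" for w
      using that per by force
    moreover have "range complex_of_real \<subseteq> strip r"
      using of_real_in_strip[OF r] by blast
    moreover have "0 \<in> strip r" using r by (simp add: strip_def)
    ultimately have "F (z + 1) - F z = 0"
      using analytic_continuation[OF hol open_strip convex_connected[OF convex_strip],
          of "range complex_of_real" 0 z] that by blast
    then show ?thesis by simp
  qed
  from fourier_expansion[OF F this r'] show ?thesis using that by metis
qed

lemma strip_ext_fourier_expansion:
  assumes "strip_ext r h" and per: "\<And>x. h (x + 1) = h x" and r': "0 < r'" "r' < r"
  obtains c where "exp_decay r' c" "\<And>x::real. complex_of_real (h x) = fourier c (of_real x)"
proof -
  obtain F where F: "F holomorphic_on strip r" "\<And>x. F (of_real x) = complex_of_real (h x)"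
    using assms unfolding strip_ext_def by blast
  obtain c where "exp_decay r' c" "\<And>x::real. F (of_real x) = fourier c (of_real x)"
    using fourier_expansion_real[OF F(1) _ r'] per unfolding F(2) by metis
  then show ?thesis using that F(2) by metis
qed

subsection \<open>Bezout identities for holomorphic functions\<close>

text \<open>Subtracting a multiple of the syzygy (g, -f) makes the coefficient of f vanish at z,
  so that it absorbs one more factor.\<close>
lemma Bezout_power:
  assumes S: "open S" "z \<in> S" and f: "f holomorphic_on S" and g: "g holomorphic_on S" "g z \<noteq> 0"
    and "\<exists>a b. a holomorphic_on S \<and> b holomorphic_on S \<and> (\<forall>w\<in>S. a w * f w + b w * g w = 1)"
  shows "\<exists>a b. a holomorphic_on S \<and> b holomorphic_on S \<and> (\<forall>w\<in>S. a w * ((w - z) ^ n * f w) + b w * g w = 1)"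
proof (induction n)
  case 0
  then show ?case using assms(6) by simp
next
  case (Suc n)
  then obtain a b where ab: "a holomorphic_on S" "b holomorphic_on S"
    "\<And>w. w \<in> S \<Longrightarrow> a w * ((w - z) ^ n * f w) + b w * g w = 1" by blast
  \<comment> \<open>The choice makes \<open>h\<close> vanish at z. It is possible only because g z
    is nonzero: here the absence of a common zero enters.\<close>
  define t where "t = a z / g z"
  define h where "h = (\<lambda>w. a w - t * g w)"
  have h: "h holomorphic_on S" unfolding h_def by (intro holomorphic_intros ab g)
  have hz: "h z = 0" using g(2) by (simp add: h_def t_def)
  define a' where "a' = (\<lambda>w. if w = z then deriv h z else (h w - h z) / (w - z))"
  have a': "a' holomorphic_on S" unfolding a'_def by (rule pole_lemma_open[OF h S(1)])
  have ah: "a' w * (w - z) = h w" for w by (auto simp: a'_def hz)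
  define b' where "b' = (\<lambda>w. b w + t * ((w - z) ^ n * f w))"
  have b': "b' holomorphic_on S" unfolding b'_def by (intro holomorphic_intros ab f)
  have "a' w * ((w - z) ^ Suc n * f w) + b' w * g w = 1" if "w \<in> S" for w
  proof -
    have "a' w * ((w - z) ^ Suc n * f w) + b' w * g w = (a' w * (w - z)) * ((w - z) ^ n * f w) + b' w * g w"
      by simp
    also have "\<dots> = a w * ((w - z) ^ n * f w) + b w * g w"
      unfolding ah by (simp add: h_def b'_def algebra_simps)
    finally show ?thesis using ab(3)[OF that] by simp
  qed
  then show ?case using a' b' by blast
qed

text \<open>The local cofactor and the quotient of f by the power of w - z agree on the punctured
  ball, so they glue to a holomorphic cofactor on all of S.\<close>

lemma factor_zero_global:
  assumes S: "open S" "connected S" "z \<in> S" and f: "f holomorphic_on S" "f z = 0" "\<not> f constant_on S"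
  obtains n h where "n > 0" "h holomorphic_on S" "h z \<noteq> 0" "\<And>w. w \<in> S \<Longrightarrow> f w = (w - z) ^ n * h w"
proof -
  obtain g r n where gr: "0 < n" "0 < r" "ball z r \<subseteq> S" "g holomorphic_on ball z r"
      "\<And>w. w \<in> ball z r \<Longrightarrow> f w = (w - z) ^ n * g w"
      "\<And>w. w \<in> ball z r \<Longrightarrow> g w \<noteq> 0"
    using holomorphic_factor_zero_nonconstant[OF f(1) S f(2,3)] by metis
  define h where "h = (\<lambda>w. if w \<in> ball z r then g w else f w / (w - z) ^ n)"
  have "h holomorphic_on ball z r"
    by (rule holomorphic_transform[OF gr(4)]) (simp add: h_def)
  moreover have "h holomorphic_on S - {z}"
  proof (rule holomorphic_transform[where f = "\<lambda>w. f w / (w - z) ^ n"])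
    show "(\<lambda>w. f w / (w - z) ^ n) holomorphic_on S - {z}"
      by (intro holomorphic_intros holomorphic_on_subset[OF f(1)]) auto
    show "f w / (w - z) ^ n = h w" if "w \<in> S - {z}" for w
      using that gr(5)[of w] by (auto simp: h_def)
  qed
  ultimately have "h holomorphic_on ball z r \<union> (S - {z})"
    by (rule holomorphic_on_Un) (use S(1) in auto)
  moreover have "ball z r \<union> (S - {z}) = S" using gr(2,3) S(3) by auto
  ultimately have "h holomorphic_on S" by simp
  moreover have "h z \<noteq> 0" using gr(2,6) by (simp add: h_def)
  moreover have "f w = (w - z) ^ n * h w" if "w \<in> S" for w
    using gr(1,2) gr(5)[of w] f(2) by (auto simp: h_def)
  ultimately show ?thesis using that gr(1) by blast
qed

text \<open>Induction on the number of zeros of f. A zero is split off with its full multiplicity,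
  the cofactor has fewer zeros, and \<open>Bezout_power\<close> puts the factor back. Without zeros,
  a = 1/f and b = 0 suffice.\<close>

lemma Bezout_holomorphic:
  assumes S: "open S" "connected S" and f: "f holomorphic_on S" and g: "g holomorphic_on S"
    and "finite {w\<in>S. f w = 0}" and "\<And>w. w \<in> S \<Longrightarrow> f w = 0 \<Longrightarrow> g w \<noteq> 0"
  shows "\<exists>a b. a holomorphic_on S \<and> b holomorphic_on S \<and> (\<forall>w\<in>S. a w * f w + b w * g w = 1)"
proof -
  have "\<forall>f. card {w\<in>S. f w = 0} = N \<longrightarrow> f holomorphic_on S \<longrightarrow> finite {w\<in>S. f w = 0}
      \<longrightarrow> (\<forall>w\<in>S. f w = 0 \<longrightarrow> g w \<noteq> 0)
      \<longrightarrow> (\<exists>a b. a holomorphic_on S \<and> b holomorphic_on S \<and> (\<forall>w\<in>S. a w * f w + b w * g w = 1))" for N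
  proof (induction N rule: less_induct)
    case (less N)
    show ?case
    proof (intro allI impI)
      fix f assume N: "card {w\<in>S. f w = 0} = N" and f: "f holomorphic_on S"
        and fin: "finite {w\<in>S. f w = 0}" and ng: "\<forall>w\<in>S. f w = 0 \<longrightarrow> g w \<noteq> 0"
      show "\<exists>a b. a holomorphic_on S \<and> b holomorphic_on S \<and> (\<forall>w\<in>S. a w * f w + b w * g w = 1)"
      proof (cases "\<exists>z\<in>S. f z = 0")
        case False
        then have "(\<lambda>w. 1 / f w) holomorphic_on S" "(\<lambda>w. 0) holomorphic_on S"
          using f by (auto intro!: holomorphic_intros)
        moreover have "\<forall>w\<in>S. 1 / f w * f w + 0 * g w = 1" using False by auto
        ultimately show ?thesis by (intro exI[of _ "\<lambda>w. 1 / f w"] exI[of _ "\<lambda>w. 0"]) auto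
      next
        case True
        then obtain z where z: "z \<in> S" "f z = 0" by blast
        have "\<not> f constant_on S"
        proof
          assume "f constant_on S"
          then have "{w\<in>S. f w = 0} = S" using z unfolding constant_on_def by auto
          then have "finite S" using fin by simp
          then show False using S(1) z(1) finite_imp_not_open by blast
        qed
        then obtain n h where nh: "n > 0" "h holomorphic_on S" "h z \<noteq> 0"
          "\<And>w. w \<in> S \<Longrightarrow> f w = (w - z) ^ n * h w"
          using factor_zero_global[OF S z(1) f z(2)] by metis
        have sub: "{w\<in>S. h w = 0} \<subset> {w\<in>S. f w = 0}"
          using nh z by auto
        then have c: "card {w\<in>S. h w = 0} < N" using psubset_card_mono[OF fin sub] N by simp
        have "finite {w\<in>S. h w = 0}" using sub fin finite_subset by blast
        moreover have "\<forall>w\<in>S. h w = 0 \<longrightarrow> g w \<noteq> 0" using ng sub by blast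
        ultimately have "\<exists>a b. a holomorphic_on S \<and> b holomorphic_on S \<and> (\<forall>w\<in>S. a w * h w + b w * g w = 1)"
          using less.IH[OF c, rule_format, OF refl nh(2)] by blast
        from Bezout_power[OF S(1) z(1) nh(2) g _ this, of n]
        have "\<exists>a b. a holomorphic_on S \<and> b holomorphic_on S \<and> (\<forall>w\<in>S. a w * ((w - z) ^ n * h w) + b w * g w = 1)"
          using ng z by blast
        then show ?thesis using nh(4) by simp
      qed
    qed
  qed
  then show ?thesis using assms(3,5,6) by blast
qed

subsection \<open>The dual eigenvalue equation\<close>

text \<open>The difference of the two sides of the dual eigenvalue equation, kept as a sequence: it
  decays with \<open>v\<close>, so its vanishing can be tested on its Fourier series.\<close>

definition dual_defect :: "real \<Rightarrow> real \<Rightarrow> real \<Rightarrow> real \<Rightarrow> (int \<Rightarrow> complex) \<Rightarrow> int \<Rightarrow> complex" where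
  "dual_defect lam \<alpha> \<theta> E v k =
     of_real lam * (v (k + 1) + v (k - 1))
     + of_real (2 * cos (2 * pi * (\<theta> + of_int k * \<alpha>))) * v k - of_real E * v k"

lemma exp_decay_bound_mult:
  assumes "exp_decay r v" and "\<And>k. cmod (w k) \<le> M * cmod (v k)" "M \<ge> 0"
  shows "exp_decay r w"
proof -
  obtain C where C: "C \<ge> 0" "\<And>k. cmod (v k) \<le> C * exp (- 2 * pi * r * of_int \<bar>k\<bar>)"
    using exp_decay_nonneg[OF assms(1)] by blast
  have "cmod (w k) \<le> (M * C) * exp (- 2 * pi * r * of_int \<bar>k\<bar>)" for k
    using assms(2)[of k] mult_left_mono[OF C(2)[of k] assms(3)] by (simp add: mult.assoc)
  then show ?thesis unfolding exp_decay_def by blast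
qed

lemma exp_decay_shift:
  assumes "exp_decay r v" "r \<ge> 0"
  shows "exp_decay r (\<lambda>k. v (k + j))"
proof -
  obtain C where C: "C \<ge> 0" "\<And>k. cmod (v k) \<le> C * exp (- 2 * pi * r * of_int \<bar>k\<bar>)"
    using exp_decay_nonneg[OF assms(1)] by blast
  have "cmod (v (k + j)) \<le> (C * exp (2 * pi * r * of_int \<bar>j\<bar>)) * exp (- 2 * pi * r * of_int \<bar>k\<bar>)" for k
  proof -
    have "real_of_int \<bar>k\<bar> - real_of_int \<bar>j\<bar> \<le> real_of_int \<bar>k + j\<bar>" by linarith
    then have "(2 * pi * r) * (real_of_int \<bar>k\<bar> - real_of_int \<bar>j\<bar>) \<le> (2 * pi * r) * real_of_int \<bar>k + j\<bar>"
      using assms(2) by (intro mult_left_mono) auto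
    then have "exp (- 2 * pi * r * of_int \<bar>k + j\<bar>) \<le> exp (2 * pi * r * of_int \<bar>j\<bar> + - 2 * pi * r * of_int \<bar>k\<bar>)"
      by (simp add: algebra_simps)
    then have "C * exp (- 2 * pi * r * of_int \<bar>k + j\<bar>)
        \<le> C * (exp (2 * pi * r * of_int \<bar>j\<bar>) * exp (- 2 * pi * r * of_int \<bar>k\<bar>))"
      unfolding exp_add using C(1) by (rule mult_left_mono)
    then show ?thesis using C(2)[of "k + j"] by (simp add: mult.assoc)
  qed
  then show ?thesis unfolding exp_decay_def by blast
qed

lemma exp_decay_reflect:
  assumes "exp_decay r v"
  shows "exp_decay r (\<lambda>k. v (- k))"
proof -
  obtain C where C: "\<And>k. cmod (v k) \<le> C * exp (- 2 * pi * r * of_int \<bar>k\<bar>)"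
    using assms unfolding exp_decay_def by blast
  have "cmod (v (- k)) \<le> C * exp (- 2 * pi * r * of_int \<bar>k\<bar>)" for k
    using C[of "- k"] by simp
  then show ?thesis unfolding exp_decay_def by blast
qed

lemma exp_decay_add:
  assumes "exp_decay r c" "exp_decay r d"
  shows "exp_decay r (\<lambda>k. c k + d k)"
proof -
  obtain C where C: "\<And>k. cmod (c k) \<le> C * exp (- 2 * pi * r * of_int \<bar>k\<bar>)"
    using assms(1) unfolding exp_decay_def by blast
  obtain D where D: "\<And>k. cmod (d k) \<le> D * exp (- 2 * pi * r * of_int \<bar>k\<bar>)"
    using assms(2) unfolding exp_decay_def by blast
  have "cmod (c k + d k) \<le> (C + D) * exp (- 2 * pi * r * of_int \<bar>k\<bar>)" for k
    using C[of k] D[of k] norm_triangle_ineq[of "c k" "d k"] unfolding distrib_right by linarith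
  then show ?thesis unfolding exp_decay_def by blast
qed

text \<open>Makes \<open>fourier_unique_zero\<close> applicable to the defect: a functional equation
  on the real line is thereby turned back into the dual eigenvalue equation.\<close>

lemma exp_decay_dual_defect:
  assumes "exp_decay r v" "r \<ge> 0"
  shows "exp_decay r (dual_defect lam \<alpha> \<theta> E v)"
proof -
  have 1: "exp_decay r (\<lambda>k. of_real lam * (v (k + 1) + v (k + (-1))))"
  proof (rule exp_decay_bound_mult[where M = "\<bar>lam\<bar>"])
    show "exp_decay r (\<lambda>k. v (k + 1) + v (k + (-1)))"
      using assms by (intro exp_decay_add exp_decay_shift) auto
  qed (simp_all only: norm_mult norm_of_real order_refl abs_ge_zero)
  have 2: "exp_decay r (\<lambda>k. (of_real (2 * cos (2 * pi * (\<theta> + of_int k * \<alpha>))) - of_real E) * v k)"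
  proof (rule exp_decay_bound_mult[where M = "2 + \<bar>E\<bar>", OF assms(1)])
    fix k
    let ?c = "2 * cos (2 * pi * (\<theta> + of_int k * \<alpha>))"
    have "cmod (of_real ?c - of_real E) \<le> \<bar>?c\<bar> + \<bar>E\<bar>"
      using norm_triangle_ineq4[of "complex_of_real ?c" "of_real E"] by (simp only: norm_of_real)
    also have "\<bar>?c\<bar> \<le> 2" using abs_cos_le_one[of "2 * pi * (\<theta> + of_int k * \<alpha>)"] by linarith
    finally show "cmod ((of_real ?c - of_real E) * v k) \<le> (2 + \<bar>E\<bar>) * cmod (v k)"
      unfolding norm_mult by (intro mult_right_mono) auto
  qed simp
  have "dual_defect lam \<alpha> \<theta> E v = (\<lambda>k. of_real lam * (v (k + 1) + v (k + (-1)))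
      + (of_real (2 * cos (2 * pi * (\<theta> + of_int k * \<alpha>))) - of_real E) * v k)"
    by (simp add: dual_defect_def fun_eq_iff algebra_simps)
  then show ?thesis using exp_decay_add[OF 1 2] by simp
qed

text \<open>Aubry duality at the level of series: index shifts become multiplication by
  \<open>ec z\<close> and \<open>ec (- z)\<close>, and the cosine, split into two exponentials,
  becomes translation by \<alpha> and - \<alpha> with phases
  \<open>ec (\<plusminus> \<theta>)\<close>.\<close>

lemma fourier_dual_defect:
  assumes v: "exp_decay r v" and z: "z \<in> strip r"
  shows "fourier (dual_defect lam \<alpha> \<theta> E v) z =
     of_real lam * (ec z + ec (- z)) * fourier v z
     + ec (of_real \<theta>) * fourier v (z + of_real \<alpha>) + ec (- of_real \<theta>) * fourier v (z - of_real \<alpha>)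
     - of_real E * fourier v z"
proof -
  have h: "((\<lambda>k. v k * ec (of_int k * w)) has_sum fourier v w) UNIV" if "w \<in> strip r" for w
    by (rule fourier_has_sum[OF v that])
  have up: "((\<lambda>k. v (k - 1) * ec (of_int k * z)) has_sum (ec z * fourier v z)) UNIV"
  proof -
    have "((\<lambda>k. ec z * (v k * ec (of_int k * z))) has_sum (ec z * fourier v z)) UNIV"
      by (rule has_sum_cmult_right[OF h[OF z]])
    also have "?this \<longleftrightarrow> ?thesis"
      by (rule has_sum_reindex_bij_witness[of _ "\<lambda>k. k - 1" "\<lambda>k. k + 1"])
        (auto simp: distrib_right ec_add)
    finally show ?thesis .
  qed
  have dn: "((\<lambda>k. v (k + 1) * ec (of_int k * z)) has_sum (ec (- z) * fourier v z)) UNIV"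
  proof -
    have "((\<lambda>k. ec (- z) * (v k * ec (of_int k * z))) has_sum (ec (- z) * fourier v z)) UNIV"
      by (rule has_sum_cmult_right[OF h[OF z]])
    also have "?this \<longleftrightarrow> ?thesis"
      by (rule has_sum_reindex_bij_witness[of _ "\<lambda>k. k + 1" "\<lambda>k. k - 1"])
        (auto simp: left_diff_distrib ec_diff ec_minus field_simps)
    finally show ?thesis .
  qed
  have sh: "((\<lambda>k. v k * ec (of_int k * (z + of_real a))) has_sum fourier v (z + of_real a)) UNIV" for a
    by (rule h) (simp add: z)
  have "((\<lambda>k. of_real lam * (v (k - 1) * ec (of_int k * z) + v (k + 1) * ec (of_int k * z))
       + (ec (of_real \<theta>) * (v k * ec (of_int k * (z + of_real \<alpha>)))
         + ec (- of_real \<theta>) * (v k * ec (of_int k * (z + of_real (- \<alpha>)))))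
       + (- of_real E) * (v k * ec (of_int k * z))) has_sum
      (of_real lam * (ec z * fourier v z + ec (- z) * fourier v z)
       + (ec (of_real \<theta>) * fourier v (z + of_real \<alpha>) + ec (- of_real \<theta>) * fourier v (z + of_real (- \<alpha>)))
       + (- of_real E) * fourier v z)) UNIV"
    by (intro has_sum_add has_sum_cmult_right up dn sh h z)
  moreover have "of_real lam * (v (k - 1) * ec (of_int k * z) + v (k + 1) * ec (of_int k * z))
       + (ec (of_real \<theta>) * (v k * ec (of_int k * (z + of_real \<alpha>)))
         + ec (- of_real \<theta>) * (v k * ec (of_int k * (z + of_real (- \<alpha>)))))
       + (- of_real E) * (v k * ec (of_int k * z)) = dual_defect lam \<alpha> \<theta> E v k * ec (of_int k * z)" for k
  proof -
    let ?e = "ec (of_real \<theta>) * ec (of_int k * of_real \<alpha>)"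
    have "ec (of_real (\<theta> + of_int k * \<alpha>)) = ?e" by (simp add: ec_add)
    moreover have "ec (- of_real (\<theta> + of_int k * \<alpha>)) = ec (- of_real \<theta>) * ec (of_int k * of_real (- \<alpha>))"
      by (simp add: ec_add [symmetric] algebra_simps)
    ultimately have "complex_of_real (2 * cos (2 * pi * (\<theta> + of_int k * \<alpha>)))
        = ?e + ec (- of_real \<theta>) * ec (of_int k * of_real (- \<alpha>))"
      by (simp only: ec_cos)
    then show ?thesis
      unfolding dual_defect_def by (simp only: distrib_left ec_add) (simp add: algebra_simps)
  qed
  ultimately have "fourier (dual_defect lam \<alpha> \<theta> E v) z =
      of_real lam * (ec z * fourier v z + ec (- z) * fourier v z)
       + (ec (of_real \<theta>) * fourier v (z + of_real \<alpha>) + ec (- of_real \<theta>) * fourier v (z + of_real (- \<alpha>)))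
       + (- of_real E) * fourier v z"
    unfolding fourier_def[of "dual_defect lam \<alpha> \<theta> E v"] by (simp add: infsumI)
  then show ?thesis by (simp add: algebra_simps)
qed

text \<open>The discrete Wronskian of two solutions does not depend on k, while decay forces it to 0
  as k tends to infinity.\<close>

lemma dual_eq_Wronskian:
  assumes lam: "lam \<noteq> 0" and r: "r > 0" and u: "exp_decay r u" and v: "exp_decay r v"
    and eu: "\<And>k. dual_defect lam \<alpha> \<theta> E u k = 0" and ev: "\<And>k. dual_defect lam \<alpha> \<theta> E v k = 0"
  shows "u (k + 1) * v k = u k * v (k + 1)"
proof -
  define W where "W k = u (k + 1) * v k - u k * v (k + 1)" for k
  have step: "W k = W (k - 1)" for k
  proof -
    define c where "c = complex_of_real (2 * cos (2 * pi * (\<theta> + of_int k * \<alpha>))) - of_real E"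
    have 1: "of_real lam * (u (k + 1) + u (k - 1)) = - c * u k"
      using eu[of k] by (simp add: dual_defect_def c_def algebra_simps eq_neg_iff_add_eq_0)
    have 2: "of_real lam * (v (k + 1) + v (k - 1)) = - c * v k"
      using ev[of k] by (simp add: dual_defect_def c_def algebra_simps eq_neg_iff_add_eq_0)
    have "of_real lam * (W k - W (k - 1)) =
        (of_real lam * (u (k + 1) + u (k - 1))) * v k - u k * (of_real lam * (v (k + 1) + v (k - 1)))"
      by (simp add: W_def algebra_simps)
    also have "\<dots> = 0" unfolding 1 2 by simp
    finally show ?thesis using lam by simp
  qed
  have const: "W k = W 0" for k
    by (induction k rule: int_induct[of _ 0]) (use step in \<open>simp_all, metis add_diff_cancel_right'\<close>)
  obtain C where C: "C \<ge> 0" "\<And>k. cmod (u k) \<le> C * exp (- 2 * pi * r * of_int \<bar>k\<bar>)"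
    using exp_decay_nonneg[OF u] by blast
  obtain D where D: "D \<ge> 0" "\<And>k. cmod (v k) \<le> D * exp (- 2 * pi * r * of_int \<bar>k\<bar>)"
    using exp_decay_nonneg[OF v] by blast
  have Db: "cmod (v k) \<le> D" for k
  proof -
    have "exp (- 2 * pi * r * of_int \<bar>k\<bar>) \<le> 1" using r by simp
    then have "D * exp (- 2 * pi * r * of_int \<bar>k\<bar>) \<le> D" using D(1) mult_left_le by blast
    then show ?thesis using D(2)[of k] by simp
  qed
  have uto: "(\<lambda>n. u (int n + a)) \<longlonglongrightarrow> 0" if "a \<ge> 0" for a
  proof (rule Lim_null_comparison)
    have q: "exp (- 2 * pi * r) < 1" using r by simp
    then show "(\<lambda>n. C * exp (- 2 * pi * r) ^ n) \<longlonglongrightarrow> 0"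
      by (intro tendsto_mult_right_zero LIMSEQ_power_zero) simp
    show "\<forall>\<^sub>F n in sequentially. norm (u (int n + a)) \<le> C * exp (- 2 * pi * r) ^ n"
    proof (rule always_eventually, rule allI)
      fix n
      have "real n \<le> real_of_int \<bar>int n + a\<bar>" using that by simp
      then have "(2 * pi * r) * real n \<le> (2 * pi * r) * real_of_int \<bar>int n + a\<bar>"
        using r by (intro mult_left_mono) auto
      then have "exp (- 2 * pi * r * of_int \<bar>int n + a\<bar>) \<le> exp (- 2 * pi * r) ^ n"
        by (simp add: exp_of_nat_mult [symmetric] mult_ac)
      then show "norm (u (int n + a)) \<le> C * exp (- 2 * pi * r) ^ n"
        using C(1) C(2)[of "int n + a"] by (meson mult_left_mono order_trans)
    qed
  qed
  have "(\<lambda>n. W (int n)) \<longlonglongrightarrow> 0"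
  proof (rule Lim_null_comparison)
    have "(\<lambda>n. norm (u (int n + 1)) * D + norm (u (int n + 0)) * D) \<longlonglongrightarrow> 0 * D + 0 * D"
      by (intro tendsto_intros tendsto_norm_zero uto) auto
    then show "(\<lambda>n. norm (u (int n + 1)) * D + norm (u (int n)) * D) \<longlonglongrightarrow> 0" by simp
    show "\<forall>\<^sub>F n in sequentially. norm (W (int n)) \<le> norm (u (int n + 1)) * D + norm (u (int n)) * D"
    proof (rule always_eventually, rule allI)
      fix n
      have "norm (W (int n)) \<le> norm (u (int n + 1) * v (int n)) + norm (u (int n) * v (int n + 1))"
        unfolding W_def by (rule norm_triangle_ineq4)
      also have "\<dots> \<le> norm (u (int n + 1)) * D + norm (u (int n)) * D"
        unfolding norm_mult by (intro add_mono mult_left_mono Db) auto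
      finally show "norm (W (int n)) \<le> norm (u (int n + 1)) * D + norm (u (int n)) * D" .
    qed
  qed
  moreover have "(\<lambda>n. W (int n)) = (\<lambda>n. W 0)" by (rule ext, rule const)
  ultimately have "(\<lambda>n::nat. W 0) \<longlonglongrightarrow> 0" by (simp only:)
  then have "W 0 = 0" by (simp only: LIMSEQ_const_iff)
  then have "W k = 0" using const[of k] by simp
  then show ?thesis by (simp add: W_def)
qed

text \<open>With c matched at k0, the vanishing Wronskian makes v - c u vanish at k0 + 1 as well,
  and a solution of a second order recurrence with two consecutive zeros is zero; \<open>lam\<close>
  nonzero lets the recurrence run both ways.\<close>

lemma dual_eigenvector_unique:
  assumes lam: "lam \<noteq> 0" and r: "r > 0" and u: "exp_decay r u" and v: "exp_decay r v"
    and eu: "\<And>k. dual_defect lam \<alpha> \<theta> E u k = 0" and ev: "\<And>k. dual_defect lam \<alpha> \<theta> E v k = 0"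
    and ne: "u k0 \<noteq> 0"
  obtains c where "\<And>k. v k = c * u k"
proof
  define c where "c = v k0 / u k0"
  define d where "d k = v k - c * u k" for k
  have d0: "d k0 = 0" using ne by (simp add: d_def c_def)
  have d1: "d (k0 + 1) = 0"
    using dual_eq_Wronskian[OF lam r u v eu ev, of k0] ne by (simp add: d_def c_def field_simps)
  have ed: "of_real lam * (d (k + 1) + d (k - 1)) =
      - (of_real (2 * cos (2 * pi * (\<theta> + of_int k * \<alpha>))) - of_real E) * d k" for k
  proof -
    have "dual_defect lam \<alpha> \<theta> E d k = dual_defect lam \<alpha> \<theta> E v k - c * dual_defect lam \<alpha> \<theta> E u k"
      by (simp add: dual_defect_def d_def algebra_simps)
    then have "dual_defect lam \<alpha> \<theta> E d k = 0" by (simp add: eu ev)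
    then show ?thesis by (simp add: dual_defect_def algebra_simps eq_neg_iff_add_eq_0)
  qed
  have "d k = 0 \<and> d (k + 1) = 0" for k
  proof (induction k rule: int_induct[of _ k0])
    case base
    then show ?case using d0 d1 by simp
  next
    case (step1 i)
    then show ?case using ed[of "i + 1"] lam by (simp add: add.assoc)
  next
    case (step2 i)
    then show ?case using ed[of i] lam by simp
  qed
  then show "v k = c * u k" for k by (simp add: d_def)
qed

lemma irrational_multiple_not_int:
  assumes "\<alpha> \<notin> \<rat>" "of_int k * \<alpha> = (of_int l :: real)"
  shows "k = 0"
proof (rule ccontr)
  assume "k \<noteq> 0"
  then have "\<alpha> = of_int l / of_int k" using assms(2) by (simp add: field_simps)
  then show False using assms(1) by simp
qed

text \<open>A common zero propagates along its rotation orbit, which accumulates on a circle in the annulus.\<close>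
lemma cocycle_nonvanishing:
  assumes irr: "\<alpha> \<notin> \<rat>" and r: "r > 0" and u: "exp_decay r u" "u k0 \<noteq> 0"
    and eu: "\<And>k. dual_defect lam \<alpha> \<theta> E u k = 0"
    and z: "z \<in> strip r" and z0: "fourier u z = 0" "fourier u (z - of_real \<alpha>) = 0"
  shows False
proof -
  have fe: "of_real lam * (ec w + ec (- w)) * fourier u w
     + ec (of_real \<theta>) * fourier u (w + of_real \<alpha>) + ec (- of_real \<theta>) * fourier u (w - of_real \<alpha>)
     - of_real E * fourier u w = 0" if "w \<in> strip r" for w
  proof -
    have "dual_defect lam \<alpha> \<theta> E u = (\<lambda>_. 0)" using eu by auto
    then have "fourier (dual_defect lam \<alpha> \<theta> E u) w = 0" by (simp add: fourier_def)
    then show ?thesis using fourier_dual_defect[OF u(1) that] by simp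
  qed
  \<comment> \<open>The functional equation determines the next value from two consecutive ones,
    since \<open>ec \<theta>\<close> is nonzero.\<close>
  have orb: "fourier u (z + of_nat n * of_real \<alpha>) = 0 \<and> fourier u (z + of_nat n * of_real \<alpha> - of_real \<alpha>) = 0" for n
  proof (induction n)
    case 0
    then show ?case using z0 by simp
  next
    case (Suc n)
    let ?w = "z + of_nat n * of_real \<alpha>"
    have "?w \<in> strip r" using z by (simp add: strip_def)
    from fe[OF this] Suc have "fourier u (?w + of_real \<alpha>) = 0" by simp
    then show ?case using Suc by (simp add: algebra_simps)
  qed
  obtain K where K: "K holomorphic_on annulus r" "\<And>w. w \<in> strip r \<Longrightarrow> K (ec w) = fourier u w"
    using periodic_strip_imp_annulus[OF fourier_holomorphic[OF u(1)]] fourier_periodic by metis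
  define P where "P = range (\<lambda>n::nat. ec (z + of_nat n * of_real \<alpha>))"
  have "inj (\<lambda>n::nat. ec (z + of_nat n * of_real \<alpha>))"
  proof (rule injI)
    fix m n :: nat assume "ec (z + of_nat m * of_real \<alpha>) = ec (z + of_nat n * of_real \<alpha>)"
    then obtain l :: int where "z + of_nat m * of_real \<alpha> = z + of_nat n * of_real \<alpha> + of_int l"
      unfolding ec_eq_iff by blast
    then have "complex_of_real (of_int (int m - int n) * \<alpha>) = complex_of_real (of_int l)"
      by (simp add: algebra_simps)
    then have "of_int (int m - int n) * \<alpha> = of_int l" unfolding of_real_eq_iff .
    then have "int m - int n = 0" by (rule irrational_multiple_not_int[OF irr])
    then show "m = n" by simp
  qed
  then have "infinite P" unfolding P_def using infinite_UNIV_nat finite_imageD by blast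
  have Psub: "P \<subseteq> sphere 0 (cmod (ec z))"
    by (auto simp: P_def norm_ec)
  have Ssub: "sphere 0 (cmod (ec z)) \<subseteq> annulus r"
    using z ec_in_annulus_iff[of z r] by (auto simp: annulus_def)
  obtain \<xi> where \<xi>: "\<xi> \<in> sphere 0 (cmod (ec z))" "\<xi> islimpt P"
    using compact_eq_Bolzano_Weierstrass[of "sphere 0 (cmod (ec z))"] \<open>infinite P\<close> Psub by auto
  have K0: "K w = 0" if "w \<in> annulus r" for w
  proof (rule analytic_continuation[OF K(1) open_annulus connected_annulus_exp _ _ \<xi>(2) _ that])
    show "P \<subseteq> annulus r" using Psub Ssub by blast
    show "\<xi> \<in> annulus r" using \<xi>(1) Ssub by blast
    fix w assume "w \<in> P"
    then obtain n where n: "w = ec (z + of_nat n * of_real \<alpha>)" by (auto simp: P_def)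
    have "z + of_nat n * of_real \<alpha> \<in> strip r" using z by (simp add: strip_def)
    then show "K w = 0" using K(2) orb[of n] n by simp
  qed
  have "fourier u (of_real x) = 0" for x :: real
    using K(2)[OF of_real_in_strip[OF r]] K0 of_real_in_strip[OF r] ec_in_annulus_iff by metis
  then show False using fourier_unique_zero[OF u(1) r] u(2) by blast
qed

subsection \<open>Small divisors from continued fractions\<close>

text \<open>Numerators of the convergents, by the recurrence of \<open>cf_denom\<close>; the
  matching recurrences give the determinant identity below.\<close>

fun cf_num :: "real \<Rightarrow> nat \<Rightarrow> int" where
  "cf_num \<alpha> 0 = cf_quotient \<alpha> 0"
| "cf_num \<alpha> (Suc 0) = cf_quotient \<alpha> 0 * cf_quotient \<alpha> 1 + 1"
| "cf_num \<alpha> (Suc (Suc n)) =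
     cf_quotient \<alpha> (Suc (Suc n)) * cf_num \<alpha> (Suc n) + cf_num \<alpha> n"

context
  fixes \<alpha> :: real
  assumes irrational: "\<alpha> \<notin> \<rat>"
begin

lemma cf_complete_quotient_irrational: "cf_complete_quotient \<alpha> n \<notin> \<rat>"
proof (induction n)
  case (Suc n)
  show ?case
  proof
    assume "cf_complete_quotient \<alpha> (Suc n) \<in> \<rat>"
    then have "1 / cf_complete_quotient \<alpha> (Suc n) \<in> \<rat>" by (intro Rats_divide) auto
    then have "frac (cf_complete_quotient \<alpha> n) \<in> \<rat>" by simp
    then have "frac (cf_complete_quotient \<alpha> n) + of_int \<lfloor>cf_complete_quotient \<alpha> n\<rfloor> \<in> \<rat>"
      by (intro Rats_add) auto
    then show False using Suc by (simp add: frac_def)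
  qed
qed (use irrational in simp)

lemma frac_cf_pos: "frac (cf_complete_quotient \<alpha> n) > 0"
  using cf_complete_quotient_irrational[of n] Ints_subset_Rats frac_gt_0_iff by blast

lemma cf_complete_quotient_Suc_gt_1: "cf_complete_quotient \<alpha> (Suc n) > 1"
  using frac_cf_pos[of n] frac_lt_1[of "cf_complete_quotient \<alpha> n"] by simp

lemma cf_complete_quotient_eq:
  "(cf_complete_quotient \<alpha> n - of_int (cf_quotient \<alpha> n)) * cf_complete_quotient \<alpha> (Suc n) = 1"
  using frac_cf_pos[of n] by (simp add: cf_quotient_def frac_def)

lemma cf_quotient_ge_1: "cf_quotient \<alpha> (Suc n) \<ge> 1"
  using cf_complete_quotient_Suc_gt_1[of n] unfolding cf_quotient_def by linarith

lemma cf_denom_pos: "cf_denom \<alpha> n \<ge> 1"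
proof (induction n rule: less_induct)
  case (less n)
  show ?case
  proof (cases "(\<alpha>, n)" rule: cf_denom.cases)
    case (3 a m)
    then have n: "n = Suc (Suc m)" by simp
    have "cf_quotient \<alpha> n * cf_denom \<alpha> (Suc m) \<ge> 0"
      using cf_quotient_ge_1[of "Suc m"] less.IH[of "Suc m"] n by simp
    then show ?thesis using less.IH[of m] n by simp
  qed (use cf_quotient_ge_1[of 0] in auto)
qed

lemma cf_denom_Suc_Suc_ge: "cf_denom \<alpha> (Suc (Suc n)) \<ge> cf_denom \<alpha> (Suc n) + cf_denom \<alpha> n"
proof -
  have "1 * cf_denom \<alpha> (Suc n) \<le> cf_quotient \<alpha> (Suc (Suc n)) * cf_denom \<alpha> (Suc n)"
    using cf_quotient_ge_1[of "Suc n"] cf_denom_pos[of "Suc n"] by (intro mult_right_mono) auto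
  then show ?thesis by simp
qed

lemma cf_denom_le_Suc: "cf_denom \<alpha> n \<le> cf_denom \<alpha> (Suc n)"
proof (cases n)
  case 0
  then show ?thesis using cf_quotient_ge_1[of 0] by simp
next
  case (Suc m)
  then show ?thesis using cf_denom_Suc_Suc_ge[of m] cf_denom_pos[of m] by (simp del: cf_denom.simps)
qed

lemma cf_denom_ge: "cf_denom \<alpha> n \<ge> int n"
proof (induction n)
  case (Suc n)
  show ?case
  proof (cases n)
    case 0
    then show ?thesis using cf_denom_pos[of "Suc 0"] by simp
  next
    case (Suc m)
    then show ?thesis using cf_denom_Suc_Suc_ge[of m] cf_denom_pos[of m] Suc.IH by (simp del: cf_denom.simps)
  qed
qed simp

lemma cf_determinant:
  "cf_num \<alpha> (Suc n) * cf_denom \<alpha> n - cf_num \<alpha> n * cf_denom \<alpha> (Suc n) = (-1) ^ n"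
proof (induction n)
  case (Suc n)
  have "cf_num \<alpha> (Suc (Suc n)) * cf_denom \<alpha> (Suc n) - cf_num \<alpha> (Suc n) * cf_denom \<alpha> (Suc (Suc n))
      = - (cf_num \<alpha> (Suc n) * cf_denom \<alpha> n - cf_num \<alpha> n * cf_denom \<alpha> (Suc n))"
    by (simp only: cf_num.simps(3) cf_denom.simps(3)) (simp only: algebra_simps)
  then show ?case using Suc by simp
qed simp

text \<open>The sign is kept because the best approximation argument uses that consecutive errors
  alternate.\<close>

definition cf_error :: "nat \<Rightarrow> real" where
  "cf_error n = of_int (cf_denom \<alpha> n) * \<alpha> - of_int (cf_num \<alpha> n)"

text \<open>Consecutive errors have ratio minus the next complete quotient, a number above 1. Sign
  alternation and monotone decrease both follow.\<close>

lemma cf_error_Suc: "cf_error (Suc n) * cf_complete_quotient \<alpha> (Suc (Suc n)) = - cf_error n"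
proof (induction n)
  case 0
  define x a0 a1 where "x = cf_complete_quotient \<alpha> (Suc 0)"
    and "a0 = real_of_int (cf_quotient \<alpha> 0)" and "a1 = real_of_int (cf_quotient \<alpha> (Suc 0))"
  have 1: "(\<alpha> - a0) * x = 1" using cf_complete_quotient_eq[of 0]
    unfolding x_def a0_def cf_complete_quotient.simps(1) .
  have 2: "(x - a1) * cf_complete_quotient \<alpha> (Suc (Suc 0)) = 1"
    using cf_complete_quotient_eq[of "Suc 0"] unfolding x_def a1_def .
  have e0: "cf_error 0 = \<alpha> - a0" by (simp add: cf_error_def a0_def)
  have "cf_error (Suc 0) = a1 * (\<alpha> - a0) - 1"
    by (simp add: cf_error_def a0_def a1_def algebra_simps)
  also have "\<dots> = (a1 - x) * (\<alpha> - a0)" using 1 by (simp add: algebra_simps)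
  also have "\<dots> = - (\<alpha> - a0) * (x - a1)" by (simp add: algebra_simps)
  finally have "cf_error (Suc 0) * cf_complete_quotient \<alpha> (Suc (Suc 0))
      = - (\<alpha> - a0) * ((x - a1) * cf_complete_quotient \<alpha> (Suc (Suc 0)))"
    by (simp only: mult.assoc)
  then show ?case unfolding 2 e0 by simp
next
  case (Suc n)
  define x a where "x = cf_complete_quotient \<alpha> (Suc (Suc n))"
    and "a = real_of_int (cf_quotient \<alpha> (Suc (Suc n)))"
  have IH: "cf_error n = - (cf_error (Suc n) * x)" using Suc unfolding x_def by linarith
  have 2: "(x - a) * cf_complete_quotient \<alpha> (Suc (Suc (Suc n))) = 1"
    using cf_complete_quotient_eq[of "Suc (Suc n)"] by (simp only: x_def a_def)
  have "cf_error (Suc (Suc n)) = a * cf_error (Suc n) + cf_error n"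
    by (simp add: cf_error_def a_def algebra_simps)
  also have "\<dots> = - cf_error (Suc n) * (x - a)" unfolding IH by (simp add: algebra_simps)
  finally have "cf_error (Suc (Suc n)) * cf_complete_quotient \<alpha> (Suc (Suc (Suc n)))
      = - cf_error (Suc n) * ((x - a) * cf_complete_quotient \<alpha> (Suc (Suc (Suc n))))"
    by (simp only: mult.assoc)
  then show ?case unfolding 2 by simp
qed

lemma cf_error_nonzero: "cf_error n \<noteq> 0"
proof
  assume "cf_error n = 0"
  then have "of_int (cf_denom \<alpha> n) * \<alpha> = of_int (cf_num \<alpha> n)" by (simp add: cf_error_def)
  then show False using irrational_multiple_not_int[OF irrational] cf_denom_pos[of n] by force
qed

lemma cf_error_alternates: "cf_error n * cf_error (Suc n) < 0"
proof -
  have "cf_error n * cf_error (Suc n) = - (cf_error (Suc n))\<^sup>2 * cf_complete_quotient \<alpha> (Suc (Suc n))"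
    using cf_error_Suc[of n] by (simp add: power2_eq_square algebra_simps del: cf_complete_quotient.simps)
  then show ?thesis
    using cf_complete_quotient_Suc_gt_1[of "Suc n"] cf_error_nonzero[of "Suc n"]
    by (simp add: mult_neg_pos del: cf_complete_quotient.simps)
qed

lemma cf_error_decreasing: "\<bar>cf_error (Suc n)\<bar> \<le> \<bar>cf_error n\<bar>"
proof -
  have "\<bar>cf_error n\<bar> = \<bar>cf_error (Suc n)\<bar> * \<bar>cf_complete_quotient \<alpha> (Suc (Suc n))\<bar>"
    using cf_error_Suc[of n] by (metis abs_minus_cancel abs_mult)
  then show ?thesis
    using cf_complete_quotient_Suc_gt_1[of "Suc n"]
    by (simp add: mult_le_cancel_left1 del: cf_complete_quotient.simps)
qed

text \<open>The determinant identity says that the combination of two consecutive errors with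
  crossed denominators has modulus 1. Both summands are at most |cf_error n| times the larger
  denominator, whence the factor 2.\<close>

lemma cf_error_lower: "\<bar>cf_error n\<bar> \<ge> 1 / (2 * of_int (cf_denom \<alpha> (Suc n)))"
proof -
  let ?q = "\<lambda>n. real_of_int (cf_denom \<alpha> n)" and ?p = "\<lambda>n. real_of_int (cf_num \<alpha> n)"
  have q: "?q n \<ge> 1" "?q (Suc n) \<ge> ?q n" using cf_denom_pos[of n] cf_denom_le_Suc[of n] by simp_all
  have "cf_error n * ?q (Suc n) - cf_error (Suc n) * ?q n
      = real_of_int (cf_num \<alpha> (Suc n) * cf_denom \<alpha> n - cf_num \<alpha> n * cf_denom \<alpha> (Suc n))"
    by (simp add: cf_error_def algebra_simps)
  then have "1 = \<bar>cf_error n * ?q (Suc n) - cf_error (Suc n) * ?q n\<bar>"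
    unfolding cf_determinant by simp
  also have "\<dots> \<le> \<bar>cf_error n\<bar> * ?q (Suc n) + \<bar>cf_error (Suc n)\<bar> * ?q n"
    using q abs_triangle_ineq4[of "cf_error n * ?q (Suc n)" "cf_error (Suc n) * ?q n"] by (simp add: abs_mult)
  also have "\<dots> \<le> \<bar>cf_error n\<bar> * ?q (Suc n) + \<bar>cf_error n\<bar> * ?q (Suc n)"
    using q cf_error_decreasing[of n] by (intro add_left_mono mult_mono) auto
  finally have "1 \<le> \<bar>cf_error n\<bar> * (2 * ?q (Suc n))" by (simp add: algebra_simps)
  then show ?thesis using q by (subst pos_divide_le_eq) auto
qed

text \<open>The pair (k, l) is an integer combination, with coefficients x and y, of two consecutive
  convergents. Since |k| is below the larger denominator, x is nonzero and x, y do not have the same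
  sign; the errors alternate too, so the two contributions cannot cancel.\<close>

lemma best_approximation:
  assumes "k \<noteq> 0" "\<bar>k\<bar> < cf_denom \<alpha> (Suc n)"
  shows "\<bar>of_int k * \<alpha> - of_int l\<bar> \<ge> 1 / (2 * of_int (cf_denom \<alpha> (Suc n)))"
proof -
  let ?q = "cf_denom \<alpha>" and ?p = "cf_num \<alpha>"
  define s :: int where "s = (-1) ^ n"
  have s: "s * s = 1" by (simp add: s_def power_mult_distrib [symmetric])
  \<comment> \<open>Cramer's rule for a matrix of determinant \<open>s\<close>, which is its own
    inverse.\<close>
  define x y where "x = s * (k * ?p (Suc n) - l * ?q (Suc n))" and "y = s * (l * ?q n - k * ?p n)"
  have det: "?p (Suc n) * ?q n - ?p n * ?q (Suc n) = s" unfolding s_def by (rule cf_determinant)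
  have k: "k = x * ?q n + y * ?q (Suc n)"
  proof -
    have "x * ?q n + y * ?q (Suc n) = s * k * (?p (Suc n) * ?q n - ?p n * ?q (Suc n))"
      by (simp only: x_def y_def) (simp only: algebra_simps)
    then show ?thesis unfolding det using s by (simp add: mult.commute mult.left_commute)
  qed
  have l: "l = x * ?p n + y * ?p (Suc n)"
  proof -
    have "x * ?p n + y * ?p (Suc n) = s * l * (?p (Suc n) * ?q n - ?p n * ?q (Suc n))"
      by (simp only: x_def y_def) (simp only: algebra_simps)
    then show ?thesis unfolding det using s by (simp add: mult.commute mult.left_commute)
  qed
  have e: "of_int k * \<alpha> - of_int l = of_int x * cf_error n + of_int y * cf_error (Suc n)"
    by (subst k, subst l) (simp add: cf_error_def algebra_simps)
  have qp: "?q n \<ge> 1" "?q (Suc n) \<ge> 1" using cf_denom_pos by blast+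
  have x0: "x \<noteq> 0"
  proof
    assume "x = 0"
    then have "\<bar>k\<bar> = \<bar>y\<bar> * ?q (Suc n)" "y \<noteq> 0" using k qp assms(1) by (auto simp: abs_mult)
    then have "1 * ?q (Suc n) \<le> \<bar>k\<bar>" using qp by (simp only:) (intro mult_right_mono, auto)
    then show False using assms(2) by simp
  qed
  have opp: "x * y \<le> 0"
  proof (rule ccontr)
    assume "\<not> x * y \<le> 0"
    then have "(x > 0 \<and> y > 0) \<or> (x < 0 \<and> y < 0)" by (auto simp: not_le zero_less_mult_iff)
    then have "\<bar>k\<bar> = \<bar>x\<bar> * ?q n + \<bar>y\<bar> * ?q (Suc n)" "\<bar>y\<bar> \<ge> 1"
    proof -
      show "\<bar>y\<bar> \<ge> 1" using \<open>_ \<or> _\<close> by auto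
      show "\<bar>k\<bar> = \<bar>x\<bar> * ?q n + \<bar>y\<bar> * ?q (Suc n)"
        using \<open>_ \<or> _\<close>
      proof
        assume "x > 0 \<and> y > 0"
        then have "x * ?q n > 0" "y * ?q (Suc n) > 0" using qp by auto
        then show ?thesis using k \<open>x > 0 \<and> y > 0\<close> by simp
      next
        assume "x < 0 \<and> y < 0"
        then have "x * ?q n < 0" "y * ?q (Suc n) < 0" using qp by (auto simp: mult_less_0_iff)
        then show ?thesis using k \<open>x < 0 \<and> y < 0\<close> by simp
      qed
    qed
    moreover have "\<bar>x\<bar> * ?q n \<ge> 0" using qp by simp
    moreover have "1 * ?q (Suc n) \<le> \<bar>y\<bar> * ?q (Suc n)" using qp calculation(2) by (intro mult_right_mono) auto
    ultimately show False using assms(2) by linarith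
  qed
  have "(of_int x * cf_error n) * (of_int y * cf_error (Suc n)) \<ge> 0"
  proof -
    have "(of_int x * cf_error n) * (of_int y * cf_error (Suc n)) = of_int (x * y) * (cf_error n * cf_error (Suc n))"
      by (simp add: mult_ac)
    moreover have "real_of_int (x * y) \<le> 0" using opp by linarith
    ultimately show ?thesis
      using mult_nonpos_nonpos[of "real_of_int (x * y)" "cf_error n * cf_error (Suc n)"] cf_error_alternates[of n]
      by linarith
  qed
  then have "\<bar>of_int x * cf_error n + of_int y * cf_error (Suc n)\<bar>
      = \<bar>of_int x * cf_error n\<bar> + \<bar>of_int y * cf_error (Suc n)\<bar>"
    by (auto simp: zero_le_mult_iff)
  then have "\<bar>of_int k * \<alpha> - of_int l\<bar> \<ge> \<bar>of_int x\<bar> * \<bar>cf_error n\<bar>"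
    unfolding e by (simp add: abs_mult)
  moreover have "1 * \<bar>cf_error n\<bar> \<le> \<bar>of_int x\<bar> * \<bar>cf_error n\<bar>"
    using x0 by (intro mult_right_mono) auto
  ultimately show ?thesis using cf_error_lower[of n] by linarith
qed

text \<open>Eventually q_{n+1} is below exp(\<eta> q_n / 8). If n is least with |k| < q_n, then
  q_{n-1} \<le> |k|, so q_n is at most exp(\<eta> |k| / 8), and best approximation applies at level
  n.\<close>

lemma small_divisors:
  assumes "ereal \<eta> > 8 * beta_freq \<alpha>" "\<eta> > 0"
  obtains c where "c > 0"
    "\<And>k l. k \<noteq> 0 \<Longrightarrow> \<bar>of_int k * \<alpha> - of_int l\<bar> \<ge> c * exp (- (\<eta> / 8) * of_int \<bar>k\<bar>)"
proof -
  have "beta_freq \<alpha> < ereal (\<eta> / 8)"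
    using assms by (cases "beta_freq \<alpha>") auto
  then have "\<forall>\<^sub>F n in sequentially. ereal (ln (of_int (cf_denom \<alpha> (Suc n))) / of_int (cf_denom \<alpha> n)) < ereal (\<eta> / 8)"
    unfolding beta_freq_def by (rule Limsup_lessD)
  then obtain N where N: "\<And>n. n \<ge> N \<Longrightarrow> ln (of_int (cf_denom \<alpha> (Suc n))) / of_int (cf_denom \<alpha> n) < \<eta> / 8"
    unfolding eventually_sequentially by auto
  have qp: "real_of_int (cf_denom \<alpha> n) \<ge> 1" for n using cf_denom_pos[of n] by simp
  \<comment> \<open>The first entry is the constant from best approximation, used for large |k|; the
    second covers all |k| below the denominator from which the growth bound is available.\<close>
  define c where "c = min (1/2) (1 / (2 * real_of_int (cf_denom \<alpha> (Suc N))))"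
  have c: "c > 0" using qp[of "Suc N"] by (simp add: c_def)
  have "\<bar>of_int k * \<alpha> - of_int l\<bar> \<ge> c * exp (- (\<eta> / 8) * of_int \<bar>k\<bar>)" if k: "k \<noteq> 0" for k l
  proof (cases "\<bar>k\<bar> < cf_denom \<alpha> (Suc N)")
    case True
    have "c * exp (- (\<eta> / 8) * of_int \<bar>k\<bar>) \<le> c * 1"
      using c assms(2) by (intro mult_left_mono) auto
    also have "\<dots> \<le> 1 / (2 * of_int (cf_denom \<alpha> (Suc N)))" by (simp add: c_def)
    also have "\<dots> \<le> \<bar>of_int k * \<alpha> - of_int l\<bar>" by (rule best_approximation[OF k True])
    finally show ?thesis .
  next
    case False
    define n where "n = (LEAST n. \<bar>k\<bar> < cf_denom \<alpha> n)"
    have "\<bar>k\<bar> < cf_denom \<alpha> (nat \<bar>k\<bar> + 1)" using cf_denom_ge[of "nat \<bar>k\<bar> + 1"] by simp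
    then have n: "\<bar>k\<bar> < cf_denom \<alpha> n" unfolding n_def by (rule LeastI)
    have "mono (cf_denom \<alpha>)" unfolding mono_iff_le_Suc using cf_denom_le_Suc by blast
    then have "Suc N < n" using n False monoD[of "cf_denom \<alpha>" n "Suc N"] by linarith
    then obtain m where m: "n = Suc m" "m \<ge> N" by (cases n) auto
    have mk: "cf_denom \<alpha> m \<le> \<bar>k\<bar>"
      using not_less_Least[of m "\<lambda>n. \<bar>k\<bar> < cf_denom \<alpha> n"] m(1) unfolding n_def by force
    have "ln (of_int (cf_denom \<alpha> (Suc m))) < \<eta> / 8 * of_int (cf_denom \<alpha> m)"
      using N[OF m(2)] qp[of m] by (simp add: divide_less_eq)
    also have "\<dots> \<le> \<eta> / 8 * of_int \<bar>k\<bar>"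
      using mk assms(2) by (intro mult_left_mono) auto
    finally have "exp (ln (real_of_int (cf_denom \<alpha> (Suc m)))) \<le> exp (\<eta> / 8 * of_int \<bar>k\<bar>)"
      by (simp only: exp_le_cancel_iff less_imp_le)
    moreover have "exp (ln (real_of_int (cf_denom \<alpha> (Suc m)))) = real_of_int (cf_denom \<alpha> (Suc m))"
      using qp[of "Suc m"] by (intro exp_ln) linarith
    ultimately have "real_of_int (cf_denom \<alpha> (Suc m)) \<le> exp (\<eta> / 8 * of_int \<bar>k\<bar>)" by (simp only:)
    then have "1 / exp (\<eta> / 8 * of_int \<bar>k\<bar>) \<le> 1 / real_of_int (cf_denom \<alpha> (Suc m))"
      using qp[of "Suc m"] by (intro divide_left_mono) auto
    then have ex: "exp (- (\<eta> / 8) * of_int \<bar>k\<bar>) \<le> 1 / real_of_int (cf_denom \<alpha> (Suc m))"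
      by (simp only: mult_minus_left exp_minus inverse_eq_divide)
    have "c * exp (- (\<eta> / 8) * of_int \<bar>k\<bar>) \<le> 1/2 * (1 / real_of_int (cf_denom \<alpha> (Suc m)))"
      using ex c by (intro mult_mono) (auto simp: c_def)
    also have "\<dots> \<le> \<bar>of_int k * \<alpha> - of_int l\<bar>"
      using best_approximation[OF k, of m l] n m(1) by simp
    finally show ?thesis .
  qed
  then show ?thesis using that c by blast
qed

end

text \<open>A crude form of Jordan's inequality. Up to pi/3 the derivative is at least 1/2; beyond,
  the sine is at least 1/2 while x/4 stays below 1/2.\<close>

lemma sin_ge_quarter:
  assumes "0 \<le> x" "x \<le> pi / 2"
  shows "x / 4 \<le> sin x"
proof (cases "x \<le> pi / 3")
  case True
  have "sin 0 - 0 / 4 \<le> sin x - x / 4"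
  proof (rule DERIV_nonneg_imp_nondecreasing[OF assms(1)])
    fix y assume y: "0 \<le> y" "y \<le> x"
    have "cos (pi / 3) \<le> cos y"
      using y True by (intro cos_monotone_0_pi_le) auto
    then have "0 \<le> cos y - 1 / 4" by (simp add: cos_60)
    moreover have "((\<lambda>y. sin y - y / 4) has_real_derivative cos y - 1 / 4) (at y)"
      by (auto intro!: derivative_eq_intros)
    ultimately show "\<exists>D. ((\<lambda>y. sin y - y / 4) has_real_derivative D) (at y) \<and> 0 \<le> D" by blast
  qed
  then show ?thesis by simp
next
  case False
  have "sin (pi / 3) \<le> sin x"
    using False assms by (intro sin_monotone_2pi_le) auto
  moreover have "sin (pi / 3) \<ge> 1 / 2" by (simp add: sin_60)
  moreover have "x / 4 \<le> 1 / 2" using assms pi_less_4 by simp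
  ultimately show ?thesis by simp
qed

text \<open>The left side is a chord, of length 2 |sin (pi s)|, where s is the offset of t from the
  nearest integer. The slope 1/4 for the sine gives at least pi |s| / 2.\<close>

lemma norm_ec_minus_1_ge:
  obtains l :: int where "cmod (ec (of_real t) - 1) \<ge> \<bar>t - of_int l\<bar>"
proof
  define l where "l = round t"
  define s where "s = t - of_int l"
  have s: "\<bar>s\<bar> \<le> 1/2" using of_int_round_abs_le[of t] by (simp add: s_def l_def abs_minus_commute)
  have "ec (of_real t) = ec (of_real s)"
    by (simp add: s_def ec_diff)
  moreover have "cmod (ec (of_real s) - 1) = 2 * \<bar>sin (pi * s)\<bar>"
    using dist_exp_i_1[of "2 * pi * s"] by (simp add: ec_def mult_ac)
  moreover have "\<bar>sin (pi * s)\<bar> = sin (pi * \<bar>s\<bar>)"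
  proof -
    have "sin (pi * \<bar>s\<bar>) \<ge> 0" using s by (intro sin_ge_zero) (auto intro: mult_left_le)
    then show ?thesis by (cases "s \<ge> 0") auto
  qed
  moreover have "sin (pi * \<bar>s\<bar>) \<ge> pi * \<bar>s\<bar> / 4"
    using s by (intro sin_ge_quarter) auto
  moreover have "pi * \<bar>s\<bar> \<ge> 2 * \<bar>s\<bar>" using pi_ge_two by (intro mult_right_mono) auto
  ultimately show "cmod (ec (of_real t) - 1) \<ge> \<bar>t - of_int l\<bar>"
    unfolding s_def [symmetric] by simp
qed

subsection \<open>Lifts of projective actions and degrees\<close>

text \<open>Taken with q = 0 it is periodicity; with p = q = 1/2 it is commutation of a lift with
  half-turns.\<close>

lemma translation_int:
  fixes f :: "real \<Rightarrow> real"
  assumes "\<And>x. f (x + p) = f x + q"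
  shows "f (x + of_int n * p) = f x + of_int n * q"
proof (induction n rule: int_induct[of _ 0])
  case (step1 i)
  then show ?case using assms[of "x + of_int i * p"] by (simp add: algebra_simps)
next
  case (step2 i)
  then show ?case using assms[of "x + of_int (i - 1) * p"] by (simp add: algebra_simps)
qed simp

lemma mat2_nth [simp]:
  "mat2 a b c d $ 1 $ 1 = a" "mat2 a b c d $ 1 $ 2 = b"
  "mat2 a b c d $ 2 $ 1 = c" "mat2 a b c d $ 2 $ 2 = d"
  by (simp_all add: mat2_def)

lemma mat2_eqI:
  fixes M N :: "real^2^2"
  assumes "M $ 1 $ 1 = N $ 1 $ 1" "M $ 1 $ 2 = N $ 1 $ 2" "M $ 2 $ 1 = N $ 2 $ 1" "M $ 2 $ 2 = N $ 2 $ 2"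
  shows "M = N"
  using assms by (simp add: vec_eq_iff forall_2)

lemma mat2_mult: "mat2 a b c d ** mat2 a' b' c' d' =
    mat2 (a * a' + b * c') (a * b' + b * d') (c * a' + d * c') (c * b' + d * d')"
  by (rule mat2_eqI) (simp_all add: matrix_matrix_mult_def sum_2)

lemma matrix_vector_2:
  fixes M :: "real^2^2"
  shows "(M *v v) $ 1 = M $ 1 $ 1 * v $ 1 + M $ 1 $ 2 * v $ 2"
    "(M *v v) $ 2 = M $ 2 $ 1 * v $ 1 + M $ 2 $ 2 * v $ 2"
  by (simp_all add: matrix_vector_mult_def sum_2)

lemma direction_nth [simp]: "direction \<phi> $ 1 = cos (2 * pi * \<phi>)" "direction \<phi> $ 2 = sin (2 * pi * \<phi>)"
  by (simp_all add: direction_def)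

lemma continuous_on_mat2 [continuous_intros]:
  assumes "continuous_on S a" "continuous_on S b" "continuous_on S c" "continuous_on S d"
  shows "continuous_on S (\<lambda>x. mat2 (a x) (b x) (c x) (d x))"
proof -
  have *: "mat2 (a x) (b x) (c x) (d x) =
      (\<chi> i j. if i = 1 then if j = 1 then a x else b x else if j = 1 then c x else d x)" for x
    by (rule mat2_eqI) simp_all
  have "continuous_on S (\<lambda>x. if i = 1 then if j = 1 then a x else b x else if j = 1 then c x else d x)"
    for i j :: 2
    using assms by (cases "i = 1"; cases "j = 1") simp_all
  then show ?thesis unfolding * by (intro continuous_on_vec_lambda)
qed

lemma direction_nonzero: "direction \<phi> \<noteq> 0"
proof
  assume "direction \<phi> = 0"
  then have "cos (2 * pi * \<phi>) = 0" "sin (2 * pi * \<phi>) = 0"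
    by (metis direction_nth zero_index)+
  then show False using sin_cos_squared_add[of "2 * pi * \<phi>"] by simp
qed

text \<open>The action on lines: \<open>t\<close> may be negative, so \<psi> is determined modulo
  1/2. Where the factor is required positive instead, angles are determined modulo 1.\<close>

definition acts_dir :: "real^2^2 \<Rightarrow> real \<Rightarrow> real \<Rightarrow> bool" where
  "acts_dir M \<phi> \<psi> \<longleftrightarrow> (\<exists>t. t \<noteq> 0 \<and> M *v direction \<phi> = t *\<^sub>R direction \<psi>)"

lemma direction_parallel:
  assumes "t *\<^sub>R direction a = s *\<^sub>R direction b" "t \<noteq> 0"
  shows "2 * (a - b) \<in> \<int>"
proof -
  have "t * cos (2 * pi * a) = s * cos (2 * pi * b)" "t * sin (2 * pi * a) = s * sin (2 * pi * b)"
    using arg_cong[OF assms(1), of "\<lambda>v. v $ 1"] arg_cong[OF assms(1), of "\<lambda>v. v $ 2"] by simp_all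
  then have "t * (sin (2 * pi * a) * cos (2 * pi * b) - cos (2 * pi * a) * sin (2 * pi * b)) = 0"
    by (simp add: right_diff_distrib mult.assoc [symmetric])
  then have "sin (2 * pi * a - 2 * pi * b) = 0" using assms(2) by (simp add: sin_diff)
  then obtain i :: int where "2 * pi * a - 2 * pi * b = of_int i * pi"
    unfolding sin_zero_iff_int2 by blast
  then have "pi * (2 * (a - b)) = pi * of_int i" by (simp add: algebra_simps)
  then show ?thesis by simp
qed

lemma acts_dir_unique: "acts_dir M \<phi> a \<Longrightarrow> acts_dir M \<phi> b \<Longrightarrow> 2 * (a - b) \<in> \<int>"
  unfolding acts_dir_def using direction_parallel by metis

text \<open>Distinct values differ by at least 1/2, so continuity on a connected set leaves a single
  value. It compares lifts that are determined only modulo half-turns.\<close>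

lemma half_int_const:
  fixes D :: "'a::topological_space \<Rightarrow> real"
  assumes S: "connected S" "continuous_on S D" "\<And>p. p \<in> S \<Longrightarrow> 2 * D p \<in> \<int>" and "p \<in> S" "q \<in> S"
  shows "D p = D q"
proof -
  have "D constant_on S"
  proof (rule continuous_discrete_range_constant[OF S(1,2)])
    fix x assume x: "x \<in> S"
    have "1/2 \<le> norm (D y - D x)" if y: "y \<in> S" "D y \<noteq> D x" for y
    proof -
      have "2 * (D y - D x) \<in> \<int>" using S(3)[OF x] S(3)[OF y(1)] by (simp add: right_diff_distrib)
      then obtain i :: int where i: "2 * (D y - D x) = of_int i" by (auto elim: Ints_cases)
      then have "i \<noteq> 0" using y(2) by auto
      then have "\<bar>real_of_int i\<bar> \<ge> 1" by linarith
      then have "1 \<le> 2 * \<bar>D y - D x\<bar>" unfolding i[symmetric] abs_mult abs_numeral .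
      then show ?thesis by simp
    qed
    then show "\<exists>e>0. \<forall>y. y \<in> S \<and> D y \<noteq> D x \<longrightarrow> e \<le> norm (D y - D x)"
      by (intro exI[of _ "1/2"]) auto
  qed
  then show ?thesis using assms(4,5) unfolding constant_on_def by metis
qed

lemma int_valued_const:
  fixes D :: "'a::topological_space \<Rightarrow> real"
  assumes "connected S" "continuous_on S D" "\<And>p. p \<in> S \<Longrightarrow> D p \<in> \<int>" "p \<in> S" "q \<in> S"
  shows "D p = D q"
  by (rule half_int_const[OF assms(1,2) _ assms(4,5)]) (intro Ints_mult assms(3) Ints_numeral)

lemma R_rot_direction: "R_rot c *v direction \<phi> = direction (\<phi> + c)"
  by (simp add: vec_eq_iff forall_2 matrix_vector_2 R_rot_def distrib_left cos_add sin_add)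

lemma direction_half: "direction (\<phi> + 1/2) = - direction \<phi>"
  by (simp add: vec_eq_iff forall_2 distrib_left)

text \<open>Parallelism alone allows half-turns; positive factors make the cosine of the difference
  positive and exclude the odd ones.\<close>

lemma direction_eq_imp_int:
  assumes "r *\<^sub>R direction a = s *\<^sub>R direction b" "r > 0" "s > 0"
  shows "a - b \<in> \<int>"
proof -
  have c: "r * cos (2 * pi * a) = s * cos (2 * pi * b)" and d: "r * sin (2 * pi * a) = s * sin (2 * pi * b)"
    using arg_cong[OF assms(1), of "\<lambda>v. v $ 1"] arg_cong[OF assms(1), of "\<lambda>v. v $ 2"] by simp_all
  have "r * cos (2 * pi * a - 2 * pi * b)
      = (r * cos (2 * pi * a)) * cos (2 * pi * b) + (r * sin (2 * pi * a)) * sin (2 * pi * b)"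
    by (simp add: cos_diff distrib_left)
  also have "\<dots> = s * ((sin (2 * pi * b))\<^sup>2 + (cos (2 * pi * b))\<^sup>2)"
    unfolding c d by (simp only: power2_eq_square) (simp only: algebra_simps)
  finally have "r * cos (2 * pi * (a - b)) = s" by (simp add: right_diff_distrib)
  then have pos: "cos (2 * pi * (a - b)) > 0" using assms(2,3) by (metis zero_less_mult_pos)
  obtain i :: int where i: "2 * (a - b) = of_int i"
    using direction_parallel[OF assms(1)] assms(2) by (auto elim: Ints_cases)
  have "even i"
  proof (rule ccontr)
    assume "odd i"
    then obtain j where "i = 2 * j + 1" by (auto elim: oddE)
    then have "2 * pi * (a - b) = pi + 2 * pi * of_int j" using i by (simp add: algebra_simps)
    then have "cos (2 * pi * (a - b)) = cos pi" 
      using cos_int_2pin[of j] sin_int_2pin[of j] by (simp add: cos_add)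
    then show False using pos by simp
  qed
  then obtain j where "i = 2 * j" by (auto elim: evenE)
  then have "a - b = of_int j" using i by simp
  then show ?thesis by simp
qed

lemma det_nonzero_imp_mult_nonzero:
  fixes M :: "real^2^2"
  assumes "det M \<noteq> 0" "v \<noteq> 0"
  shows "M *v v \<noteq> 0"
  using assms by (metis invertible_det_nz matrix_left_invertible_ker invertible_left_inverse)

text \<open>The path to a family of rotations forces the lift to commute with half-turns.\<close>
lemma angle_lift:
  fixes M :: "'a::real_normed_vector \<Rightarrow> real^2^2"
  assumes S: "convex S" "continuous_on S M" "\<And>t. t \<in> S \<Longrightarrow> det (M t) \<noteq> 0"
    and S1: "connected S1" "S1 \<subseteq> S" "t1 \<in> S1" "continuous_on S1 c" "\<And>t. t \<in> S1 \<Longrightarrow> M t = R_rot (c t)"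
  obtains \<Psi> where "continuous_on (S \<times> UNIV) \<Psi>"
    "\<And>t \<phi>. t \<in> S \<Longrightarrow> \<exists>\<rho>>0. M t *v direction \<phi> = \<rho> *\<^sub>R direction (\<Psi> (t, \<phi>))"
    "\<And>t \<phi>. t \<in> S \<Longrightarrow> \<Psi> (t, \<phi> + 1/2) = \<Psi> (t, \<phi>) + 1/2"
    "\<And>t \<phi>. t \<in> S1 \<Longrightarrow> \<Psi> (t, \<phi>) = \<phi> + c t"
proof -
  \<comment> \<open>The image vector is read as a nonzero complex number. The parameter space is
    convex, so it has a continuous logarithm, whose imaginary part is the angle.\<close>
  define f where "f = (\<lambda>p. of_real ((M (fst p) *v direction (snd p)) $ 1)
      + \<i> * of_real ((M (fst p) *v direction (snd p)) $ 2))"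
  have Mf: "continuous_on (S \<times> (UNIV :: real set)) (\<lambda>p. M (fst p))"
    by (rule continuous_on_compose2[OF S(2)]) (auto intro!: continuous_intros)
  have fc: "continuous_on (S \<times> UNIV) f"
    unfolding f_def matrix_vector_2 direction_nth by (intro continuous_intros Mf)
  have f0: "f p \<noteq> 0" if "p \<in> S \<times> UNIV" for p
  proof
    assume "f p = 0"
    then have "(M (fst p) *v direction (snd p)) $ 1 = 0" "(M (fst p) *v direction (snd p)) $ 2 = 0"
      by (simp_all add: f_def complex_eq_iff)
    then have "M (fst p) *v direction (snd p) = 0" by (simp add: vec_eq_iff forall_2)
    moreover have "det (M (fst p)) \<noteq> 0" using that S(3) by auto
    ultimately show False using det_nonzero_imp_mult_nonzero direction_nonzero by blast
  qed
  have cS: "convex (S \<times> (UNIV :: real set))" using S(1) convex_UNIV by (rule convex_Times)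
  obtain L where L: "continuous_on (S \<times> UNIV) L" "\<And>p. p \<in> S \<times> UNIV \<Longrightarrow> f p = exp (L p)"
    using continuous_logarithm_on_contractible[OF fc convex_imp_contractible[OF cS] f0] by blast
  define \<Psi>0 where "\<Psi>0 p = Im (L p) / (2 * pi)" for p
  have \<Psi>0c: "continuous_on (S \<times> UNIV) \<Psi>0"
    unfolding \<Psi>0_def by (intro continuous_intros L) simp
  have pol: "M t *v direction \<phi> = exp (Re (L (t, \<phi>))) *\<^sub>R direction (\<Psi>0 (t, \<phi>))" if "t \<in> S" for t \<phi>
  proof -
    have "f (t, \<phi>) = exp (L (t, \<phi>))" using L(2) that by auto
    then have "(M t *v direction \<phi>) $ 1 = exp (Re (L (t, \<phi>))) * cos (Im (L (t, \<phi>)))"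
      "(M t *v direction \<phi>) $ 2 = exp (Re (L (t, \<phi>))) * sin (Im (L (t, \<phi>)))"
      by (auto simp: f_def complex_eq_iff Re_exp Im_exp)
    then show ?thesis by (simp add: vec_eq_iff forall_2 \<Psi>0_def)
  qed
  have cS1: "connected (S1 \<times> (UNIV :: real set))"
    by (rule connected_Times[OF S1(1) connected_UNIV])
  define D where "D p = \<Psi>0 p - snd p - c (fst p)" for p
  have Dc: "continuous_on (S1 \<times> UNIV) D"
  proof -
    have "continuous_on (S1 \<times> (UNIV :: real set)) (\<lambda>p. c (fst p))"
      by (rule continuous_on_compose2[OF S1(4)]) (auto intro!: continuous_intros)
    moreover have "continuous_on (S1 \<times> UNIV) \<Psi>0"
      by (rule continuous_on_subset[OF \<Psi>0c]) (use S1(2) in auto)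
    ultimately show ?thesis unfolding D_def by (intro continuous_intros)
  qed
  have Di: "D (t, \<phi>) \<in> \<int>" if "t \<in> S1" for t \<phi>
  proof -
    have "exp (Re (L (t, \<phi>))) *\<^sub>R direction (\<Psi>0 (t, \<phi>)) = 1 *\<^sub>R direction (\<phi> + c t)"
      using pol[of t \<phi>] that S1(2,5) R_rot_direction by auto
    then have "\<Psi>0 (t, \<phi>) - (\<phi> + c t) \<in> \<int>" by (rule direction_eq_imp_int) auto
    then show ?thesis by (simp add: D_def algebra_simps)
  qed
  \<comment> \<open>Over \<open>S1\<close> the lift can differ from the rotation angle only by this
    constant integer; subtracting it makes the lift equal to \<phi> + c t there.\<close>
  define d where "d = D (t1, 0)"
  have D: "D (t, \<phi>) = d" if "t \<in> S1" for t \<phi>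
    unfolding d_def by (rule int_valued_const[OF cS1 Dc]) (use Di that S1(3) in auto)
  have d: "d \<in> \<int>" unfolding d_def by (rule Di[OF S1(3)])
  define \<Psi> where "\<Psi> p = \<Psi>0 p - d" for p
  have \<Psi>c: "continuous_on (S \<times> UNIV) \<Psi>" unfolding \<Psi>_def by (intro continuous_intros \<Psi>0c)
  have dird: "direction (a - d) = direction a" for a
  proof -
    obtain j :: int where "d = of_int j" using d by (auto elim: Ints_cases)
    then show ?thesis
      using cos_int_2pin[of j] sin_int_2pin[of j]
      by (simp add: vec_eq_iff forall_2 right_diff_distrib cos_diff sin_diff)
  qed
  have on1: "\<Psi> (t, \<phi>) = \<phi> + c t" if "t \<in> S1" for t \<phi>
    using D[OF that, of \<phi>] by (simp add: D_def \<Psi>_def)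
  have pol': "M t *v direction \<phi> = exp (Re (L (t, \<phi>))) *\<^sub>R direction (\<Psi> (t, \<phi>))" if "t \<in> S" for t \<phi>
    unfolding \<Psi>_def dird by (rule pol[OF that])
  have half: "\<Psi> (t, \<phi> + 1/2) = \<Psi> (t, \<phi>) + 1/2" if t: "t \<in> S" for t \<phi>
  proof -
    \<comment> \<open>The failure to commute with a half-turn is a continuous integer, hence
      constant on S, and it is 0 over \<open>S1\<close>.\<close>
    define G where "G p = \<Psi> (fst p, snd p + 1/2) - \<Psi> p - 1/2" for p
    have "continuous_on (S \<times> UNIV) (\<lambda>p. \<Psi> (fst p, snd p + 1/2))"
      by (rule continuous_on_compose2[OF \<Psi>c]) (auto intro!: continuous_intros)
    then have Gc: "continuous_on (S \<times> UNIV) G" unfolding G_def by (intro continuous_intros \<Psi>c)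
    have Gi: "G p \<in> \<int>" if pS: "p \<in> S \<times> UNIV" for p
    proof -
      obtain s \<psi> where p: "p = (s, \<psi>)" "s \<in> S" using pS by (cases p) auto
      have "exp (Re (L (s, \<psi> + 1/2))) *\<^sub>R direction (\<Psi> (s, \<psi> + 1/2)) = - (M s *v direction \<psi>)"
        using pol'[OF p(2), of "\<psi> + 1/2"] unfolding direction_half by (simp add: vec_eq_iff forall_2 matrix_vector_2)
      also have "\<dots> = exp (Re (L (s, \<psi>))) *\<^sub>R direction (\<Psi> (s, \<psi>) + 1/2)"
        unfolding pol'[OF p(2)] direction_half by simp
      finally have "\<Psi> (s, \<psi> + 1/2) - (\<Psi> (s, \<psi>) + 1/2) \<in> \<int>" by (rule direction_eq_imp_int) auto
      then show ?thesis by (simp add: G_def p algebra_simps)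
    qed
    have "G (t, \<phi>) = G (t1, 0)"
      by (rule int_valued_const[OF convex_connected[OF cS] Gc]) (use Gi t S1(2,3) in auto)
    also have "\<dots> = 0" using on1[OF S1(3)] by (simp add: G_def)
    finally show ?thesis by (simp add: G_def)
  qed
  show ?thesis
    by (rule that[OF \<Psi>c _ half on1]) (use pol' in \<open>auto intro!: exI\<close>)
qed

text \<open>The increment of the lift under a symmetry \<tau> of M is a continuous integer, so it is
  the same at every parameter and can be computed at a point where the lift is explicit.\<close>

lemma angle_lift_shift:
  fixes M :: "'a::real_normed_vector \<Rightarrow> real^2^2"
  assumes S: "convex S" and \<Psi>: "continuous_on (S \<times> UNIV) \<Psi>"
    "\<And>t \<phi>. t \<in> S \<Longrightarrow> \<exists>\<rho>>0. M t *v direction \<phi> = \<rho> *\<^sub>R direction (\<Psi> (t, \<phi>))"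
    and \<tau>: "continuous_on S \<tau>" "\<And>t. t \<in> S \<Longrightarrow> \<tau> t \<in> S" "\<And>t. t \<in> S \<Longrightarrow> M (\<tau> t) = M t"
    and "t \<in> S" "t1 \<in> S"
  shows "\<Psi> (\<tau> t, \<phi>) - \<Psi> (t, \<phi>) = \<Psi> (\<tau> t1, \<phi>1) - \<Psi> (t1, \<phi>1)"
proof -
  define D where "D p = \<Psi> (\<tau> (fst p), snd p) - \<Psi> p" for p
  have "continuous_on (S \<times> (UNIV :: real set)) (\<lambda>p. \<tau> (fst p))"
    by (rule continuous_on_compose2[OF \<tau>(1)]) (auto intro!: continuous_intros)
  then have "continuous_on (S \<times> UNIV) (\<lambda>p. \<Psi> (\<tau> (fst p), snd p))"
    by (intro continuous_on_compose2[OF \<Psi>(1)] continuous_intros) (use \<tau>(2) in auto)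
  then have Dc: "continuous_on (S \<times> UNIV) D" unfolding D_def by (intro continuous_intros \<Psi>(1))
  have Di: "D p \<in> \<int>" if pS: "p \<in> S \<times> UNIV" for p
  proof -
    obtain s \<psi> where p: "p = (s, \<psi>)" "s \<in> S" using pS by (cases p) auto
    obtain \<rho> \<rho>' where "\<rho> > 0" "\<rho>' > 0" "M s *v direction \<psi> = \<rho> *\<^sub>R direction (\<Psi> (s, \<psi>))"
      "M (\<tau> s) *v direction \<psi> = \<rho>' *\<^sub>R direction (\<Psi> (\<tau> s, \<psi>))"
      using \<Psi>(2)[OF p(2), of \<psi>] \<Psi>(2)[OF \<tau>(2)[OF p(2)], of \<psi>] by blast
    then have "\<Psi> (\<tau> s, \<psi>) - \<Psi> (s, \<psi>) \<in> \<int>"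
      using \<tau>(3)[OF p(2)] direction_eq_imp_int by metis
    then show ?thesis by (simp add: D_def p)
  qed
  have "D (t, \<phi>) = D (t1, \<phi>1)"
    by (rule int_valued_const[OF convex_connected[OF convex_Times[OF S convex_UNIV]] Dc])
      (use Di assms(7,8) in auto)
  then show ?thesis by (simp add: D_def)
qed

section \<open>Existence and uniqueness of the degree\<close>

text \<open>A lift of the action of B on directions, with the degree recorded as its drift: x to x +
  2 is the full loop, over which R_{m x / 2} makes m turns.\<close>

definition dir_lift :: "(real \<Rightarrow> real^2^2) \<Rightarrow> int \<Rightarrow> (real \<times> real \<Rightarrow> real) \<Rightarrow> bool" where
  "dir_lift B m \<beta> \<longleftrightarrow> continuous_on UNIV \<beta> \<and> (\<forall>x \<phi>. acts_dir (B x) \<phi> (\<beta> (x, \<phi>))) \<and>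
     (\<forall>x \<phi>. \<beta> (x, \<phi> + 1/2) = \<beta> (x, \<phi>) + 1/2) \<and> (\<forall>x \<phi>. \<beta> (x + 2, \<phi>) = \<beta> (x, \<phi>) + of_int m)"

text \<open>The homotopy itself serves as the parameter family, with the rotations at its end t = 1.
  The drift m is evident there, and the shift lemma carries it to t = 0.\<close>

lemma homotopic_imp_dir_lift:
  assumes "homotopic_R_2Z B (\<lambda>x. R_rot (of_int m * x / 2))"
  obtains \<beta> where "dir_lift B m \<beta>"
proof -
  obtain h :: "real \<times> real \<Rightarrow> real^2^2" where h: "continuous_on ({0..1} \<times> UNIV) h" "h ` ({0..1} \<times> UNIV) \<subseteq> SL2"
    "\<And>x. h (0, x) = B x" "\<And>x. h (1, x) = R_rot (of_int m * x / 2)"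
    "\<And>t x. t \<in> {0..1} \<Longrightarrow> h (t, x + 2) = h (t, x)"
    using assms unfolding homotopic_R_2Z_def homotopic_with_def prod_topology_subtopology_eu
      continuous_map_subtopology_eu by (auto simp: image_subset_iff_funcset)
  let ?S = "{0..1::real} \<times> (UNIV :: real set)"
  have S: "convex ?S" by (intro convex_Times convex_real_interval convex_UNIV)
  obtain \<Psi> where \<Psi>: "continuous_on (?S \<times> UNIV) \<Psi>"
    "\<And>t \<phi>. t \<in> ?S \<Longrightarrow> \<exists>\<rho>>0. h t *v direction \<phi> = \<rho> *\<^sub>R direction (\<Psi> (t, \<phi>))"
    "\<And>t \<phi>. t \<in> ?S \<Longrightarrow> \<Psi> (t, \<phi> + 1/2) = \<Psi> (t, \<phi>) + 1/2"
    "\<And>t \<phi>. t \<in> {1} \<times> UNIV \<Longrightarrow> \<Psi> (t, \<phi>) = \<phi> + of_int m * snd t / 2"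
  proof (rule angle_lift[OF S h(1), of "{1} \<times> UNIV" "(1, 0)" "\<lambda>t. of_int m * snd t / 2"])
    show "det (h t) \<noteq> 0" if "t \<in> ?S" for t
      using subsetD[OF h(2) imageI[OF that]] by (simp add: SL2_def)
    show "connected ({1 :: real} \<times> (UNIV :: real set))"
      by (intro connected_Times) auto
  qed (use h(4) in \<open>auto intro!: continuous_intros\<close>)
  define \<beta> where "\<beta> p = \<Psi> ((0, fst p), snd p)" for p
  have "continuous_on UNIV \<beta>"
    unfolding \<beta>_def by (rule continuous_on_compose2[OF \<Psi>(1)]) (auto intro!: continuous_intros)
  moreover have "acts_dir (B x) \<phi> (\<beta> (x, \<phi>))" for x \<phi>
  proof -
    obtain \<rho> where "\<rho> > 0" "h (0, x) *v direction \<phi> = \<rho> *\<^sub>R direction (\<Psi> ((0, x), \<phi>))"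
      using \<Psi>(2)[of "(0, x)" \<phi>] by auto
    then show ?thesis unfolding acts_dir_def \<beta>_def h(3) by (intro exI[of _ \<rho>]) simp
  qed
  moreover have "\<beta> (x, \<phi> + 1/2) = \<beta> (x, \<phi>) + 1/2" for x \<phi>
    using \<Psi>(3)[of "(0, x)" \<phi>] by (simp add: \<beta>_def)
  moreover have "\<beta> (x + 2, \<phi>) = \<beta> (x, \<phi>) + of_int m" for x \<phi>
  proof -
    have "\<Psi> ((\<lambda>t. (fst t, snd t + 2)) (0, x), \<phi>) - \<Psi> ((0, x), \<phi>)
        = \<Psi> ((\<lambda>t. (fst t, snd t + 2)) (1, 0), 0) - \<Psi> ((1, 0), 0)"
      by (rule angle_lift_shift[where \<tau> = "\<lambda>t. (fst t, snd t + 2)", OF S \<Psi>(1,2)])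
        (use h(5) in \<open>auto intro!: continuous_intros\<close>)
    then show ?thesis by (simp add: \<Psi>(4) \<beta>_def)
  qed
  ultimately show ?thesis using that unfolding dir_lift_def by blast
qed

text \<open>Two lifts differ by a constant, so they have the same drift. This makes the degree well
  defined.\<close>

lemma dir_lift_unique:
  assumes "dir_lift B m \<beta>" "dir_lift B m' \<beta>'"
  shows "m = m'"
proof -
  define D where "D p = \<beta> p - \<beta>' p" for p
  have "continuous_on UNIV D"
    using assms unfolding D_def dir_lift_def by (intro continuous_intros) auto
  moreover have "2 * D p \<in> \<int>" for p
    using assms acts_dir_unique unfolding dir_lift_def D_def by (metis surj_pair)
  ultimately have "D (0 + 2, 0) = D (0, 0)"
    by (intro half_int_const[of UNIV]) auto
  moreover have "\<beta> (0 + 2, 0) = \<beta> (0, 0) + of_int m" "\<beta>' (0 + 2, 0) = \<beta>' (0, 0) + of_int m'"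
    using assms unfolding dir_lift_def by blast+
  ultimately show ?thesis by (simp add: D_def)
qed

lemma degree_map_eq:
  assumes "homotopic_R_2Z B (\<lambda>x. R_rot (of_int m * x / 2))"
  shows "degree_map B = m"
  unfolding degree_map_def
proof (rule the_equality[of _ m])
  fix k assume "homotopic_R_2Z B (\<lambda>x. R_rot (of_int k * x / 2))"
  then show "k = m"
    using assms homotopic_imp_dir_lift dir_lift_unique by metis
qed (rule assms)

lemma det_mat2 [simp]: "det (mat2 a b c d) = a * d - b * c"
  by (simp add: det_2)

lemma det_R_rot [simp]: "det (R_rot a) = 1"
  using sin_cos_squared_add[of "2 * pi * a"] by (simp add: R_rot_def power2_eq_square add.commute)

lemma R_rot_0 [simp]: "R_rot 0 = mat 1"
  by (rule mat2_eqI) (simp_all add: R_rot_def mat_def)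

text \<open>Homotope the Iwasawa factors: the triangular factor to the identity and the
  angle of the first column linearly to that of the model loop.\<close>
lemma exists_degree:
  assumes B: "continuous_on UNIV B" "\<And>x. B x \<in> SL2" "\<And>x. B (x + 2) = B x"
  obtains m where "homotopic_R_2Z B (\<lambda>x. R_rot (of_int m * x / 2))"
proof -
  define f where "f x = complex_of_real (B x $ 1 $ 1) + \<i> * of_real (B x $ 2 $ 1)" for x
  have dB: "B x $ 1 $ 1 * B x $ 2 $ 2 - B x $ 1 $ 2 * B x $ 2 $ 1 = 1" for x
    using B(2)[of x] by (simp add: SL2_def det_2)
  have f0: "f x \<noteq> 0" for x
  proof
    assume "f x = 0"
    then have "B x $ 1 $ 1 = 0" "B x $ 2 $ 1 = 0" by (simp_all add: f_def complex_eq_iff)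
    then show False using dB[of x] by simp
  qed
  have fc: "continuous_on UNIV f" unfolding f_def by (intro continuous_intros B(1))
  obtain L where L: "continuous_on UNIV L" "\<And>x. f x = exp (L x)"
    using continuous_logarithm_on_contractible[OF fc] f0 contractible_UNIV by (metis UNIV_I)
  define \<psi> r where "\<psi> x = Im (L x) / (2 * pi)" and "r x = exp (Re (L x))" for x
  have \<psi>c: "continuous_on UNIV \<psi>" and rc: "continuous_on UNIV r"
    unfolding \<psi>_def r_def by (intro continuous_intros L; simp)+
  have r: "r x > 0" for x by (simp add: r_def)
  have col: "B x $ 1 $ 1 = r x * cos (2 * pi * \<psi> x)" "B x $ 2 $ 1 = r x * sin (2 * pi * \<psi> x)" for x
    using L(2)[of x] by (simp_all add: f_def r_def \<psi>_def complex_eq_iff Re_exp Im_exp)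
  have f2: "f (x + 2) = f x" for x by (simp add: f_def B(3))
  have r2: "r (x + 2) = r x" for x
  proof -
    have "exp (L (x + 2)) = exp (L x)" using f2 L(2) by simp
    then have "norm (exp (L (x + 2))) = norm (exp (L x))" by simp
    then show ?thesis by (simp add: r_def)
  qed
  have \<psi>i: "\<psi> (x + 2) - \<psi> x \<in> \<int>" for x
  proof -
    have "r (x + 2) *\<^sub>R direction (\<psi> (x + 2)) = r x *\<^sub>R direction (\<psi> x)"
      using col[of "x + 2"] col[of x] by (simp add: vec_eq_iff forall_2 B(3))
    then show ?thesis by (rule direction_eq_imp_int[OF _ r r])
  qed
  obtain m :: int where m: "\<psi> (0 + 2) - \<psi> 0 = of_int m" using \<psi>i[of 0] by (auto elim: Ints_cases)
  have \<psi>2: "\<psi> (x + 2) = \<psi> x + of_int m" for x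
  proof -
    have "continuous_on UNIV (\<lambda>x. \<psi> (x + 2))"
      by (rule continuous_on_compose2[OF \<psi>c]) (auto intro!: continuous_intros)
    then have "continuous_on UNIV (\<lambda>x. \<psi> (x + 2) - \<psi> x)" by (intro continuous_intros \<psi>c)
    then have "\<psi> (x + 2) - \<psi> x = \<psi> (0 + 2) - \<psi> 0"
      by (rule int_valued_const[OF connected_UNIV]) (use \<psi>i in auto)
    then show ?thesis using m by simp
  qed
  \<comment> \<open>The component of the second column along the direction of the first. With the
    determinant equal to 1, it completes the triangular Iwasawa factor.\<close>
  define b where "b x = cos (2 * pi * \<psi> x) * B x $ 1 $ 2 + sin (2 * pi * \<psi> x) * B x $ 2 $ 2" for x
  have bc: "continuous_on UNIV b" unfolding b_def by (intro continuous_intros \<psi>c B(1))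
  have dir2: "cos (2 * pi * \<psi> (x + 2)) = cos (2 * pi * \<psi> x)" "sin (2 * pi * \<psi> (x + 2)) = sin (2 * pi * \<psi> x)" for x
    using cos_int_2pin[of m] sin_int_2pin[of m] by (simp_all add: \<psi>2 distrib_left cos_add sin_add)
  have b2: "b (x + 2) = b x" for x by (simp only: b_def dir2 B(3))
  have BT: "B x = R_rot (\<psi> x) ** mat2 (r x) (b x) 0 (1 / r x)" for x
  proof -
    define c s where "c = cos (2 * pi * \<psi> x)" and "s = sin (2 * pi * \<psi> x)"
    have cs: "c * c + s * s = 1"
      using sin_cos_squared_add2[of "2 * pi * \<psi> x"] by (simp add: c_def s_def power2_eq_square add.commute)
    have colx: "B x $ 1 $ 1 = r x * c" "B x $ 2 $ 1 = r x * s"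
      using col[of x] by (simp_all add: c_def s_def)
    have bx: "b x = c * B x $ 1 $ 2 + s * B x $ 2 $ 2" by (simp add: b_def c_def s_def)
    have "r x * (c * B x $ 2 $ 2 - s * B x $ 1 $ 2) = 1"
      using dB[of x] unfolding colx by (simp add: algebra_simps)
    then have inv: "1 / r x = c * B x $ 2 $ 2 - s * B x $ 1 $ 2"
      using r[of x] by (simp add: field_simps)
    have "c * b x + (- s) * (1 / r x) = B x $ 1 $ 2 * (c * c + s * s)"
      unfolding inv bx by (simp add: algebra_simps)
    then have 1: "c * b x + (- s) * (1 / r x) = B x $ 1 $ 2" unfolding cs by simp
    have "s * b x + c * (1 / r x) = B x $ 2 $ 2 * (c * c + s * s)"
      unfolding inv bx by (simp add: algebra_simps)
    then have 2: "s * b x + c * (1 / r x) = B x $ 2 $ 2" unfolding cs by simp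
    show ?thesis
      unfolding R_rot_def mat2_mult c_def [symmetric] s_def [symmetric] 1 2
      by (intro mat2_eqI) (simp_all add: colx)
  qed
  \<comment> \<open>Scaling the logarithm of the diagonal keeps the determinant 1. For each time t
    the interpolated angle gains exactly \<open>m\<close> over the period 2, so every intermediate
    map is again a loop.\<close>
  define h where "h p = R_rot ((1 - fst p) * \<psi> (snd p) + fst p * (of_int m * snd p / 2))
      ** mat2 (exp ((1 - fst p) * Re (L (snd p)))) ((1 - fst p) * b (snd p)) 0 (exp (- ((1 - fst p) * Re (L (snd p)))))"
    for p :: "real \<times> real"
  have "homotopic_R_2Z B (\<lambda>x. R_rot (of_int m * x / 2))"
    unfolding homotopic_R_2Z_def
  proof (unfold homotopic_with_def, intro exI[of _ h] conjI ballI allI)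
    have sc: "continuous_on ({0..1} \<times> UNIV) (\<lambda>p::real \<times> real. g (snd p))"
      if "continuous_on UNIV g" for g :: "real \<Rightarrow> 'c::topological_space"
      by (rule continuous_on_compose2[OF that]) (auto intro!: continuous_intros)
    have "continuous_on ({0..1} \<times> UNIV) h"
      unfolding h_def R_rot_def mat2_mult
      by (intro continuous_intros sc[OF \<psi>c] sc[OF bc] sc[OF L(1)]) auto
    then show "continuous_map (prod_topology (top_of_set {0..1}) (top_of_set UNIV)) (top_of_set SL2) h"
      unfolding prod_topology_subtopology_eu continuous_map_subtopology_eu
      by (auto simp: h_def SL2_def det_mul exp_minus)
    show "h (0, x) = B x" for x
      by (simp add: h_def BT r_def exp_minus inverse_eq_divide)
    show "h (1, x) = R_rot (of_int m * x / 2)" for x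
    proof -
      have "mat2 1 0 0 1 = mat 1" by (rule mat2_eqI) (simp_all add: mat_def)
      then show ?thesis by (simp add: h_def)
    qed
    show "h (t, x + 2) = h (t, x)" if "t \<in> {0..1}" for t x
    proof -
      have "(1 - t) * \<psi> (x + 2) + t * (of_int m * (x + 2) / 2)
          = ((1 - t) * \<psi> x + t * (of_int m * x / 2)) + of_int m"
        by (simp add: \<psi>2 algebra_simps)
      moreover have "R_rot (a + of_int m) = R_rot a" for a
        using cos_int_2pin[of m] sin_int_2pin[of m]
        by (simp add: R_rot_def distrib_left cos_add sin_add)
      moreover have "Re (L (x + 2)) = Re (L x)" using r2[of x] by (simp add: r_def)
      ultimately show ?thesis by (simp add: h_def b2)
    qed
  qed
  then show ?thesis by (rule that)
qed

subsection \<open>Rotation numbers of conjugated cocycles\<close>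

text \<open>A commuting square of matrices induces one on directions; the scalar factors only
  multiply.\<close>

lemma acts_dir_comp:
  assumes "acts_dir B \<phi> \<psi>" "A ** B = B' ** C" "acts_dir C \<phi> \<phi>'" "acts_dir B' \<phi>' \<psi>'"
  shows "acts_dir A \<psi> \<psi>'"
proof -
  obtain t c d where t: "t \<noteq> 0" "B *v direction \<phi> = t *\<^sub>R direction \<psi>"
    and c: "c \<noteq> 0" "C *v direction \<phi> = c *\<^sub>R direction \<phi>'"
    and d: "d \<noteq> 0" "B' *v direction \<phi>' = d *\<^sub>R direction \<psi>'"
    using assms unfolding acts_dir_def by blast
  have "t *\<^sub>R (A *v direction \<psi>) = A *v (B *v direction \<phi>)"
    by (simp add: t(2) matrix_vector_mult_scaleR)
  also have "\<dots> = (A ** B) *v direction \<phi>" by (simp add: matrix_vector_mul_assoc)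
  also have "\<dots> = B' *v (C *v direction \<phi>)" by (simp add: assms(2) matrix_vector_mul_assoc)
  also have "\<dots> = (c * d) *\<^sub>R direction \<psi>'" by (simp add: c(2) d(2) matrix_vector_mult_scaleR)
  finally have "(1/t) *\<^sub>R (t *\<^sub>R (A *v direction \<psi>)) = (1/t) *\<^sub>R ((c * d) *\<^sub>R direction \<psi>')" by simp
  then have "A *v direction \<psi> = (c * d / t) *\<^sub>R direction \<psi>'" using t(1) by simp
  moreover have "c * d / t \<noteq> 0" using t c d by simp
  ultimately show ?thesis unfolding acts_dir_def by blast
qed

lemma span_singleton_eq_imp:
  fixes v w :: "real^2"
  assumes "span {v} = span {w}" "v \<noteq> 0"
  obtains t where "t \<noteq> 0" "v = t *\<^sub>R w"
proof -
  have "v \<in> span {w}" using assms(1) span_base[of v "{v}"] by simp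
  then obtain t where "v = t *\<^sub>R w" by (auto simp: span_singleton)
  then show ?thesis using that assms(2) by (cases "t = 0") auto
qed

lemma span_singleton_scaleR:
  fixes w :: "real^2"
  assumes "t \<noteq> 0"
  shows "span {t *\<^sub>R w} = span {w}"
proof -
  have "range (\<lambda>k. k *\<^sub>R (t *\<^sub>R w)) = range (\<lambda>k. k *\<^sub>R w)"
  proof safe
    fix k
    have "k *\<^sub>R (t *\<^sub>R w) = (k * t) *\<^sub>R w" by simp
    then show "k *\<^sub>R (t *\<^sub>R w) \<in> range (\<lambda>k. k *\<^sub>R w)" by (metis rangeI)
    have "k *\<^sub>R w = (k / t) *\<^sub>R (t *\<^sub>R w)" using assms by simp
    then show "k *\<^sub>R w \<in> range (\<lambda>k. k *\<^sub>R (t *\<^sub>R w))" by (metis rangeI)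
  qed
  then show ?thesis by (simp add: span_singleton)
qed

lemma is_angle_lift_acts_dir:
  assumes "is_angle_lift A \<Phi>" "\<And>x. det (A x) \<noteq> 0"
  shows "acts_dir (A x) \<phi> (\<Phi> (x, \<phi>))"
proof -
  have "span {A x *v direction \<phi>} = span {direction (\<Phi> (x, \<phi>))}"
    using assms(1) unfolding is_angle_lift_def by blast
  then show ?thesis
    unfolding acts_dir_def
    using span_singleton_eq_imp det_nonzero_imp_mult_nonzero[OF assms(2) direction_nonzero] by metis
qed

text \<open>Scaling the upper left entry to zero deforms the cocycle to the constant quarter-turn
  \<open>R_rot (1/4)\<close>. The deformation is 1-periodic, so the lift has no drift in x.\<close>

lemma S_AM_angle_lift:
  obtains \<Phi> where "is_angle_lift (S_AM lam E) \<Phi>"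
proof -
  let ?S = "{0..1::real} \<times> (UNIV :: real set)"
  define M where "M t = mat2 ((1 - fst t) * (E - 2 * lam * cos (2 * pi * snd t))) (- 1) 1 0"
    for t :: "real \<times> real"
  have S: "convex ?S" by (intro convex_Times convex_real_interval convex_UNIV)
  obtain \<Psi> where \<Psi>: "continuous_on (?S \<times> UNIV) \<Psi>"
    "\<And>t \<phi>. t \<in> ?S \<Longrightarrow> \<exists>\<rho>>0. M t *v direction \<phi> = \<rho> *\<^sub>R direction (\<Psi> (t, \<phi>))"
    "\<And>t \<phi>. t \<in> ?S \<Longrightarrow> \<Psi> (t, \<phi> + 1/2) = \<Psi> (t, \<phi>) + 1/2"
    "\<And>t \<phi>. t \<in> {1} \<times> UNIV \<Longrightarrow> \<Psi> (t, \<phi>) = \<phi> + 1/4"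
  proof (rule angle_lift[OF S, of M "{1} \<times> UNIV" "(1, 0)" "\<lambda>_. 1/4"])
    show "continuous_on ?S M" unfolding M_def by (intro continuous_intros)
    show "connected ({1 :: real} \<times> (UNIV :: real set))"
      by (intro connected_Times) auto
    show "M t = R_rot (1/4)" if "t \<in> {1} \<times> UNIV" for t
    proof -
      have e: "2 * pi * (1 / 4) = pi / 2" by simp
      have "R_rot (1/4) = mat2 0 (- 1) 1 0"
        unfolding R_rot_def e by simp
      then show ?thesis using that by (auto simp: M_def)
    qed
  qed (auto simp: M_def)
  define \<Phi> where "\<Phi> p = \<Psi> ((0, fst p), snd p)" for p
  have M0: "M (0, x) = S_AM lam E x" for x by (simp add: M_def S_AM_def)
  have "continuous_on UNIV \<Phi>"
    unfolding \<Phi>_def by (rule continuous_on_compose2[OF \<Psi>(1)]) (auto intro!: continuous_intros)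
  moreover have "span {S_AM lam E x *v direction \<phi>} = span {direction (\<Phi> (x, \<phi>))}" for x \<phi>
  proof -
    obtain \<rho> where "\<rho> > 0" "S_AM lam E x *v direction \<phi> = \<rho> *\<^sub>R direction (\<Phi> (x, \<phi>))"
      using \<Psi>(2)[of "(0, x)" \<phi>] unfolding M0 by (auto simp: \<Phi>_def)
    then show ?thesis by (simp add: span_singleton_scaleR)
  qed
  moreover have "\<Phi> (x, \<phi> + 1/2) = \<Phi> (x, \<phi>) + 1/2" for x \<phi>
    using \<Psi>(3)[of "(0, x)" \<phi>] by (simp add: \<Phi>_def)
  moreover have "\<Phi> (x + 1, \<phi>) = \<Phi> (x, \<phi>)" for x \<phi>
  proof -
    have "\<Psi> ((\<lambda>t. (fst t, snd t + 1)) (0, x), \<phi>) - \<Psi> ((0, x), \<phi>)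
        = \<Psi> ((\<lambda>t. (fst t, snd t + 1)) (1, 0), 0) - \<Psi> ((1, 0), 0)"
      by (rule angle_lift_shift[where \<tau> = "\<lambda>t. (fst t, snd t + 1)", OF S \<Psi>(1,2)])
        (auto intro!: continuous_intros simp: M_def distrib_left)
    then show ?thesis by (simp add: \<Psi>(4) \<Phi>_def)
  qed
  ultimately have "is_angle_lift (S_AM lam E) \<Phi>" unfolding is_angle_lift_def by auto
  then show ?thesis by (rule that)
qed

lemma continuous_on_compact_bounded:
  fixes g :: "'a::topological_space \<Rightarrow> real"
  assumes "compact X" "continuous_on X g"
  obtains K where "\<And>x. x \<in> X \<Longrightarrow> \<bar>g x\<bar> \<le> K"
proof -
  have "bounded (g ` X)" using compact_continuous_image[OF assms(2,1)] by (rule compact_imp_bounded)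
  then obtain K where "\<forall>y\<in>g ` X. norm y \<le> K" unfolding bounded_iff by blast
  then have "\<bar>g x\<bar> \<le> K" if "x \<in> X" for x using that by simp
  then show ?thesis by (rule that)
qed

text \<open>Removing \<phi> and the drift m x / 2 leaves a continuous function with period 2 in x
  and 1/2 in \<phi>, bounded by compactness of a period cell.\<close>

lemma dir_lift_bounded:
  assumes "dir_lift B m \<beta>"
  obtains K where "\<And>x \<phi>. \<bar>\<beta> (x, \<phi>) - \<phi> - of_int m / 2 * x\<bar> \<le> K"
proof -
  define g where "g p = \<beta> p - snd p - of_int m / 2 * fst p" for p
  have \<beta>: "continuous_on UNIV \<beta>" "\<And>x \<phi>. \<beta> (x, \<phi> + 1/2) = \<beta> (x, \<phi>) + 1/2"
      "\<And>x \<phi>. \<beta> (x + 2, \<phi>) = \<beta> (x, \<phi>) + of_int m"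
    using assms unfolding dir_lift_def by blast+
  have gc: "continuous_on UNIV g" unfolding g_def by (intro continuous_intros \<beta>(1))
  have g2: "g (x + 2, \<phi>) = g (x, \<phi>)" and gh: "g (x, \<phi> + 1/2) = g (x, \<phi>)" for x \<phi>
    by (simp_all add: g_def \<beta>(2,3) algebra_simps)
  have g2n: "g (x + 2 * of_int n, \<phi>) = g (x, \<phi>)" for n x \<phi>
    using translation_int[of "\<lambda>x. g (x, \<phi>)" 2 0 x n] g2 by (simp add: mult.commute)
  have ghn: "g (x, \<phi> + of_int n / 2) = g (x, \<phi>)" for n x \<phi>
    using translation_int[of "\<lambda>\<phi>. g (x, \<phi>)" "1/2" 0 \<phi> n] gh by simp
  obtain K where K: "\<And>p. p \<in> {0..2} \<times> {0..1/2} \<Longrightarrow> \<bar>g p\<bar> \<le> K"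
    using continuous_on_compact_bounded[OF compact_Times[OF compact_Icc compact_Icc]
        continuous_on_subset[OF gc subset_UNIV]] by blast
  have "\<bar>g (x, \<phi>)\<bar> \<le> K" for x \<phi>
  proof -
    define x' \<phi>' where "x' = x + 2 * of_int (- \<lfloor>x / 2\<rfloor>)" and "\<phi>' = \<phi> + of_int (- \<lfloor>2 * \<phi>\<rfloor>) / 2"
    have "g (x', \<phi>') = g (x, \<phi>)" unfolding x'_def \<phi>'_def g2n ghn ..
    moreover have "(x', \<phi>') \<in> {0..2} \<times> {0..1/2}"
      unfolding x'_def \<phi>'_def by simp linarith
    ultimately show ?thesis using K by metis
  qed
  then show ?thesis using that unfolding g_def fst_conv snd_conv by blast
qed

text \<open>Bounded distance from \<phi> and the intermediate value theorem. It lets every orbit of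
  the cocycle be written as a conjugated orbit.\<close>

lemma dir_lift_surj:
  assumes "dir_lift B m \<beta>"
  obtains \<phi> where "\<beta> (x, \<phi>) = y"
proof -
  obtain K where K: "\<And>x \<phi>. \<bar>\<beta> (x, \<phi>) - \<phi> - of_int m / 2 * x\<bar> \<le> K"
    using dir_lift_bounded[OF assms] by blast
  define a b where "a = y - of_int m / 2 * x - K" and "b = y - of_int m / 2 * x + K"
  have K0: "K \<ge> 0" using K[of 0 0] by linarith
  have "continuous_on UNIV \<beta>" using assms by (simp add: dir_lift_def)
  then have "continuous_on {a..b} (\<lambda>\<phi>. \<beta> (x, \<phi>))"
    by (rule continuous_on_compose2) (auto intro!: continuous_intros)
  moreover have "\<beta> (x, a) \<le> y" "y \<le> \<beta> (x, b)" using K[of x a] K[of x b] by (simp_all add: a_def b_def abs_le_iff)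
  moreover have "a \<le> b" using K0 by (simp add: a_def b_def)
  ultimately obtain \<phi> where "\<beta> (x, \<phi>) = y" using IVT'[of "\<lambda>\<phi>. \<beta> (x, \<phi>)" a y b] by blast
  then show ?thesis by (rule that)
qed

text \<open>Up to a half-integer c, \<beta> carries the motion \<gamma> of the constant matrix to
  \<Phi>. An orbit of \<Phi> thus stays at bounded distance from n times the sum of \<kappa>, the
  drift m \<alpha> / 2 of \<beta>, and c.\<close>

lemma rotation_orbit_limsup:
  assumes A: "\<And>x. det (A x) \<noteq> 0" "is_angle_lift A \<Phi>" and \<beta>: "dir_lift B m \<beta>"
    and conj: "\<And>x. A x ** B x = B (x + \<alpha>) ** C"
    and \<gamma>: "continuous_on UNIV \<gamma>" "\<And>\<phi>. acts_dir C \<phi> (\<gamma> \<phi>)"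
      "\<And>n \<phi>. \<bar>(\<gamma> ^^ n) \<phi> - \<phi> - real n * \<kappa>\<bar> \<le> K"
  shows "\<exists>c. 2 * c \<in> \<int> \<and> (\<forall>x \<phi>. limsup (\<lambda>n. ereal ((snd ((lifted_cocycle \<alpha> \<Phi> ^^ n) (x, \<phi>)) - \<phi>) / real n))
      = ereal (\<kappa> + of_int m / 2 * \<alpha> + c))"
proof -
  have \<Phi>: "continuous_on UNIV \<Phi>" "\<And>x \<phi>. \<Phi> (x, \<phi> + 1/2) = \<Phi> (x, \<phi>) + 1/2"
    using A(2) unfolding is_angle_lift_def by (auto simp: algebra_simps)
  have \<Phi>n: "\<Phi> (x, \<phi> + of_int n / 2) = \<Phi> (x, \<phi>) + of_int n / 2" for x \<phi> n
    using translation_int[of "\<lambda>\<phi>. \<Phi> (x, \<phi>)" "1/2" "1/2" \<phi> n] \<Phi>(2) by simp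
  have \<beta>': "continuous_on UNIV \<beta>" "\<And>x \<phi>. acts_dir (B x) \<phi> (\<beta> (x, \<phi>))"
    using \<beta> unfolding dir_lift_def by blast+
  \<comment> \<open>Both terms represent the same line, the image of the conjugated direction under
    A, so D is a continuous half-integer and therefore a constant.\<close>
  define D where "D p = \<Phi> (fst p, \<beta> p) - \<beta> (fst p + \<alpha>, \<gamma> (snd p))" for p
  have c1: "continuous_on UNIV (\<lambda>p. \<Phi> (fst p, \<beta> p))"
    by (rule continuous_on_compose2[OF \<Phi>(1)]) (auto intro!: continuous_intros \<beta>'(1))
  have c2: "continuous_on UNIV (\<lambda>p. \<beta> (fst p + \<alpha>, \<gamma> (snd p)))"
  proof (rule continuous_on_compose2[OF \<beta>'(1)])
    have "continuous_on UNIV (\<lambda>p::real \<times> real. \<gamma> (snd p))"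
      by (rule continuous_on_compose2[OF \<gamma>(1)]) (auto intro!: continuous_intros)
    then show "continuous_on UNIV (\<lambda>p::real \<times> real. (fst p + \<alpha>, \<gamma> (snd p)))" by (intro continuous_intros)
  qed simp
  have Dc: "continuous_on UNIV D" unfolding D_def by (intro continuous_intros c1 c2)
  have Di: "2 * D p \<in> \<int>" for p
  proof -
    obtain x \<phi> where p: "p = (x, \<phi>)" by (cases p) auto
    have "acts_dir (A x) (\<beta> (x, \<phi>)) (\<beta> (x + \<alpha>, \<gamma> \<phi>))"
      by (rule acts_dir_comp[OF \<beta>'(2) conj \<gamma>(2) \<beta>'(2)])
    with is_angle_lift_acts_dir[OF A(2,1)] show ?thesis
      unfolding D_def p fst_conv snd_conv by (rule acts_dir_unique)
  qed
  define c where "c = D (0, 0)"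
  have step: "\<Phi> (x, \<beta> (x, \<phi>)) = \<beta> (x + \<alpha>, \<gamma> \<phi>) + c" for x \<phi>
  proof -
    have "D (x, \<phi>) = c"
      unfolding c_def by (rule half_int_const[OF connected_UNIV Dc]) (use Di in auto)
    then show ?thesis by (simp add: D_def)
  qed
  obtain j :: int where j: "2 * c = of_int j" using Di[of "(0,0)"] unfolding c_def by (auto elim: Ints_cases)
  obtain Kb where Kb: "\<And>x \<phi>. \<bar>\<beta> (x, \<phi>) - \<phi> - of_int m / 2 * x\<bar> \<le> Kb"
    using dir_lift_bounded[OF \<beta>] by blast
  have "limsup (\<lambda>n. ereal ((snd ((lifted_cocycle \<alpha> \<Phi> ^^ n) (x, \<phi>)) - \<phi>) / real n))
      = ereal (\<kappa> + of_int m / 2 * \<alpha> + c)" for x \<phi>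
  proof -
    obtain \<phi>' where \<phi>': "\<beta> (x, \<phi>') = \<phi>" using dir_lift_surj[OF \<beta>] by blast
    have orbit: "(lifted_cocycle \<alpha> \<Phi> ^^ n) (x, \<phi>)
        = (x + real n * \<alpha>, \<beta> (x + real n * \<alpha>, (\<gamma> ^^ n) \<phi>') + real n * c)" for n
    proof (induction n)
      case 0
      then show ?case by (simp add: \<phi>')
    next
      case (Suc n)
      let ?x = "x + real n * \<alpha>" and ?f = "(\<gamma> ^^ n) \<phi>'"
      \<comment> \<open>The accumulated error is a half-integer, so it passes through \<Phi>
        unchanged by equivariance under half-turns.\<close>
      have nc: "real n * c = of_int (int n * j) / 2" using j by (simp add: field_simps)
      have "\<Phi> (?x, \<beta> (?x, ?f) + real n * c) = \<beta> (?x + \<alpha>, \<gamma> ?f) + c + real n * c"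
        unfolding nc \<Phi>n step ..
      then show ?case using Suc by (simp add: lifted_cocycle_def algebra_simps)
    qed
    define \<rho> where "\<rho> = \<kappa> + of_int m / 2 * \<alpha> + c"
    define K' where "K' = Kb + K + \<bar>\<phi>' - \<phi> + of_int m / 2 * x\<bar>"
    have bd: "\<bar>(snd ((lifted_cocycle \<alpha> \<Phi> ^^ n) (x, \<phi>)) - \<phi>) - real n * \<rho>\<bar> \<le> K'" for n
    proof -
      let ?x = "x + real n * \<alpha>" and ?f = "(\<gamma> ^^ n) \<phi>'"
      have "(snd ((lifted_cocycle \<alpha> \<Phi> ^^ n) (x, \<phi>)) - \<phi>) - real n * \<rho>
        = (\<beta> (?x, ?f) - ?f - of_int m / 2 * ?x) + (?f - \<phi>' - real n * \<kappa>) + (\<phi>' - \<phi> + of_int m / 2 * x)"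
        by (simp add: orbit \<rho>_def algebra_simps)
      then show ?thesis using Kb[of ?x ?f] \<gamma>(3)[of n \<phi>'] unfolding K'_def by linarith
    qed
    have "(\<lambda>n. (snd ((lifted_cocycle \<alpha> \<Phi> ^^ n) (x, \<phi>)) - \<phi>) / real n - \<rho>) \<longlonglongrightarrow> 0"
    proof (rule Lim_null_comparison)
      show "(\<lambda>n. K' / real n) \<longlonglongrightarrow> 0" by (rule lim_const_over_n)
      show "\<forall>\<^sub>F n in sequentially. norm ((snd ((lifted_cocycle \<alpha> \<Phi> ^^ n) (x, \<phi>)) - \<phi>) / real n - \<rho>) \<le> K' / real n"
        using eventually_gt_at_top[of "0::nat"]
      proof eventually_elim
        case (elim n)
        let ?d = "snd ((lifted_cocycle \<alpha> \<Phi> ^^ n) (x, \<phi>)) - \<phi>"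
        have "norm (?d / real n - \<rho>) = \<bar>(?d - real n * \<rho>) / real n\<bar>" using elim by (simp add: field_simps)
        also have "\<dots> = \<bar>?d - real n * \<rho>\<bar> / real n" by simp
        also have "\<dots> \<le> K' / real n" by (rule divide_right_mono[OF bd]) simp
        finally show ?case .
      qed
    qed
    then have "(\<lambda>n. (snd ((lifted_cocycle \<alpha> \<Phi> ^^ n) (x, \<phi>)) - \<phi>) / real n) \<longlonglongrightarrow> \<rho>"
      by (rule LIM_zero_cancel)
    then have "(\<lambda>n. ereal ((snd ((lifted_cocycle \<alpha> \<Phi> ^^ n) (x, \<phi>)) - \<phi>) / real n)) \<longlonglongrightarrow> ereal \<rho>"
      by simp
    then show ?thesis unfolding \<rho>_def by (intro lim_imp_Limsup) auto
  qed
  moreover have "2 * c \<in> \<int>" unfolding j by simp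
  ultimately show ?thesis by (intro exI[of _ c] conjI allI)
qed

text \<open>The constant c depends on the lift but disappears modulo 1/2, so all lifts give one
  value. The given lift \<Phi>0 excludes any second value in [0, 1/2).\<close>

lemma rotation_number_conjugate:
  assumes A: "\<And>x. det (A x) \<noteq> 0" "is_angle_lift A \<Phi>0" and \<beta>: "dir_lift B m \<beta>"
    and conj: "\<And>x. A x ** B x = B (x + \<alpha>) ** C"
    and \<gamma>: "continuous_on UNIV \<gamma>" "\<And>\<phi>. acts_dir C \<phi> (\<gamma> \<phi>)"
      "\<And>n \<phi>. \<bar>(\<gamma> ^^ n) \<phi> - \<phi> - real n * \<kappa>\<bar> \<le> K"
  shows "[rotation_number \<alpha> A = \<kappa> + of_int m / 2 * \<alpha>] (rmod 1/2)"
proof -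
  define \<rho> where "\<rho> = \<kappa> + of_int m / 2 * \<alpha>"
  define r where "r = \<rho> rmod (1/2)"
  have r0: "0 \<le> r" unfolding r_def by (rule rmod_nonneg) simp
  have r1: "r < 1/2" unfolding r_def by (rule rmod_less) simp
  have cong: "[\<rho> + c = r] (rmod 1/2)" if "2 * c \<in> \<int>" for c
  proof -
    obtain j :: int where "2 * c = of_int j" using \<open>2 * c \<in> \<int>\<close> by (auto elim: Ints_cases)
    then have "\<rho> = (\<rho> + c) + of_int (- j) * (1/2)" by simp
    then have "[\<rho> + c = \<rho>] (rmod 1/2)" unfolding rcong_altdef by blast
    then show ?thesis unfolding r_def by simp
  qed
  define ls where "ls \<Phi> x \<phi> = limsup (\<lambda>n. ereal ((snd ((lifted_cocycle \<alpha> \<Phi> ^^ n) (x, \<phi>)) - \<phi>) / real n))" for \<Phi> x \<phi>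
  define P where "P s \<longleftrightarrow> 0 \<le> s \<and> s < 1/2 \<and>
    (\<forall>\<Phi>. is_angle_lift A \<Phi> \<longrightarrow> (\<forall>x \<phi>. \<exists>r'. [r' = s] (rmod 1/2) \<and> ls \<Phi> x \<phi> = ereal r'))" for s
  have lim: "\<exists>r'. [r' = r] (rmod 1/2) \<and> ls \<Phi> x \<phi> = ereal r'" if lift: "is_angle_lift A \<Phi>" for \<Phi> x \<phi>
  proof -
    have "\<exists>c. 2 * c \<in> \<int> \<and> (\<forall>x \<phi>. ls \<Phi> x \<phi> = ereal (\<kappa> + of_int m / 2 * \<alpha> + c))"
      unfolding ls_def by (rule rotation_orbit_limsup[OF A(1) lift \<beta> conj \<gamma>])
    then obtain c where c: "2 * c \<in> \<int>" "ls \<Phi> x \<phi> = ereal (\<kappa> + of_int m / 2 * \<alpha> + c)"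
      by blast
    show ?thesis by (rule exI[of _ "\<rho> + c"]) (use cong[OF c(1)] c(2) in \<open>simp only: \<rho>_def\<close>)
  qed
  have "P r" unfolding P_def using r0 r1 lim by blast
  moreover have "s = r" if s: "P s" for s
  proof -
    obtain r' where r': "[r' = s] (rmod 1/2)" "ls \<Phi>0 0 0 = ereal r'"
      using s A(2) unfolding P_def by blast
    obtain r'' where r'': "[r'' = r] (rmod 1/2)" "ls \<Phi>0 0 0 = ereal r''"
      using lim[OF A(2)] by blast
    have "r' = r''" using r'(2) r''(2) by simp
    then have sr: "[s = r] (rmod 1/2)" using r'(1) r''(1) unfolding rcong_def by simp
    have "0 \<le> s" "s < 1/2" using s unfolding P_def by blast+
    then show "s = r" using r0 r1 by (intro rcong_imp_eq[OF sr]) linarith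
  qed
  ultimately have "(THE s. P s) = r" by (rule the_equality)
  moreover have "rotation_number \<alpha> A = (THE s. P s)"
    unfolding rotation_number_def P_def ls_def ..
  ultimately show ?thesis unfolding r_def \<rho>_def by simp
qed

text \<open>A shear fixes the horizontal line, so its lift fixes all half-integers and maps each
  interval between neighbours into itself. Iterates therefore move a point by at most 1/2: there is
  no linear drift.\<close>

lemma parabolic_dir_lift:
  assumes "s \<in> {1, -1 :: real}"
  obtains \<gamma> where "continuous_on UNIV \<gamma>" "\<And>\<phi>. acts_dir (mat2 s a 0 s) \<phi> (\<gamma> \<phi>)"
    "\<And>n \<phi>. \<bar>(\<gamma> ^^ n) \<phi> - \<phi>\<bar> \<le> 1/2"
proof -
  have ss: "s * s = 1" using assms by auto
  \<comment> \<open>Since s s = 1, the matrix is s times the shear by s a, and s does not affect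
    lines. The shears form a path from the identity.\<close>
  define M where "M t = mat2 1 (t * (s * a)) 0 1" for t :: real
  obtain \<Psi> where \<Psi>: "continuous_on (UNIV \<times> UNIV) \<Psi>"
    "\<And>t \<phi>. t \<in> UNIV \<Longrightarrow> \<exists>\<rho>>0. M t *v direction \<phi> = \<rho> *\<^sub>R direction (\<Psi> (t, \<phi>))"
    "\<And>t \<phi>. t \<in> UNIV \<Longrightarrow> \<Psi> (t, \<phi> + 1/2) = \<Psi> (t, \<phi>) + 1/2"
    "\<And>t \<phi>. t \<in> {0} \<Longrightarrow> \<Psi> (t, \<phi>) = \<phi> + 0"
  proof (rule angle_lift[of UNIV M "{0}" 0 "\<lambda>_. 0"])
    show "continuous_on UNIV M" unfolding M_def by (intro continuous_intros)
    show "M t = R_rot 0" if "t \<in> {0}" for t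
      using that by (simp add: M_def) (rule mat2_eqI, simp_all add: mat_def)
  qed (auto simp: M_def)
  define \<gamma> where "\<gamma> \<phi> = \<Psi> (1, \<phi>)" for \<phi>
  have \<gamma>c: "continuous_on UNIV \<gamma>"
    unfolding \<gamma>_def by (rule continuous_on_compose2[OF \<Psi>(1)]) (auto intro!: continuous_intros)
  have \<gamma>h: "\<gamma> (\<phi> + 1/2) = \<gamma> \<phi> + 1/2" for \<phi> using \<Psi>(3) by (simp add: \<gamma>_def)
  have \<gamma>n: "\<gamma> (\<phi> + of_int n / 2) = \<gamma> \<phi> + of_int n / 2" for \<phi> n
    using translation_int[of \<gamma> "1/2" "1/2" \<phi> n] \<gamma>h by simp
  have pol: "\<exists>\<rho>>0. M t *v direction \<phi> = \<rho> *\<^sub>R direction (\<Psi> (t, \<phi>))" for t \<phi> using \<Psi>(2) by simp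
  have act: "acts_dir (mat2 s a 0 s) \<phi> (\<gamma> \<phi>)" for \<phi>
  proof -
    obtain \<rho> where \<rho>: "\<rho> > 0" "M 1 *v direction \<phi> = \<rho> *\<^sub>R direction (\<gamma> \<phi>)"
      using pol[of 1 \<phi>] by (auto simp: \<gamma>_def)
    have "mat2 s a 0 s *v direction \<phi> = s *\<^sub>R (M 1 *v direction \<phi>)"
      by (simp add: vec_eq_iff forall_2 matrix_vector_2 M_def distrib_left mult.assoc [symmetric] ss)
    also have "\<dots> = (s * \<rho>) *\<^sub>R direction (\<gamma> \<phi>)" by (simp add: \<rho>(2))
    finally show ?thesis unfolding acts_dir_def using assms \<rho>(1) by (intro exI[of _ "s * \<rho>"]) auto
  qed
  have e1: "M t *v direction 0 = 1 *\<^sub>R direction 0" for t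
    by (simp add: vec_eq_iff forall_2 matrix_vector_2 M_def)
  have \<gamma>0: "\<gamma> 0 = 0"
  proof -
    have "continuous_on UNIV (\<lambda>t. \<Psi> (t, 0))"
      by (rule continuous_on_compose2[OF \<Psi>(1)]) (auto intro!: continuous_intros)
    moreover have "\<Psi> (t, 0) \<in> \<int>" for t
    proof -
      obtain \<rho> where \<rho>: "\<rho> > 0" "M t *v direction 0 = \<rho> *\<^sub>R direction (\<Psi> (t, 0))" using pol by blast
      then have "\<rho> *\<^sub>R direction (\<Psi> (t, 0)) = 1 *\<^sub>R direction 0" using e1 by simp
      then have "\<Psi> (t, 0) - 0 \<in> \<int>" by (rule direction_eq_imp_int) (use \<rho> in auto)
      then show ?thesis by simp
    qed
    ultimately have "\<Psi> (1, 0) = \<Psi> (0, 0)"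
      by (intro int_valued_const[of UNIV "\<lambda>t. \<Psi> (t, 0)"]) auto
    then show ?thesis using \<Psi>(4)[of 0 0] by (simp add: \<gamma>_def)
  qed
  \<comment> \<open>Only horizontal directions are mapped to horizontal ones, because a shear
    preserves the second coordinate.\<close>
  have inv: "2 * \<phi> \<in> \<int>" if half: "2 * \<gamma> \<phi> \<in> \<int>" for \<phi>
  proof -
    obtain \<rho> where \<rho>: "\<rho> > 0" "M 1 *v direction \<phi> = \<rho> *\<^sub>R direction (\<gamma> \<phi>)"
      using pol[of 1 \<phi>] by (auto simp: \<gamma>_def)
    have "sin (2 * pi * \<phi>) = \<rho> * sin (2 * pi * \<gamma> \<phi>)"
      using arg_cong[OF \<rho>(2), of "\<lambda>v. v $ 2"] by (simp add: matrix_vector_2 M_def)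
    moreover have "sin (2 * pi * \<gamma> \<phi>) = 0"
    proof -
      obtain i :: int where "2 * \<gamma> \<phi> = of_int i" using half by (auto elim: Ints_cases)
      then have "2 * pi * \<gamma> \<phi> = of_int i * pi" by (simp add: algebra_simps)
      then show ?thesis unfolding sin_zero_iff_int2 by blast
    qed
    ultimately have "sin (2 * pi * \<phi>) = 0" by simp
    then obtain i :: int where "2 * pi * \<phi> = of_int i * pi" unfolding sin_zero_iff_int2 by blast
    then have "pi * (2 * \<phi>) = pi * of_int i" by (simp add: algebra_simps)
    then show ?thesis by simp
  qed
  \<comment> \<open>If a point left the interval, the intermediate value theorem would give an
    interior point sent to an end point, against \<open>inv\<close>.\<close>
  have base: "0 \<le> \<gamma> \<phi> \<and> \<gamma> \<phi> \<le> 1/2" if "0 \<le> \<phi>" "\<phi> \<le> 1/2" for \<phi>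
  proof -
    have \<gamma>1: "\<gamma> (1/2) = 1/2" using \<gamma>h[of 0] \<gamma>0 by simp
    have notint: "2 * \<psi> \<notin> \<int>" if "0 < \<psi>" "\<psi> < 1/2" for \<psi> :: real
    proof
      assume "2 * \<psi> \<in> \<int>"
      then obtain i :: int where "2 * \<psi> = of_int i" by (auto elim: Ints_cases)
      then have "0 < real_of_int i" "real_of_int i < 1" using that by linarith+
      then show False by simp
    qed
    have False if "\<gamma> \<phi> < 0"
    proof -
      have "\<exists>\<psi>\<ge>\<phi>. \<psi> \<le> 1/2 \<and> \<gamma> \<psi> = 0"
        by (rule IVT') (use that \<open>\<phi> \<le> 1/2\<close> \<gamma>1 continuous_on_subset[OF \<gamma>c subset_UNIV] in auto)
      then obtain \<psi> where \<psi>: "\<phi> \<le> \<psi>" "\<psi> \<le> 1/2" "\<gamma> \<psi> = 0" by blast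
      have "\<psi> \<noteq> \<phi>" using \<psi>(3) that by auto
      moreover have "\<psi> \<noteq> 1/2"
      proof
        assume h: "\<psi> = 1/2"
        show False using \<psi>(3) unfolding h \<gamma>1 by simp
      qed
      ultimately have "2 * \<psi> \<notin> \<int>" using notint[of \<psi>] \<psi> \<open>0 \<le> \<phi>\<close> by linarith
      then show False using inv[of \<psi>] \<psi>(3) by simp
    qed
    moreover have False if "\<gamma> \<phi> > 1/2"
    proof -
      have "\<exists>\<psi>\<ge>0. \<psi> \<le> \<phi> \<and> \<gamma> \<psi> = 1/2"
        by (rule IVT') (use that \<open>0 \<le> \<phi>\<close> \<gamma>0 continuous_on_subset[OF \<gamma>c subset_UNIV] in auto)
      then obtain \<psi> where \<psi>: "0 \<le> \<psi>" "\<psi> \<le> \<phi>" "\<gamma> \<psi> = 1/2" by blast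
      have "\<psi> \<noteq> \<phi>" "\<psi> \<noteq> 0" using \<psi>(3) that \<gamma>0 by auto
      then have "2 * \<psi> \<notin> \<int>" using notint[of \<psi>] \<psi> \<open>\<phi> \<le> 1/2\<close> by linarith
      then show False using inv[of \<psi>] \<psi>(3) by simp
    qed
    ultimately show ?thesis by (meson not_le)
  qed
  have cell: "of_int j / 2 \<le> \<gamma> \<phi> \<and> \<gamma> \<phi> \<le> of_int j / 2 + 1/2" if "of_int j / 2 \<le> \<phi>" "\<phi> \<le> of_int j / 2 + 1/2" for \<phi> j
    using base[of "\<phi> - of_int j / 2"] \<gamma>n[of "\<phi> - of_int j / 2" j] that by simp
  have "\<bar>(\<gamma> ^^ n) \<phi> - \<phi>\<bar> \<le> 1/2" for n \<phi>
  proof -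
    define j where "j = \<lfloor>2 * \<phi>\<rfloor>"
    have j: "of_int j / 2 \<le> \<phi>" "\<phi> \<le> of_int j / 2 + 1/2" unfolding j_def by linarith+
    have "of_int j / 2 \<le> (\<gamma> ^^ n) \<phi> \<and> (\<gamma> ^^ n) \<phi> \<le> of_int j / 2 + 1/2"
      by (induction n) (use j cell in auto)
    then show ?thesis using j by linarith
  qed
  then show ?thesis using that \<gamma>c act by blast
qed

lemma rotation_dir_lift:
  "continuous_on UNIV (\<lambda>\<phi>. \<phi> + \<kappa>)" "acts_dir (R_rot \<kappa>) \<phi> (\<phi> + \<kappa>)"
  "\<bar>((\<lambda>\<phi>. \<phi> + \<kappa>) ^^ n) \<phi> - \<phi> - real n * \<kappa>\<bar> \<le> 0"
proof -
  have "((\<lambda>\<phi>. \<phi> + \<kappa>) ^^ n) \<phi> = \<phi> + real n * \<kappa>" by (induction n) (simp_all add: algebra_simps)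
  then show "\<bar>((\<lambda>\<phi>. \<phi> + \<kappa>) ^^ n) \<phi> - \<phi> - real n * \<kappa>\<bar> \<le> 0" by simp
  show "acts_dir (R_rot \<kappa>) \<phi> (\<phi> + \<kappa>)"
    unfolding acts_dir_def R_rot_direction by (intro exI[of _ 1]) simp
  show "continuous_on UNIV (\<lambda>\<phi>. \<phi> + \<kappa>)" by (intro continuous_intros)
qed

subsection \<open>The nonresonant case\<close>

text \<open>Conjugacies are kept in the form A(x) B(x) = B(x + \<alpha>) C, free of inverses, until
  the end.\<close>

lemma matrix_inv_conj:
  fixes A B B' C :: "real^2^2"
  assumes "det B' = 1" "A ** B = B' ** C"
  shows "matrix_inv B' ** A ** B = C"
proof -
  have "invertible B'" using assms(1) by (simp add: invertible_det_nz)
  then have "matrix_inv B' ** B' = mat 1"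
    unfolding invertible_def matrix_inv_def by (rule someI2_ex) blast
  then show ?thesis
    by (metis assms(2) matrix_mul_assoc matrix_mul_lid)
qed

text \<open>The multiples of \<alpha> modulo 1 are dense, and h takes the value h 0 on all of
  them.\<close>

lemma almost_periodic_const:
  fixes h :: "real \<Rightarrow> real"
  assumes irr: "\<alpha> \<notin> \<rat>" and cont: "continuous_on UNIV h"
    and per: "\<And>x. h (x + 1) = h x" "\<And>x. h (x + \<alpha>) = h x"
  shows "h x = h 0"
proof (rule ccontr)
  assume "h x \<noteq> h 0"
  then have e: "\<bar>h x - h 0\<bar> > 0" by simp
  have "isCont h x" using cont by (simp add: continuous_on_eq_continuous_at)
  then obtain d where d: "d > 0" "\<And>y. \<bar>y - x\<bar> < d \<Longrightarrow> \<bar>h y - h x\<bar> < \<bar>h x - h 0\<bar>"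
    using e unfolding continuous_at_eps_delta dist_real_def by blast
  obtain m k where mk: "k > 0" "\<bar>of_int k * \<alpha> - of_int m - x\<bar> < d"
    using sequence_of_fractional_parts_is_dense[OF irr d(1)] by blast
  have p1: "h (y + of_int n) = h y" for y n
    using translation_int[of h 1 0 y n] per(1) by simp
  have p2: "h (y + of_int n * \<alpha>) = h y" for y n
    using translation_int[of h \<alpha> 0 y n] per(2) by simp
  have "h (of_int k * \<alpha> - of_int m) = h 0"
    using p1[of "of_int k * \<alpha>" "- m"] p2[of 0 k] by simp
  then show False using d(2)[OF mk(2)] by (simp add: abs_minus_commute)
qed

text \<open>Compare the growth of a continuous argument of \<open>\<psi>\<close> under the two translations.\<close>
lemma twisted_function_freq:
  fixes \<psi> :: "real \<Rightarrow> complex"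
  assumes cont: "continuous_on UNIV \<psi>" and nz: "\<And>x. \<psi> x \<noteq> 0"
    and per: "\<And>x. \<psi> (x + 1) = \<psi> x" "\<And>x. \<psi> (x + \<alpha>) = ec (of_real \<tau>) * \<psi> x"
  shows "\<tau> \<in> freq_module \<alpha>"
proof -
  obtain L where L: "continuous_on UNIV L" "\<And>x. \<psi> x = exp (L x)"
    using continuous_logarithm_on_contractible[OF cont] nz contractible_UNIV by (metis UNIV_I)
  define g where "g x = Im (L x) / (2 * pi)" for x
  have gc: "continuous_on UNIV g" unfolding g_def by (intro continuous_intros L(1)) simp
  have sh: "continuous_on UNIV (\<lambda>x. g (x + a))" for a
    by (rule continuous_on_compose2[OF gc]) (auto intro!: continuous_intros)
  have i1: "g (x + 1) - g x \<in> \<int>" for x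
  proof -
    have "exp (L (x + 1)) = exp (L x)" using per(1)[of x] L(2) by simp
    then obtain n :: int where "L (x + 1) = L x + (of_int (2 * n) * pi) * \<i>" unfolding exp_eq by blast
    then have "g (x + 1) - g x = of_int n" by (simp add: g_def field_simps)
    then show ?thesis by simp
  qed
  have i2: "g (x + \<alpha>) - g x - \<tau> \<in> \<int>" for x
  proof -
    have "exp (L (x + \<alpha>)) = exp (2 * of_real pi * \<i> * of_real \<tau> + L x)"
      using per(2)[of x] L(2) by (simp add: exp_add ec_def)
    then obtain n :: int where "L (x + \<alpha>) = 2 * of_real pi * \<i> * of_real \<tau> + L x + (of_int (2 * n) * pi) * \<i>"
      unfolding exp_eq by blast
    then have "g (x + \<alpha>) - g x - \<tau> = of_int n" by (simp add: g_def field_simps)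
    then show ?thesis by simp
  qed
  obtain d m :: int where dm: "g (0 + 1) - g 0 = of_int d" "g (0 + \<alpha>) - g 0 - \<tau> = of_int m"
    using i1[of 0] i2[of 0] by (metis Ints_cases)
  have d: "g (x + 1) = g x + of_int d" for x
  proof -
    have "g (x + 1) - g x = g (0 + 1) - g 0"
      by (rule int_valued_const[of UNIV]) (use i1 in \<open>auto intro!: continuous_intros sh gc\<close>)
    then show ?thesis using dm(1) by simp
  qed
  have m: "g (x + \<alpha>) = g x + \<tau> + of_int m" for x
  proof -
    have "g (x + \<alpha>) - g x - \<tau> = g (0 + \<alpha>) - g 0 - \<tau>"
      by (rule int_valued_const[of UNIV]) (use i2 in \<open>auto intro!: continuous_intros sh gc\<close>)
    then show ?thesis using dm(2) by simp
  qed
  \<comment> \<open>Without its linear part the argument is periodic, hence bounded, so its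
    increment c along the rotation must be 0. The equation c = 0 is the claimed resonance.\<close>
  define h where "h x = g x - of_int d * x" for x
  define c where "c = \<tau> + of_int m - of_int d * \<alpha>"
  have hc: "continuous_on UNIV h" unfolding h_def by (intro continuous_intros gc)
  have h1: "h (x + 1) = h x" for x unfolding h_def d by (simp add: algebra_simps)
  have h2: "h (x + \<alpha>) = h x + c" for x unfolding h_def c_def m by (simp add: algebra_simps)
  have hn: "h (x + of_int n) = h x" for x n
    using translation_int[of h 1 0 x n] h1 by simp
  obtain K where K: "\<And>x. x \<in> {0..1} \<Longrightarrow> \<bar>h x\<bar> \<le> K"
    using continuous_on_compact_bounded[OF compact_Icc continuous_on_subset[OF hc subset_UNIV]] by blast
  have bd: "\<bar>h x\<bar> \<le> K" for x
  proof -
    have "x - of_int \<lfloor>x\<rfloor> \<in> {0..1}" by simp linarith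
    from K[OF this] show ?thesis using hn[of x "- \<lfloor>x\<rfloor>"] by simp
  qed
  have "h (real n * \<alpha>) = h 0 + real n * c" for n
  proof (induction n)
    case (Suc n)
    then show ?case using h2[of "real n * \<alpha>"] by (simp add: algebra_simps)
  qed simp
  then have "real n * \<bar>c\<bar> \<le> 2 * K" for n
  proof -
    have "real n * \<bar>c\<bar> = \<bar>h (real n * \<alpha>) - h 0\<bar>" using \<open>h (real n * \<alpha>) = h 0 + real n * c\<close> by (simp add: abs_mult)
    then show ?thesis using bd[of "real n * \<alpha>"] bd[of 0] by linarith
  qed
  then have "c = 0" using reals_Archimedean3[of "\<bar>c\<bar>"] by (metis abs_le_zero_iff linorder_not_le)
  then have "\<tau> = of_int d * \<alpha> + of_int (- m)" by (simp add: c_def)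
  then show ?thesis unfolding freq_module_def by blast
qed

lemma eventual_decay_imp_exp_decay:
  assumes "\<exists>K. \<forall>k. \<bar>k\<bar> \<ge> K \<longrightarrow> cmod (u k) \<le> exp (- 2 * pi * \<eta> * real_of_int \<bar>k\<bar>)"
  shows "exp_decay \<eta> u"
proof -
  obtain K where K: "\<And>k. \<bar>k\<bar> \<ge> K \<Longrightarrow> cmod (u k) \<le> exp (- 2 * pi * \<eta> * real_of_int \<bar>k\<bar>)"
    using assms by blast
  have "bdd_above ((\<lambda>k. cmod (u k) * exp (2 * pi * \<eta> * real_of_int \<bar>k\<bar>)) ` {- K..K})"
    by (intro bdd_above_finite) simp
  then obtain C where C: "\<And>k. k \<in> {- K..K} \<Longrightarrow> cmod (u k) * exp (2 * pi * \<eta> * real_of_int \<bar>k\<bar>) \<le> C"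
    unfolding bdd_above_def by blast
  have "cmod (u k) \<le> max 1 C * exp (- 2 * pi * \<eta> * real_of_int \<bar>k\<bar>)" for k
  proof (cases "\<bar>k\<bar> \<ge> K")
    case True
    have "1 * exp (- 2 * pi * \<eta> * real_of_int \<bar>k\<bar>) \<le> max 1 C * exp (- 2 * pi * \<eta> * real_of_int \<bar>k\<bar>)"
      by (intro mult_right_mono) auto
    then show ?thesis using K[OF True] by linarith
  next
    case False
    then have "k \<in> {- K..K}" by auto
    from C[OF this] have "cmod (u k) * exp (2 * pi * \<eta> * real_of_int \<bar>k\<bar>) \<le> max 1 C"
      by (rule max.coboundedI2)
    then have "cmod (u k) * exp (2 * pi * \<eta> * real_of_int \<bar>k\<bar>) * exp (- 2 * pi * \<eta> * real_of_int \<bar>k\<bar>)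
        \<le> max 1 C * exp (- 2 * pi * \<eta> * real_of_int \<bar>k\<bar>)" by (intro mult_right_mono) auto
    then show ?thesis by (simp add: mult.assoc exp_add [symmetric])
  qed
  then show ?thesis unfolding exp_decay_def by blast
qed

lemma aubry_dual_imp_dual_defect:
  assumes "lam \<noteq> 0" "\<forall>k. aubry_dual lam \<alpha> \<theta> u k = complex_of_real E * u k"
  shows "dual_defect lam \<alpha> \<theta> E u k = 0"
  using assms(2) unfolding aubry_dual_eq[OF assms(1)] dual_defect_def by simp

lemma det_S_AM: "det (S_AM lam E x) = 1"
  by (simp add: S_AM_def)

text \<open>Duality at real points, arranged so that the left factor is the upper left entry of
  \<open>S_AM\<close>.\<close>

lemma fourier_recurrence:
  assumes u: "exp_decay r u" and r: "r > 0" and eu: "\<And>k. dual_defect lam \<alpha> \<theta> E u k = 0"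
  shows "of_real (E - 2 * lam * cos (2 * pi * x)) * fourier u (of_real x) =
     ec (of_real \<theta>) * fourier u (of_real (x + \<alpha>)) + ec (- of_real \<theta>) * fourier u (of_real (x - \<alpha>))"
proof -
  have "dual_defect lam \<alpha> \<theta> E u = (\<lambda>_. 0)" using eu by auto
  then have "fourier (dual_defect lam \<alpha> \<theta> E u) (of_real x) = 0" by (simp add: fourier_def)
  moreover have "ec (of_real x) + ec (- of_real x) = complex_of_real (2 * cos (2 * pi * x))"
    by (rule ec_cos[symmetric])
  ultimately show ?thesis
    using fourier_dual_defect[OF u of_real_in_strip[OF r], of lam \<alpha> \<theta> E x] by (simp add: algebra_simps)
qed

lemma fourier_shift_holomorphic:
  assumes "exp_decay r u"
  shows "(\<lambda>z. fourier u (z + of_real a)) holomorphic_on strip r"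
proof -
  have "(fourier u \<circ> (\<lambda>z. z + of_real a)) holomorphic_on strip r"
    by (rule holomorphic_on_compose_gen[OF _ fourier_holomorphic[OF assms]]) (auto intro!: holomorphic_intros)
  then show ?thesis by (simp add: o_def)
qed

text \<open>If (p, q) is proportional to its conjugate with factor \<psi>, then, the cocycle being
  real, translation by \<alpha> multiplies \<psi> by \<open>ec (2 \<theta>)\<close>, and
  \<open>twisted_function_freq\<close> applies.\<close>

lemma nonresonant_Wronskian:
  fixes p q :: "real \<Rightarrow> complex" and e :: "real \<Rightarrow> real"
  assumes cont: "continuous_on UNIV p" "continuous_on UNIV q"
    and per: "\<And>x. p (x + 1) = p x" "\<And>x. q (x + 1) = q x"
    and nz: "\<And>x. p x \<noteq> 0 \<or> q x \<noteq> 0"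
    and eqs: "\<And>x. of_real (e x) * p x - q x = ec (of_real \<theta>) * p (x + \<alpha>)" "\<And>x. p x = ec (of_real \<theta>) * q (x + \<alpha>)"
    and dep: "\<And>x. Im (cnj (p x) * q x) = 0"
  shows "2 * \<theta> \<in> freq_module \<alpha>"
proof -
  define N where "N x = p x * cnj (p x) + q x * cnj (q x)" for x
  \<comment> \<open>This is the common value of cnj p / p and cnj q / q, written with a denominator
    that never vanishes although p or q alone may.\<close>
  define \<psi> where "\<psi> x = (cnj (p x) * cnj (p x) + cnj (q x) * cnj (q x)) / N x" for x
  have N: "N x \<noteq> 0" for x
  proof
    assume "N x = 0"
    then have "complex_of_real ((cmod (p x))\<^sup>2 + (cmod (q x))\<^sup>2) = 0"
      unfolding N_def complex_norm_square of_real_add by simp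
    then have "(cmod (p x))\<^sup>2 + (cmod (q x))\<^sup>2 = 0" using of_real_eq_0_iff by blast
    then have "p x = 0" "q x = 0" by (simp_all add: sum_power2_eq_zero_iff)
    then show False using nz[of x] by simp
  qed
  have sym: "cnj (p x) * q x = p x * cnj (q x)" for x
    using dep[of x] by (simp add: complex_eq_iff algebra_simps)
  have conj: "cnj (p x) = \<psi> x * p x" "cnj (q x) = \<psi> x * q x" for x
  proof -
    have "(cnj (p x) * cnj (p x) + cnj (q x) * cnj (q x)) * p x = cnj (p x) * (p x * cnj (p x)) + cnj (q x) * (p x * cnj (q x))"
      by (simp add: algebra_simps)
    also have "\<dots> = cnj (p x) * N x" unfolding sym[symmetric] N_def by (simp add: algebra_simps)
    finally show "cnj (p x) = \<psi> x * p x" using N[of x] by (simp add: \<psi>_def)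
    have "(cnj (p x) * cnj (p x) + cnj (q x) * cnj (q x)) * q x = cnj (p x) * (cnj (p x) * q x) + cnj (q x) * (q x * cnj (q x))"
      by (simp add: algebra_simps)
    also have "\<dots> = cnj (q x) * N x" unfolding sym N_def by (simp add: algebra_simps)
    finally show "cnj (q x) = \<psi> x * q x" using N[of x] by (simp add: \<psi>_def)
  qed
  have "\<psi> x \<noteq> 0" for x using conj[of x] nz[of x] by fastforce
  moreover have "continuous_on UNIV \<psi>"
    unfolding \<psi>_def N_def by (intro continuous_intros cont) (use N in \<open>auto simp: N_def\<close>)
  moreover have "\<psi> (x + 1) = \<psi> x" for x by (simp add: \<psi>_def N_def per)
  moreover have "\<psi> (x + \<alpha>) = ec (of_real (2 * \<theta>)) * \<psi> x" for x
  proof -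
    have e2: "ec (of_real (2 * \<theta>)) = ec (of_real \<theta>) * ec (of_real \<theta>)"
      by (simp add: ec_add [symmetric])
    have ce: "cnj (ec (of_real \<theta>)) = inverse (ec (of_real \<theta>))" by (simp add: cnj_ec ec_minus)
    have inv: "ec (of_real \<theta>) * cnj (ec (of_real \<theta>)) = 1" by (simp add: ce)
    \<comment> \<open>The same computation is needed for both components, since only one of them is
      known to be nonzero at a given point.\<close>
    have key: "\<psi> (x + \<alpha>) * w = ec (of_real (2 * \<theta>)) * \<psi> x * w"
      if "v' = ec (of_real \<theta>) * w" "cnj v' = \<psi> x * v'" "cnj w = \<psi> (x + \<alpha>) * w" for v' w
    proof -
      have "\<psi> (x + \<alpha>) * w = (ec (of_real \<theta>) * cnj (ec (of_real \<theta>))) * cnj w" using that(3) inv by simp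
      also have "\<dots> = ec (of_real \<theta>) * cnj v'" using that(1) by simp
      also have "\<dots> = ec (of_real \<theta>) * (\<psi> x * (ec (of_real \<theta>) * w))" using that(1,2) by simp
      finally show ?thesis unfolding e2 by (simp only: mult_ac)
    qed
    have "cnj (of_real (e x) * p x - q x) = \<psi> x * (of_real (e x) * p x - q x)"
      by (simp add: conj right_diff_distrib mult.left_commute)
    from key[OF eqs(1) this conj(1)] key[OF eqs(2) conj(1) conj(2)]
    show ?thesis using nz[of "x + \<alpha>"] by (metis mult_right_cancel)
  qed
  ultimately show ?thesis by (intro twisted_function_freq)
qed

lemma nonresonant_conjugacy:
  assumes irr: "\<alpha> \<notin> \<rat>" and \<eta>: "\<eta> > 0" and u: "exp_decay \<eta> u" "u k0 \<noteq> 0"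
    and eu: "\<And>k. dual_defect lam \<alpha> \<theta> E u k = 0" and nr: "2 * \<theta> \<notin> freq_module \<alpha>"
  shows "\<exists>B. \<exists>s\<in>{1, -1 :: real}. circle_to_SL2 B \<and> (\<forall>i j. strip_ext \<eta> (\<lambda>x. B x $ i $ j)) \<and>
    (\<forall>x. S_AM lam E x ** B x = B (x + \<alpha>) ** R_rot (s * \<theta>))"
proof -
  define P where "P z = ec (of_real \<theta>) * fourier u (z + of_real 0)" for z
  define Q where "Q z = fourier u (z + of_real (- \<alpha>))" for z
  have hol: "P holomorphic_on strip \<eta>" "Q holomorphic_on strip \<eta>"
    unfolding P_def Q_def by (intro holomorphic_intros fourier_shift_holomorphic u(1))+
  define p q where "p x = P (of_real x)" and "q x = Q (of_real x)" for x :: real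
  define e where "e x = E - 2 * lam * cos (2 * pi * x)" for x
  have cont: "continuous_on UNIV p" "continuous_on UNIV q"
    unfolding p_def q_def
    by (rule continuous_on_compose2[OF holomorphic_on_imp_continuous_on[OF hol(1)]]
        continuous_on_compose2[OF holomorphic_on_imp_continuous_on[OF hol(2)]];
        auto intro!: continuous_intros of_real_in_strip \<eta>)+
  have per: "p (x + 1) = p x" "q (x + 1) = q x" for x
    using fourier_periodic[of u "of_real x"] fourier_periodic[of u "of_real x - of_real \<alpha>"]
    by (simp_all add: p_def q_def P_def Q_def algebra_simps)
  have nz: "p x \<noteq> 0 \<or> q x \<noteq> 0" for x
    using cocycle_nonvanishing[OF irr \<eta> u eu of_real_in_strip[OF \<eta>], of x]
    by (auto simp: p_def q_def P_def Q_def)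
  have eq2: "p x = ec (of_real \<theta>) * q (x + \<alpha>)" for x
    by (simp add: p_def q_def P_def Q_def)
  have eq1: "of_real (e x) * p x - q x = ec (of_real \<theta>) * p (x + \<alpha>)" for x
  proof -
    have "of_real (e x) * p x = ec (of_real \<theta>) * (of_real (e x) * fourier u (of_real x))"
      by (simp add: p_def P_def)
    also have "\<dots> = ec (of_real \<theta>) * (ec (of_real \<theta>) * fourier u (of_real (x + \<alpha>)))
        + (ec (of_real \<theta>) * ec (- of_real \<theta>)) * fourier u (of_real (x - \<alpha>))"
      unfolding e_def fourier_recurrence[OF u(1) \<eta> eu] by (simp add: algebra_simps)
    also have "ec (of_real \<theta>) * ec (- of_real \<theta>) = 1" by (simp add: ec_minus)
    finally show ?thesis by (simp add: p_def q_def P_def Q_def)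
  qed
  define c s where "c = cos (2 * pi * \<theta>)" and "s = sin (2 * pi * \<theta>)"
  have ecs: "Re (ec (of_real \<theta>)) = c" "Im (ec (of_real \<theta>)) = s"
    by (simp_all add: ec_eq_cis c_def s_def)
  have r1: "e x * Re (p x) - Re (q x) = c * Re (p (x + \<alpha>)) - s * Im (p (x + \<alpha>))"
    and r2: "e x * Im (p x) - Im (q x) = s * Re (p (x + \<alpha>)) + c * Im (p (x + \<alpha>))" for x
    using arg_cong[OF eq1[of x], of Re] arg_cong[OF eq1[of x], of Im] by (simp_all add: ecs)
  have r3: "Re (p x) = c * Re (q (x + \<alpha>)) - s * Im (q (x + \<alpha>))"
    and r4: "Im (p x) = s * Re (q (x + \<alpha>)) + c * Im (q (x + \<alpha>))" for x
    using arg_cong[OF eq2[of x], of Re] arg_cong[OF eq2[of x], of Im] by (simp_all add: ecs)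
  have cs: "c * c + s * s = 1"
    using sin_cos_squared_add2[of "2 * pi * \<theta>"] by (simp add: c_def s_def power2_eq_square add.commute)
  \<comment> \<open>The Wronskian of real and imaginary parts. It is invariant under translation by
    \<alpha> because both the cocycle and the rotation by \<theta> have determinant 1.\<close>
  define d where "d x = Re (p x) * Im (q x) - Im (p x) * Re (q x)" for x
  have dper: "d (x + \<alpha>) = d x" for x
  proof -
    have "d x = Im (p x) * (e x * Re (p x) - Re (q x)) - Re (p x) * (e x * Im (p x) - Im (q x))"
      by (simp add: d_def algebra_simps)
    also have "\<dots> = (c * c + s * s) * d (x + \<alpha>)"
      unfolding r1 r2 unfolding r3 r4 d_def by (simp add: algebra_simps)
    finally show ?thesis using cs by simp
  qed
  have d: "d x = d 0" for x
    by (rule almost_periodic_const[where h = d, OF irr _ _ dper])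
      (use cont in \<open>auto simp: d_def per intro!: continuous_intros\<close>)
  have d0: "d 0 \<noteq> 0"
  proof
    assume "d 0 = 0"
    then have dep: "Im (cnj (p x) * q x) = 0" for x using d[of x] by (simp add: d_def)
    show False using nonresonant_Wronskian[where e = e, OF cont per nz eq1 eq2 dep] nr by blast
  qed
  \<comment> \<open>\<kappa> scales the determinant to modulus 1, and \<sigma> flips the second
    column if it is negative. The flip reverses the rotation, which is the origin of the sign in
    front of \<theta>.\<close>
  define \<sigma> where "\<sigma> = sgn (d 0)"
  define \<kappa> where "\<kappa> = 1 / sqrt \<bar>d 0\<bar>"
  have \<sigma>: "\<sigma> \<in> {1, -1}" "\<sigma> * \<sigma> = 1" using d0 by (auto simp: \<sigma>_def sgn_if)
  have \<kappa>: "\<kappa> * \<kappa> * (\<sigma> * d x) = 1" for x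
    using d0 d[of x] by (simp add: \<kappa>_def \<sigma>_def sgn_if)
  define B where "B x = mat2 (\<kappa> * Re (p x)) (\<sigma> * (\<kappa> * Im (p x))) (\<kappa> * Re (q x)) (\<sigma> * (\<kappa> * Im (q x)))" for x
  have "det (B x) = 1" for x
    using \<kappa>[of x] by (simp add: B_def d_def algebra_simps)
  then have circ: "circle_to_SL2 B" unfolding circle_to_SL2_def SL2_def by (simp add: B_def per)
  have ext: "strip_ext \<eta> (\<lambda>x. Re (p x))" "strip_ext \<eta> (\<lambda>x. Re (q x))"
      "strip_ext \<eta> (\<lambda>x. Im (p x))" "strip_ext \<eta> (\<lambda>x. Im (q x))"
  proof -
    show "strip_ext \<eta> (\<lambda>x. Re (p x))" "strip_ext \<eta> (\<lambda>x. Re (q x))"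
      unfolding p_def q_def by (rule strip_ext_Re[OF hol(1)], rule strip_ext_Re[OF hol(2)])
    have "strip_ext \<eta> (\<lambda>x. Re ((- \<i>) * P (of_real x)))" "strip_ext \<eta> (\<lambda>x. Re ((- \<i>) * Q (of_real x)))"
      by (rule strip_ext_Re, intro holomorphic_intros hol)+
    then show "strip_ext \<eta> (\<lambda>x. Im (p x))" "strip_ext \<eta> (\<lambda>x. Im (q x))"
      by (simp_all add: p_def q_def)
  qed
  have "strip_ext \<eta> (\<lambda>x. B x $ i $ j)" for i j
    using exhaust_2[of i] exhaust_2[of j] by (auto simp: B_def intro!: strip_ext_cmult ext)
  moreover have "S_AM lam E x ** B x = B (x + \<alpha>) ** R_rot (- \<sigma> * \<theta>)" for x
  proof -
    have R: "R_rot (- \<sigma> * \<theta>) = mat2 c (\<sigma> * s) (- (\<sigma> * s)) c"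
      using \<sigma>(1) by (auto simp: R_rot_def c_def s_def)
    show ?thesis
      unfolding S_AM_def B_def mat2_mult R e_def[symmetric]
    proof (rule arg_cong4[where f = mat2])
      show "e x * (\<kappa> * Re (p x)) + - 1 * (\<kappa> * Re (q x))
          = \<kappa> * Re (p (x + \<alpha>)) * c + \<sigma> * (\<kappa> * Im (p (x + \<alpha>))) * - (\<sigma> * s)"
      proof -
        have h: "\<sigma> * (\<kappa> * Im (p (x + \<alpha>))) * - (\<sigma> * s) = - (\<sigma> * \<sigma>) * (\<kappa> * Im (p (x + \<alpha>)) * s)" by (simp add: mult_ac)
        show ?thesis unfolding h \<sigma>(2) using arg_cong[OF r1[of x], of "\<lambda>t. \<kappa> * t"] by (simp add: algebra_simps)
      qed
      show "e x * (\<sigma> * (\<kappa> * Im (p x))) + - 1 * (\<sigma> * (\<kappa> * Im (q x)))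
          = \<kappa> * Re (p (x + \<alpha>)) * (\<sigma> * s) + \<sigma> * (\<kappa> * Im (p (x + \<alpha>))) * c"
        using arg_cong[OF r2[of x], of "\<lambda>t. \<sigma> * \<kappa> * t"] by (simp add: algebra_simps)
      show "1 * (\<kappa> * Re (p x)) + 0 * (\<kappa> * Re (q x))
          = \<kappa> * Re (q (x + \<alpha>)) * c + \<sigma> * (\<kappa> * Im (q (x + \<alpha>))) * - (\<sigma> * s)"
      proof -
        have h: "\<sigma> * (\<kappa> * Im (q (x + \<alpha>))) * - (\<sigma> * s) = - (\<sigma> * \<sigma>) * (\<kappa> * Im (q (x + \<alpha>)) * s)" by (simp add: mult_ac)
        show ?thesis unfolding h \<sigma>(2) using arg_cong[OF r3[of x], of "\<lambda>t. \<kappa> * t"] by (simp add: algebra_simps)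
      qed
      show "1 * (\<sigma> * (\<kappa> * Im (p x))) + 0 * (\<sigma> * (\<kappa> * Im (q x)))
          = \<kappa> * Re (q (x + \<alpha>)) * (\<sigma> * s) + \<sigma> * (\<kappa> * Im (q (x + \<alpha>))) * c"
        using arg_cong[OF r4[of x], of "\<lambda>t. \<sigma> * \<kappa> * t"] by (simp add: algebra_simps)
    qed
  qed
  moreover have "- \<sigma> \<in> {1, -1}" using \<sigma>(1) by auto
  ultimately show ?thesis using circ by blast
qed

subsection \<open>The resonant case\<close>

lemma ec_half_int:
  obtains \<sigma> :: real where "\<sigma> \<in> {1, -1}" "ec (of_int l / 2) = of_real \<sigma>" "ec (- (of_int l / 2)) = of_real \<sigma>"
proof -
  have "ec (of_int l / 2) * ec (of_int l / 2) = 1"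
    by (simp only: ec_add [symmetric]) simp
  then have "ec (of_int l / 2) = 1 \<or> ec (of_int l / 2) = - 1" by (simp add: square_eq_1_iff)
  then show ?thesis
  proof
    assume "ec (of_int l / 2) = 1"
    then show ?thesis using that[of 1] by (simp add: ec_minus)
  next
    assume "ec (of_int l / 2) = - 1"
    then show ?thesis using that[of "-1"] by (simp add: ec_minus)
  qed
qed

lemma strip_ext_cos: "strip_ext r (\<lambda>x. cos (2 * pi * x))"
proof -
  have "strip_ext r (\<lambda>x. Re ((ec (of_real x) + ec (- of_real x)) / 2))"
    by (rule strip_ext_Re) (intro holomorphic_intros, simp_all)
  moreover have "Re ((ec (of_real x) + ec (- of_real x)) / 2) = cos (2 * pi * x)" for x
    unfolding ec_cos[symmetric] by simp
  ultimately show ?thesis by simp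
qed

lemma compact_annulus_closed: "compact {w :: complex. a \<le> cmod w \<and> cmod w \<le> b}"
  unfolding compact_eq_bounded_closed
proof
  show "closed {w :: complex. a \<le> cmod w \<and> cmod w \<le> b}"
    by (intro closed_Collect_conj closed_Collect_le continuous_intros)
  show "bounded {w :: complex. a \<le> cmod w \<and> cmod w \<le> b}"
    unfolding bounded_iff by blast
qed

text \<open>The annulus is essential: on a smaller closed annulus, which is compact, U has finitely
  many zeros, whereas in the strip every zero repeats with period 1. Composing with
  \<open>ec\<close> also makes both coefficients periodic.\<close>

lemma fourier_Bezout:
  assumes irr: "\<alpha> \<notin> \<rat>" and r: "0 < r" "r < \<eta>" and u: "exp_decay \<eta> u" "u k0 \<noteq> 0"
    and eu: "\<And>k. dual_defect lam \<alpha> \<theta> E u k = 0"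
  obtains a b where "a holomorphic_on strip r" "b holomorphic_on strip r"
    "\<And>z. a (z + 1) = a z" "\<And>z. b (z + 1) = b z"
    "\<And>z. z \<in> strip r \<Longrightarrow> a z * fourier u z + b z * fourier u (z - of_real \<alpha>) = 1"
proof -
  obtain K where K: "K holomorphic_on annulus \<eta>" "\<And>z. z \<in> strip \<eta> \<Longrightarrow> K (ec z) = fourier u z"
    using periodic_strip_imp_annulus[OF fourier_holomorphic[OF u(1)]] fourier_periodic by metis
  define G where "G w = K (w * ec (- of_real \<alpha>))" for w
  have sub: "annulus r \<subseteq> annulus \<eta>"
  proof
    fix w assume "w \<in> annulus r"
    then obtain z where "z \<in> strip r" "ec z = w" by (rule annulus_imp_ec)
    then show "w \<in> annulus \<eta>" using r by (auto simp: strip_def)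
  qed
  have G: "G (ec z) = fourier u (z - of_real \<alpha>)" if "z \<in> strip \<eta>" for z
  proof -
    have "z - of_real \<alpha> \<in> strip \<eta>" using that by simp
    from K(2)[OF this] show ?thesis
      by (simp add: G_def ec_add [symmetric])
  qed
  have Gh: "G holomorphic_on annulus r"
  proof -
    have "(K \<circ> (\<lambda>w. w * ec (- of_real \<alpha>))) holomorphic_on annulus r"
    proof (rule holomorphic_on_compose_gen[OF _ K(1)])
      show "(\<lambda>w. w * ec (- of_real \<alpha>)) ` annulus r \<subseteq> annulus \<eta>"
        using sub by (auto simp: annulus_def norm_mult norm_ec)
    qed (intro holomorphic_intros)
    then show ?thesis by (simp add: G_def [abs_def] o_def)
  qed
  have noz: "G w \<noteq> 0" if "w \<in> annulus r" "K w = 0" for w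
  proof
    assume "G w = 0"
    obtain z where z: "z \<in> strip r" "ec z = w" using \<open>w \<in> annulus r\<close> by (rule annulus_imp_ec)
    have z': "z \<in> strip \<eta>" using z(1) r by (auto simp: strip_def)
    have "fourier u z = 0" "fourier u (z - of_real \<alpha>) = 0"
      using K(2)[OF z'] G[OF z'] z(2) \<open>G w = 0\<close> \<open>K w = 0\<close> by simp_all
    then show False using cocycle_nonvanishing[OF irr _ u eu z'] r by simp
  qed
  have fin: "finite {w \<in> annulus r. K w = 0}"
  \<comment> \<open>The finiteness of zeros holds for nonconstant functions. A constant K has no
    zeros at all, for if it were 0, then U and its translate would vanish together.\<close>
  proof (cases "K constant_on annulus \<eta>")
    case True
    then obtain c where c: "\<And>w. w \<in> annulus \<eta> \<Longrightarrow> K w = c" unfolding constant_on_def by blast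
    have "c \<noteq> 0"
    proof
      assume "c = 0"
      have 1: "0 \<in> strip r" "0 \<in> strip \<eta>" "- of_real \<alpha> \<in> strip \<eta>" using r by (simp_all add: strip_def)
      then have "K 1 = 0" "G 1 = 0"
        using c[of 1] c[of "ec (- of_real \<alpha>)"] \<open>c = 0\<close> ec_in_annulus_iff[of 0 \<eta>] ec_in_annulus_iff[of "- of_real \<alpha>" \<eta>]
        by (simp_all add: G_def)
      then show False using noz[of 1] ec_in_annulus_iff[of 0 r] 1 by simp
    qed
    then have "{w \<in> annulus r. K w = 0} = {}" using c sub by blast
    then show ?thesis by (simp only: finite.emptyI)
  next
    case False
    let ?C = "{w. exp (- 2 * pi * r) \<le> cmod w \<and> cmod w \<le> exp (2 * pi * r)}"
    have "exp (- 2 * pi * \<eta>) < exp (- 2 * pi * r)" "exp (2 * pi * r) < exp (2 * pi * \<eta>)"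
      using r by simp_all
    then have "w \<in> annulus \<eta>" if "exp (- 2 * pi * r) \<le> cmod w" "cmod w \<le> exp (2 * pi * r)" for w
      unfolding annulus_def mem_Collect_eq using that by linarith
    then have "?C \<subseteq> annulus \<eta>" by blast
    then have "finite {w \<in> ?C. K w = 0}"
      using holomorphic_compact_finite_zeros[OF K(1) open_annulus connected_annulus_exp compact_annulus_closed _ False]
      by blast
    then show ?thesis by (rule rev_finite_subset) (auto simp: annulus_def)
  qed
  obtain a b where ab: "a holomorphic_on annulus r" "b holomorphic_on annulus r"
    "\<forall>w\<in>annulus r. a w * K w + b w * G w = 1"
    using Bezout_holomorphic[OF open_annulus connected_annulus_exp holomorphic_on_subset[OF K(1) sub] Gh fin noz]
    by blast
  have comp: "(\<lambda>z. h (ec z)) holomorphic_on strip r" if "h holomorphic_on annulus r" for h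
  proof -
    have "(h \<circ> ec) holomorphic_on strip r"
      by (rule holomorphic_on_compose_gen[OF _ that]) (auto intro!: ec_holomorphic[of "\<lambda>z. z", simplified])
    then show ?thesis by (simp add: o_def)
  qed
  show ?thesis
  proof (rule that[OF comp[OF ab(1)] comp[OF ab(2)]])
    show "a (ec (z + 1)) = a (ec z)" "b (ec (z + 1)) = b (ec z)" for z by (simp_all add: ec_add)
    show "a (ec z) * fourier u z + b (ec z) * fourier u (z - of_real \<alpha>) = 1" if "z \<in> strip r" for z
    proof -
      have z': "z \<in> strip \<eta>" using that r by (auto simp: strip_def)
      show ?thesis using ab(3) that K(2)[OF z'] G[OF z'] by (metis ec_in_annulus_iff)
    qed
  qed
qed

text \<open>When 2 \<theta> = k \<alpha> + l, conjugation combined with the reflection j to -j - k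
  preserves the dual equation. Uniqueness makes \<open>u\<close> an eigenvector of this symmetry;
  the factor \<open>ec (k x / 2)\<close> centres the reflection, and a constant \<mu> removes the
  remaining phase.\<close>

lemma resonant_real_solution:
  assumes lam: "lam \<noteq> 0" and \<eta>: "\<eta> > 0" and u: "exp_decay \<eta> u" "u k0 \<noteq> 0"
    and eu: "\<And>j. dual_defect lam \<alpha> \<theta> E u j = 0" and res: "2 * \<theta> = of_int k * \<alpha> + of_int l"
  obtains \<mu> where "\<mu> \<noteq> 0" "\<And>x::real. Im (\<mu> * ec (of_int k * of_real x / 2) * fourier u (of_real x)) = 0"
proof -
  define v where "v j = cnj (u (- j + - k))" for j
  have "exp_decay \<eta> (\<lambda>j. u (- j + - k))"
    using exp_decay_reflect[OF exp_decay_shift[OF u(1), of "- k"]] \<eta> by simp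
  then have v: "exp_decay \<eta> v"
    by (rule exp_decay_bound_mult[where M = 1]) (simp_all add: v_def)
  have ev: "dual_defect lam \<alpha> \<theta> E v j = 0" for j
  proof -
    let ?i = "- j + - k"
    have "2 * pi * (\<theta> + of_int ?i * \<alpha>) = - (2 * pi * (\<theta> + of_int j * \<alpha>)) + 2 * pi * of_int l"
    proof -
      have "\<theta> + of_int ?i * \<alpha> = - (\<theta> + of_int j * \<alpha>) + of_int l"
        using res by (simp add: algebra_simps)
      then show ?thesis by (simp add: algebra_simps)
    qed
    then have c: "cos (2 * pi * (\<theta> + of_int ?i * \<alpha>)) = cos (2 * pi * (\<theta> + of_int j * \<alpha>))"
      using cos_int_2pin[of l] sin_int_2pin[of l] by (simp only: cos_add) simp
    have s: "- (j + 1) + - k = ?i - 1" "- (j - 1) + - k = ?i + 1" by simp_all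
    have "dual_defect lam \<alpha> \<theta> E v j = cnj (dual_defect lam \<alpha> \<theta> E u ?i)"
      unfolding dual_defect_def c v_def s by (simp add: add.commute)
    then show ?thesis by (simp only: eu complex_cnj_zero)
  qed
  obtain c where c: "\<And>j. v j = c * u j"
    using dual_eigenvector_unique[OF lam \<eta> u(1) v eu ev u(2)] by blast
  define w where "w x = ec (of_int k * of_real x / 2) * fourier u (of_real x)" for x :: real
  have cw: "cnj (w x) = c * w x" for x
  proof -
    have "((\<lambda>j. u j * ec (of_int j * of_real x)) has_sum fourier u (of_real x)) UNIV"
      by (rule fourier_has_sum[OF u(1) of_real_in_strip[OF \<eta>]])
    then have "((\<lambda>j. cnj (u j * ec (of_int j * of_real x))) has_sum cnj (fourier u (of_real x))) UNIV"
      by (simp only: has_sum_cnj_iff)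
    then have "((\<lambda>j. ec (- (of_int k * of_real x)) * cnj (u j * ec (of_int j * of_real x))) has_sum
        (ec (- (of_int k * of_real x)) * cnj (fourier u (of_real x)))) UNIV"
      by (rule has_sum_cmult_right)
    also have "?this \<longleftrightarrow> ((\<lambda>j. v j * ec (of_int j * of_real x)) has_sum
        (ec (- (of_int k * of_real x)) * cnj (fourier u (of_real x)))) UNIV"
    proof (rule has_sum_reindex_bij_witness[of _ "\<lambda>j. - j + - k" "\<lambda>j. - j + - k"])
      fix j
      have "ec (of_int (- j + - k) * of_real x) = ec (- (of_int k * of_real x)) * ec (- (of_int j * of_real x))"
        by (simp add: ec_add [symmetric] algebra_simps)
      then show "v (- j + - k) * ec (of_int (- j + - k) * of_real x)
          = ec (- (of_int k * of_real x)) * cnj (u j * ec (of_int j * of_real x))"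
        by (simp add: v_def cnj_ec)
    qed auto
    finally have "fourier v (of_real x) = ec (- (of_int k * of_real x)) * cnj (fourier u (of_real x))"
      unfolding fourier_def[of v] by (rule infsumI)
    moreover have "fourier v (of_real x) = c * fourier u (of_real x)"
      unfolding fourier_def c by (simp add: infsum_cmult_right' mult.assoc)
    ultimately have f: "ec (- (of_int k * of_real x)) * cnj (fourier u (of_real x)) = c * fourier u (of_real x)" by simp
    have "ec (of_int k * of_real x / 2) * (ec (- (of_int k * of_real x)) * cnj (fourier u (of_real x))) = cnj (w x)"
      by (simp add: w_def cnj_ec mult.assoc [symmetric] ec_add [symmetric])
    then show ?thesis unfolding f w_def by (simp add: mult_ac)
  qed
  have "\<exists>x. w x \<noteq> 0"
  proof (rule ccontr)
    assume "\<not> (\<exists>x. w x \<noteq> 0)"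
    then have "fourier u (of_real x) = 0" for x :: real by (simp add: w_def)
    then show False using fourier_unique_zero[OF u(1) \<eta>] u(2) by blast
  qed
  then obtain x0 where x0: "w x0 \<noteq> 0" by blast
  have "Im (cnj (w x0) * w x) = 0" for x
  proof -
    have "cnj (cnj (w x0) * w x) = w x0 * cnj (w x)" by simp
    also have "\<dots> = cnj (w x0) * w x" unfolding cw by (simp only: mult_ac)
    finally have "cnj (w x0) * w x \<in> \<real>" unfolding Reals_cnj_iff .
    then show ?thesis unfolding complex_is_Real_iff .
  qed
  \<comment> \<open>Since cnj w = c w with a constant c, the product of w with the conjugate of one
    of its nonzero values is real everywhere.\<close>
  then show ?thesis using that[of "cnj (w x0)"] x0 by (simp add: w_def mult.assoc)
qed

text \<open>Fourier coefficients are divided by \<open>ec (k \<alpha>) - 1\<close>; the mean cannot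
  be solved for and becomes the constant a. Dividing costs exp(\<eta> |k| / 8), which the gap
  between the rates 3 \<eta>/8 and \<eta>/4 absorbs.\<close>

lemma cohomological_equation:
  assumes irr: "\<alpha> \<notin> \<rat>" and \<eta>: "\<eta> > 0" and \<beta>: "ereal \<eta> > 8 * beta_freq \<alpha>"
    and \<kappa>: "strip_ext (\<eta> / 2) \<kappa>" "\<And>x. \<kappa> (x + 1) = \<kappa> x"
  obtains t a where "strip_ext (\<eta> / 4) t" "\<And>x. t (x + 1) = t x" "\<And>x. t (x + \<alpha>) - t x = \<kappa> x - a"
proof -
  \<comment> \<open>The rate lies midway between the available width \<eta>/2 and the target
    \<eta>/4.\<close>
  obtain c where c: "exp_decay (3 * \<eta> / 8) c" "\<And>x::real. complex_of_real (\<kappa> x) = fourier c (of_real x)"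
    using strip_ext_fourier_expansion[OF \<kappa>, of "3 * \<eta> / 8"] \<eta> by auto
  obtain C where C: "C \<ge> 0" "\<And>k. cmod (c k) \<le> C * exp (- 2 * pi * (3 * \<eta> / 8) * of_int \<bar>k\<bar>)"
    using exp_decay_nonneg[OF c(1)] by blast
  obtain c0 where c0: "c0 > 0"
    "\<And>k l. k \<noteq> 0 \<Longrightarrow> \<bar>of_int k * \<alpha> - of_int l\<bar> \<ge> c0 * exp (- (\<eta> / 8) * of_int \<bar>k\<bar>)"
    using small_divisors[OF irr \<beta> \<eta>] by blast
  have div: "cmod (ec (of_int k * of_real \<alpha>) - 1) \<ge> c0 * exp (- (\<eta> / 8) * of_int \<bar>k\<bar>)" if "k \<noteq> 0" for k
  proof -
    obtain l :: int where "cmod (ec (of_real (of_int k * \<alpha>)) - 1) \<ge> \<bar>of_int k * \<alpha> - of_int l\<bar>"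
      by (rule norm_ec_minus_1_ge)
    then show ?thesis using c0(2)[OF that, of l] by simp
  qed
  define d where "d k = (if k = 0 then 0 else c k / (ec (of_int k * of_real \<alpha>) - 1))" for k :: int
  have "cmod (d k) \<le> (C / c0) * exp (- 2 * pi * (\<eta> / 4) * of_int \<bar>k\<bar>)" for k
  proof (cases "k = 0")
    case True
    then show ?thesis using C(1) c0(1) by (simp add: d_def)
  next
    case False
    have pos: "c0 * exp (- (\<eta> / 8) * of_int \<bar>k\<bar>) > 0" using c0(1) by simp
    have expo: "(- 2 * pi * (3 * \<eta> / 8) + \<eta> / 8) * of_int \<bar>k\<bar>
        = - 2 * pi * (3 * \<eta> / 8) * of_int \<bar>k\<bar> - - (\<eta> / 8) * of_int \<bar>k\<bar>"
      by (simp add: algebra_simps)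
    have "cmod (d k) = cmod (c k) / cmod (ec (of_int k * of_real \<alpha>) - 1)"
      using False by (simp add: d_def norm_divide)
    also have "\<dots> \<le> (C * exp (- 2 * pi * (3 * \<eta> / 8) * of_int \<bar>k\<bar>)) / (c0 * exp (- (\<eta> / 8) * of_int \<bar>k\<bar>))"
      by (rule frac_le[OF _ C(2) pos div[OF False]]) (use C(1) in simp)
    also have "\<dots> = (C / c0) * exp ((- 2 * pi * (3 * \<eta> / 8) + \<eta> / 8) * of_int \<bar>k\<bar>)"
      unfolding expo by (simp only: exp_diff times_divide_times_eq)
    also have "\<dots> \<le> (C / c0) * exp ((- 2 * pi * (\<eta> / 4)) * of_int \<bar>k\<bar>)"
    proof (rule mult_left_mono)
      \<comment> \<open>Rates carry a factor 2 pi that the divisor bound does not, so the gap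
        \<eta>/8 in rate outweighs the loss \<eta>/8 in the exponent.\<close>
      have "\<eta> * 1 \<le> \<eta> * (2 * pi)" using \<eta> pi_ge_two by (intro mult_left_mono) auto
      then have "- 2 * pi * (3 * \<eta> / 8) + \<eta> / 8 \<le> - 2 * pi * (\<eta> / 4)"
        by (simp add: field_simps)
      then have "(- 2 * pi * (3 * \<eta> / 8) + \<eta> / 8) * of_int \<bar>k\<bar> \<le> (- 2 * pi * (\<eta> / 4)) * of_int \<bar>k\<bar>"
        by (rule mult_right_mono) simp
      then show "exp ((- 2 * pi * (3 * \<eta> / 8) + \<eta> / 8) * of_int \<bar>k\<bar>) \<le> exp ((- 2 * pi * (\<eta> / 4)) * of_int \<bar>k\<bar>)"
        by (simp only: exp_le_cancel_iff)
      show "0 \<le> C / c0" using C(1) c0(1) by simp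
    qed
    finally show ?thesis .
  qed
  then have dd: "exp_decay (\<eta> / 4) d" unfolding exp_decay_def by blast
  have eq: "fourier d (of_real (x + \<alpha>)) - fourier d (of_real x) = of_real (\<kappa> x) - c 0" for x
  proof -
    have S1: "((\<lambda>k. d k * ec (of_int k * of_real (x + \<alpha>)) + - (d k * ec (of_int k * of_real x)))
        has_sum (fourier d (of_real (x + \<alpha>)) + - fourier d (of_real x))) UNIV"
      by (intro has_sum_add has_sum_uminusI fourier_has_sum[OF dd] of_real_in_strip) (use \<eta> in simp_all)
    have S2: "((\<lambda>k. c k * ec (of_int k * of_real x) + - (if k = 0 then c 0 else 0))
        has_sum (fourier c (of_real x) + - c 0)) UNIV"
    proof (intro has_sum_add has_sum_uminusI fourier_has_sum[OF c(1)] of_real_in_strip)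
      show "((\<lambda>k::int. if k = 0 then c 0 else 0) has_sum c 0) UNIV"
        by (rule has_sum_finite_neutralI[of "{0}"]) auto
    qed (use \<eta> in simp)
    have eqk: "d k * ec (of_int k * of_real (x + \<alpha>)) + - (d k * ec (of_int k * of_real x))
        = c k * ec (of_int k * of_real x) + - (if k = 0 then c 0 else 0)" for k
    proof (cases "k = 0")
      case False
      have "0 < c0 * exp (- (\<eta> / 8) * of_int \<bar>k\<bar>)" using c0(1) by simp
      then have "ec (of_int k * of_real \<alpha>) - 1 \<noteq> 0" using div[OF False] by force
      then have "d k * (ec (of_int k * of_real \<alpha>) - 1) = c k" using False by (simp add: d_def)
      moreover have "d k * ec (of_int k * of_real (x + \<alpha>)) + - (d k * ec (of_int k * of_real x))
          = (d k * (ec (of_int k * of_real \<alpha>) - 1)) * ec (of_int k * of_real x)"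
        by (simp add: distrib_left ec_add algebra_simps)
      ultimately show ?thesis using False by simp
    qed (simp add: d_def)
    have "fourier d (of_real (x + \<alpha>)) + - fourier d (of_real x) = fourier c (of_real x) + - c 0"
      using S1 S2 unfolding eqk by (rule has_sum_unique)
    then show ?thesis by (simp add: c(2))
  qed
  show ?thesis
  proof (rule that)
    show "strip_ext (\<eta> / 4) (\<lambda>x. Re (fourier d (of_real x)))"
      by (rule strip_ext_Re[OF fourier_holomorphic[OF dd]])
    show "Re (fourier d (of_real (x + 1))) = Re (fourier d (of_real x))" for x
      using fourier_periodic[of d "of_real x"] by simp
    show "Re (fourier d (of_real (x + \<alpha>))) - Re (fourier d (of_real x)) = \<kappa> x - Re (c 0)" for x
      using arg_cong[OF eq[of x], of Re] by simp
  qed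
qed

text \<open>B has columns (f, \<sigma> f(x - \<alpha>)) and (P2, Q2), where f is U made real. The
  sign \<epsilon> governs its behaviour under x to x + 1, and \<sigma> is the diagonal entry of the
  triangular matrix.\<close>

lemma resonant_conjugacy:
  assumes irr: "\<alpha> \<notin> \<rat>" and lam: "lam \<noteq> 0" and \<eta>: "\<eta> > 0" and \<beta>: "ereal \<eta> > 8 * beta_freq \<alpha>"
    and u: "exp_decay \<eta> u" "u k0 \<noteq> 0" and eu: "\<And>j. dual_defect lam \<alpha> \<theta> E u j = 0"
    and res: "2 * \<theta> = of_int k * \<alpha> + of_int l"
  shows "\<exists>B a. \<exists>\<sigma>\<in>{1, -1 :: real}. circle_to_PSL2 B \<and> (\<forall>i j. strip_ext (\<eta> / 4) (\<lambda>x. B x $ i $ j)) \<and>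
    a \<noteq> 0 \<and> (\<forall>x. S_AM lam E x ** B x = B (x + \<alpha>) ** mat2 \<sigma> a 0 \<sigma>)"
proof -
  define h where "h z = ec (of_int k * z / 2)" for z
  have h: "h (z + w) = h z * h w" "h z \<noteq> 0" "h z * h (- z) = 1" for z w
    by (simp_all add: h_def ec_add [symmetric] add_divide_distrib distrib_left)
  have hh: "h holomorphic_on S" for S unfolding h_def by (intro holomorphic_intros) simp_all
  \<comment> \<open>The sign of the half-frequency factor over one period; when it is -1, B is only
    antiperiodic.\<close>
  obtain \<epsilon> :: real where \<epsilon>: "\<epsilon> \<in> {1, -1}" "h 1 = of_real \<epsilon>" "h (- 1) = of_real \<epsilon>"
    using ec_half_int[of k] unfolding h_def by (metis mult.right_neutral mult_minus_right minus_divide_left)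
  \<comment> \<open>Halving 2 \<theta> = k \<alpha> + l leaves the phase \<open>ec (l / 2)\<close>,
    which is a sign.\<close>
  obtain \<sigma> :: real where \<sigma>: "\<sigma> \<in> {1, -1}" "ec (of_int l / 2) = of_real \<sigma>" "ec (- (of_int l / 2)) = of_real \<sigma>"
    by (rule ec_half_int)
  have \<sigma>\<sigma>: "\<sigma> * \<sigma> = 1" using \<sigma>(1) by auto
  have \<epsilon>\<epsilon>: "\<epsilon> * \<epsilon> = 1" using \<epsilon>(1) by auto
  have ec\<theta>: "ec (of_real \<theta>) = h (of_real \<alpha>) * of_real \<sigma>" "ec (- of_real \<theta>) = h (- of_real \<alpha>) * of_real \<sigma>"
  proof -
    have "\<theta> = of_int k * \<alpha> / 2 + of_int l / 2" using res by simp
    then have \<theta>: "complex_of_real \<theta> = of_int k * of_real \<alpha> / 2 + of_int l / 2" by simp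
    show "ec (of_real \<theta>) = h (of_real \<alpha>) * of_real \<sigma>"
      unfolding \<theta> ec_add \<sigma>(2) h_def ..
    have "- complex_of_real \<theta> = of_int k * (- of_real \<alpha>) / 2 + - (of_int l / 2)" unfolding \<theta> by simp
    then show "ec (- of_real \<theta>) = h (- of_real \<alpha>) * of_real \<sigma>"
      unfolding h_def by (simp only: ec_add \<sigma>(3))
  qed
  define e where "e x = E - 2 * lam * cos (2 * pi * x)" for x
  have ext_e: "strip_ext r e" for r
    unfolding e_def [abs_def] by (intro strip_ext_diff strip_ext_cmult strip_ext_const strip_ext_cos)
  have e1: "e (x + 1) = e x" for x by (simp add: e_def distrib_left)
  obtain \<mu> where \<mu>: "\<mu> \<noteq> 0" "\<And>x::real. Im (\<mu> * ec (of_int k * of_real x / 2) * fourier u (of_real x)) = 0"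
    using resonant_real_solution[OF lam \<eta> u eu res] by blast
  define F where "F z = \<mu> * h z * fourier u z" for z
  define f where "f x = Re (F (of_real x))" for x :: real
  have fF: "F (of_real x) = of_real (f x)" for x :: real
    using \<mu>(2)[of x] by (simp add: f_def F_def h_def complex_eq_iff)
  have Fh: "F holomorphic_on strip \<eta>"
    unfolding F_def by (intro holomorphic_intros hh fourier_holomorphic[OF u(1)])
  have ext_f: "strip_ext \<eta> f" unfolding f_def by (rule strip_ext_Re[OF Fh])
  have f1: "f (x + 1) = \<epsilon> * f x" for x
  proof -
    have "complex_of_real (f (x + 1)) = of_real (\<epsilon> * f x)"
      unfolding fF [symmetric] using fourier_periodic[of u "of_real x"]
      by (simp add: F_def h(1) \<epsilon>(2) fF [symmetric])
    then show ?thesis unfolding of_real_eq_iff .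
  qed
  have rec: "e x * f x = \<sigma> * (f (x + \<alpha>) + f (x - \<alpha>))" for x
  proof -
    have "complex_of_real (e x) * F (of_real x) = \<mu> * h (of_real x) * (of_real (e x) * fourier u (of_real x))"
      by (simp add: F_def)
    also have "\<dots> = of_real \<sigma> * (\<mu> * (h (of_real x) * h (of_real \<alpha>)) * fourier u (of_real (x + \<alpha>)))
        + of_real \<sigma> * (\<mu> * (h (of_real x) * h (- of_real \<alpha>)) * fourier u (of_real (x - \<alpha>)))"
      unfolding e_def fourier_recurrence[OF u(1) \<eta> eu] ec\<theta> by (simp add: algebra_simps)
    also have "\<dots> = of_real \<sigma> * F (of_real (x + \<alpha>)) + of_real \<sigma> * F (of_real (x - \<alpha>))"
      unfolding F_def h(1) [symmetric] by simp
    finally have "complex_of_real (e x * f x) = of_real (\<sigma> * (f (x + \<alpha>) + f (x - \<alpha>)))"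
      unfolding fF by (simp add: distrib_left)
    then show ?thesis unfolding of_real_eq_iff .
  qed
  obtain a b where ab: "a holomorphic_on strip (\<eta> / 2)" "b holomorphic_on strip (\<eta> / 2)"
    "\<And>z. a (z + 1) = a z" "\<And>z. b (z + 1) = b z"
    "\<And>z. z \<in> strip (\<eta> / 2) \<Longrightarrow> a z * fourier u z + b z * fourier u (z - of_real \<alpha>) = 1"
    using fourier_Bezout[OF irr _ _ u eu, of "\<eta> / 2"] \<eta> by auto
  \<comment> \<open>The Bezout coefficients are untwisted by the inverse of \<mu> h, so that the
    identity holds for F and its translate; the factor h(\<alpha>) in \<open>b1\<close> accounts for
    the shifted argument.\<close>
  define a1 where "a1 z = a z * h (- z) / \<mu>" for z
  define b1 where "b1 z = b z * h (of_real \<alpha>) * h (- z) / \<mu>" for z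
  have hm: "(\<lambda>z. h (- z)) holomorphic_on S" for S unfolding h_def by (intro holomorphic_intros) simp_all
  have hol1: "a1 holomorphic_on strip (\<eta> / 2)" "b1 holomorphic_on strip (\<eta> / 2)"
    unfolding a1_def b1_def by (intro holomorphic_intros ab hm \<mu>(1))+
  \<comment> \<open>Because f is real, the real part of the Bezout identity is again such an
    identity. The factor - \<sigma> in \<open>P\<close> turns it into a determinant.\<close>
  define Q where "Q x = Re (a1 (of_real x))" for x :: real
  define P where "P x = - \<sigma> * Re (b1 (of_real x))" for x :: real
  have ext_Q: "strip_ext (\<eta> / 2) Q" unfolding Q_def by (rule strip_ext_Re[OF hol1(1)])
  have ext_P: "strip_ext (\<eta> / 2) P" unfolding P_def by (rule strip_ext_cmult, rule strip_ext_Re[OF hol1(2)])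
  have hm1: "h (- (z + 1)) = of_real \<epsilon> * h (- z)" for z
  proof -
    have "h (- (z + 1)) = h (- z + - 1)" by simp
    then show ?thesis unfolding h(1) \<epsilon>(3) by (simp add: mult.commute)
  qed
  have ab1: "a1 (z + 1) = of_real \<epsilon> * a1 z" "b1 (z + 1) = of_real \<epsilon> * b1 z" for z
    unfolding a1_def b1_def ab(3,4) hm1 by simp_all
  have Q1: "Q (x + 1) = \<epsilon> * Q x" and P1: "P (x + 1) = \<epsilon> * P x" for x
    using ab1[of "of_real x"] by (simp_all add: Q_def P_def)
  have det: "f x * Q x - \<sigma> * f (x - \<alpha>) * P x = 1" for x
  proof -
    let ?z = "complex_of_real x"
    have "h (?z - of_real \<alpha>) * h (of_real \<alpha>) = h ?z"
      unfolding h(1) [symmetric] by simp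
    then have "b1 ?z * F (of_real (x - \<alpha>)) = b ?z * (h ?z * h (- ?z)) * fourier u (?z - of_real \<alpha>)"
      unfolding b1_def F_def using \<mu>(1) by (simp add: mult_ac)
    moreover have "a1 ?z * F ?z = a ?z * (h ?z * h (- ?z)) * fourier u ?z"
      unfolding a1_def F_def using \<mu>(1) by simp
    moreover have "a ?z * fourier u ?z + b ?z * fourier u (?z - of_real \<alpha>) = 1"
      by (rule ab(5)[OF of_real_in_strip]) (use \<eta> in simp)
    ultimately have "a1 ?z * of_real (f x) + b1 ?z * of_real (f (x - \<alpha>)) = 1"
      unfolding fF h(3) by simp
    from arg_cong[OF this, of Re] have "Q x * f x + Re (b1 ?z) * f (x - \<alpha>) = 1"
      by (simp add: Q_def)
    moreover have "\<sigma> * f (x - \<alpha>) * P x = - (\<sigma> * \<sigma>) * (Re (b1 ?z) * f (x - \<alpha>))"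
      by (simp add: P_def mult_ac)
    ultimately show ?thesis unfolding \<sigma>\<sigma> by (simp add: mult.commute)
  qed
  \<comment> \<open>The upper right entry of the conjugated cocycle: the first row of the inverse at
    x + \<alpha>, applied to the image (e P - Q, P) of the second column.\<close>
  define \<kappa> where "\<kappa> x = Q (x + \<alpha>) * (e x * P x - Q x) - P (x + \<alpha>) * P x" for x
  have ext_\<kappa>: "strip_ext (\<eta> / 2) \<kappa>"
    unfolding \<kappa>_def by (intro strip_ext_diff strip_ext_mult strip_ext_shift ext_Q ext_P ext_e)
  have \<kappa>1: "\<kappa> (x + 1) = \<kappa> x" for x
  proof -
    have s: "Q (x + 1 + \<alpha>) = \<epsilon> * Q (x + \<alpha>)" "P (x + 1 + \<alpha>) = \<epsilon> * P (x + \<alpha>)"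
      using Q1[of "x + \<alpha>"] P1[of "x + \<alpha>"] by (simp_all add: add_ac)
    have "\<kappa> (x + 1) = (\<epsilon> * \<epsilon>) * \<kappa> x"
      unfolding \<kappa>_def s Q1 P1 e1 by (simp add: algebra_simps)
    then show ?thesis unfolding \<epsilon>\<epsilon> by simp
  qed
  \<comment> \<open>Together with \<open>k2\<close> this expresses the image of the second column as
    \<kappa> times the translated first column plus \<sigma> times the translated second
    one.\<close>
  have k1: "\<kappa> x * f (x + \<alpha>) + \<sigma> * P (x + \<alpha>) = e x * P x - Q x"
    and k2: "\<kappa> x * (\<sigma> * f x) + \<sigma> * Q (x + \<alpha>) = P x" for x
  proof -
    have d': "f (x + \<alpha>) * Q (x + \<alpha>) = 1 + \<sigma> * f x * P (x + \<alpha>)"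
      using det[of "x + \<alpha>"] by simp
    have z: "P x * f (x - \<alpha>) = \<sigma> * (f x * Q x - 1)"
    proof -
      have "\<sigma> * (f x * Q x - 1) = (\<sigma> * \<sigma>) * (f (x - \<alpha>) * P x)"
        using det[of x] by (simp add: algebra_simps)
      then show ?thesis unfolding \<sigma>\<sigma> by (simp add: mult.commute)
    qed
    have ef: "\<sigma> * (e x * f x) = f (x + \<alpha>) + f (x - \<alpha>)"
      unfolding rec by (simp only: mult.assoc [symmetric] \<sigma>\<sigma> mult_1_left)
    have "\<kappa> x * f (x + \<alpha>) + \<sigma> * P (x + \<alpha>)
        = (f (x + \<alpha>) * Q (x + \<alpha>)) * (e x * P x - Q x) - P (x + \<alpha>) * (P x * f (x + \<alpha>)) + \<sigma> * P (x + \<alpha>)"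
      by (simp add: \<kappa>_def algebra_simps)
    also have "\<dots> = (e x * P x - Q x)
        + P (x + \<alpha>) * ((\<sigma> * (e x * f x)) * P x - \<sigma> * f x * Q x - P x * f (x + \<alpha>) + \<sigma>)"
      unfolding d' by (simp add: algebra_simps)
    also have "(\<sigma> * (e x * f x)) * P x - \<sigma> * f x * Q x - P x * f (x + \<alpha>) + \<sigma>
        = P x * f (x - \<alpha>) - \<sigma> * (f x * Q x - 1)"
      unfolding ef by (simp add: algebra_simps)
    also have "\<dots> = 0" unfolding z by simp
    finally show "\<kappa> x * f (x + \<alpha>) + \<sigma> * P (x + \<alpha>) = e x * P x - Q x" by simp
    have "\<kappa> x * (\<sigma> * f x) + \<sigma> * Q (x + \<alpha>)
        = Q (x + \<alpha>) * ((\<sigma> * (e x * f x)) * P x - \<sigma> * (f x * Q x - 1)) - P x * (\<sigma> * f x * P (x + \<alpha>))"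
      by (simp add: \<kappa>_def algebra_simps)
    also have "(\<sigma> * (e x * f x)) * P x - \<sigma> * (f x * Q x - 1) = P x * f (x + \<alpha>)"
      unfolding ef z [symmetric] by (simp add: algebra_simps)
    also have "Q (x + \<alpha>) * (P x * f (x + \<alpha>)) - P x * (\<sigma> * f x * P (x + \<alpha>))
        = P x * (f (x + \<alpha>) * Q (x + \<alpha>) - \<sigma> * f x * P (x + \<alpha>))"
      by (simp add: algebra_simps)
    also have "\<dots> = P x" unfolding d' by simp
    finally show "\<kappa> x * (\<sigma> * f x) + \<sigma> * Q (x + \<alpha>) = P x" .
  qed
  have ext_sk: "strip_ext (\<eta> / 2) (\<lambda>x. \<sigma> * \<kappa> x)" by (rule strip_ext_cmult[OF ext_\<kappa>])
  obtain t c where t: "strip_ext (\<eta> / 4) t" "\<And>x. t (x + 1) = t x" "\<And>x. t (x + \<alpha>) - t x = \<sigma> * \<kappa> x - c"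
    using cohomological_equation[OF irr \<eta> \<beta> ext_sk] \<kappa>1 by metis
  define d where "d = \<sigma> * c"
  have t\<kappa>: "\<sigma> * t x + \<kappa> x = d + \<sigma> * t (x + \<alpha>)" for x
  proof -
    have "\<sigma> * (t (x + \<alpha>) - t x) = (\<sigma> * \<sigma>) * \<kappa> x - \<sigma> * c"
      unfolding t(3) by (simp add: algebra_simps)
    then show ?thesis unfolding \<sigma>\<sigma> d_def by (simp add: algebra_simps)
  qed
  \<comment> \<open>Adding t times the first column to the second keeps the determinant and changes
    the off-diagonal entry by \<sigma> (t(x) - t(x + \<alpha>)), which makes it the constant
    \<open>d\<close>.\<close>
  define P2 where "P2 x = P x + f x * t x" for x
  define Q2 where "Q2 x = Q x + \<sigma> * f (x - \<alpha>) * t x" for x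
  define B where "B x = mat2 (f x) (P2 x) (\<sigma> * f (x - \<alpha>)) (Q2 x)" for x
  have ext4: "strip_ext (\<eta> / 4) f" "strip_ext (\<eta> / 4) P" "strip_ext (\<eta> / 4) Q"
    using \<eta> by (auto intro: strip_ext_mono[OF ext_f] strip_ext_mono[OF ext_P] strip_ext_mono[OF ext_Q])
  have ext4s: "strip_ext (\<eta> / 4) (\<lambda>x. f (x - \<alpha>))" using strip_ext_shift[OF ext4(1), of "- \<alpha>"] by simp
  have ext_P2: "strip_ext (\<eta> / 4) P2" unfolding P2_def by (intro strip_ext_add strip_ext_mult ext4 t(1))
  have ext_Q2: "strip_ext (\<eta> / 4) Q2"
    unfolding Q2_def by (intro strip_ext_add strip_ext_mult strip_ext_cmult ext4 ext4s t(1))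
  have det2: "f x * Q2 x - P2 x * (\<sigma> * f (x - \<alpha>)) = 1" for x
    using det[of x] by (simp add: Q2_def P2_def algebra_simps)
  have fm1: "f (x + 1 - \<alpha>) = \<epsilon> * f (x - \<alpha>)" for x
    using f1[of "x - \<alpha>"] by (simp add: algebra_simps)
  have P21: "P2 (x + 1) = \<epsilon> * P2 x" and Q21: "Q2 (x + 1) = \<epsilon> * Q2 x" for x
    unfolding P2_def Q2_def P1 Q1 f1 fm1 t(2) by (simp_all add: algebra_simps)
  have "B (x + 1) = \<epsilon> *\<^sub>R B x" for x
    by (rule mat2_eqI) (simp_all add: B_def f1 fm1 P21 Q21)
  moreover have "B x \<in> SL2" for x using det2[of x] by (simp add: B_def SL2_def)
  ultimately have circ: "circle_to_PSL2 B" unfolding circle_to_PSL2_def using \<epsilon>(1) by blast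
  have ext_B: "strip_ext (\<eta> / 4) (\<lambda>x. B x $ i $ j)" for i j
    using exhaust_2[of i] exhaust_2[of j]
    by (auto simp: B_def intro!: strip_ext_cmult ext4 ext4s ext_P2 ext_Q2)
  have m1: "e x * P2 x - Q2 x = d * f (x + \<alpha>) + \<sigma> * P2 (x + \<alpha>)"
    and m2: "P2 x = d * (\<sigma> * f x) + \<sigma> * Q2 (x + \<alpha>)" for x
  proof -
    have "e x * P2 x - Q2 x = (e x * P x - Q x) + (e x * f x) * t x - \<sigma> * f (x - \<alpha>) * t x"
      by (simp add: P2_def Q2_def algebra_simps)
    also have "\<dots> = (\<sigma> * t x + \<kappa> x) * f (x + \<alpha>) + \<sigma> * P (x + \<alpha>)"
      unfolding k1[symmetric] rec by (simp add: algebra_simps)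
    also have "\<dots> = d * f (x + \<alpha>) + \<sigma> * P2 (x + \<alpha>)"
      unfolding t\<kappa> by (simp add: P2_def algebra_simps)
    finally show "e x * P2 x - Q2 x = d * f (x + \<alpha>) + \<sigma> * P2 (x + \<alpha>)" .
    have ft: "f x * t x = (\<sigma> * t x) * (\<sigma> * f x)"
    proof -
      have "(\<sigma> * t x) * (\<sigma> * f x) = (\<sigma> * \<sigma>) * (f x * t x)" by (simp only: mult_ac)
      then show ?thesis unfolding \<sigma>\<sigma> mult_1_left by (rule sym)
    qed
    have "P2 x = (\<kappa> x * (\<sigma> * f x) + \<sigma> * Q (x + \<alpha>)) + (\<sigma> * t x) * (\<sigma> * f x)"
      unfolding k2 ft[symmetric] P2_def ..
    also have "\<dots> = (\<sigma> * t x + \<kappa> x) * (\<sigma> * f x) + \<sigma> * Q (x + \<alpha>)" by (simp add: algebra_simps)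
    also have "\<dots> = d * (\<sigma> * f x) + \<sigma> * Q2 (x + \<alpha>)"
      unfolding t\<kappa> by (simp add: Q2_def algebra_simps)
    finally show "P2 x = d * (\<sigma> * f x) + \<sigma> * Q2 (x + \<alpha>)" .
  qed
  have conj: "S_AM lam E x ** B x = B (x + \<alpha>) ** mat2 \<sigma> d 0 \<sigma>" for x
    unfolding S_AM_def B_def mat2_mult e_def[symmetric]
  proof (rule arg_cong4[where f = mat2])
    show "e x * f x + - 1 * (\<sigma> * f (x - \<alpha>)) = f (x + \<alpha>) * \<sigma> + P2 (x + \<alpha>) * 0"
      unfolding rec by (simp add: algebra_simps)
    show "e x * P2 x + - 1 * Q2 x = f (x + \<alpha>) * d + P2 (x + \<alpha>) * \<sigma>"
      using m1[of x] by (simp add: algebra_simps)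
    show "1 * f x + 0 * (\<sigma> * f (x - \<alpha>)) = \<sigma> * f (x + \<alpha> - \<alpha>) * \<sigma> + Q2 (x + \<alpha>) * 0"
    proof -
      have "\<sigma> * f (x + \<alpha> - \<alpha>) * \<sigma> = (\<sigma> * \<sigma>) * f x" by (simp add: mult_ac)
      then show ?thesis unfolding \<sigma>\<sigma> by simp
    qed
    show "1 * P2 x + 0 * Q2 x = \<sigma> * f (x + \<alpha> - \<alpha>) * d + Q2 (x + \<alpha>) * \<sigma>"
      using m2[of x] by (simp add: algebra_simps)
  qed
  have "d \<noteq> 0"
  proof
    assume "d = 0"
    have Q2P2: "Q2 x = \<sigma> * P2 (x - \<alpha>)" for x
    proof -
      have "\<sigma> * P2 (x - \<alpha>) = (\<sigma> * \<sigma>) * Q2 x" using m2[of "x - \<alpha>"] \<open>d = 0\<close> by simp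
      then show ?thesis unfolding \<sigma>\<sigma> by simp
    qed
    have rec2: "e x * P2 x = \<sigma> * (P2 (x + \<alpha>) + P2 (x - \<alpha>))" for x
      using m1[of x] \<open>d = 0\<close> unfolding Q2P2 by (simp add: algebra_simps)
    obtain H where H: "H holomorphic_on strip (\<eta> / 4)" "\<And>x. H (of_real x) = complex_of_real (P2 x)"
      using ext_P2 unfolding strip_ext_def by blast
    \<comment> \<open>Multiplying by the inverse half-frequency factor restores period 1, so G has a
      Fourier series whose coefficients can be tested in the dual equation.\<close>
    define G where "G z = h (- z) * H z" for z
    have "G holomorphic_on strip (\<eta> / 4)" unfolding G_def by (intro holomorphic_intros hm H)
    moreover have "G (of_real (x + 1)) = G (of_real x)" for x :: real
    proof -
      have "G (of_real (x + 1)) = of_real (\<epsilon> * \<epsilon>) * G (of_real x)"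
        using hm1[of "of_real x"] H(2)[of "x + 1"] by (simp add: G_def H(2) P21 mult_ac)
      then show ?thesis unfolding \<epsilon>\<epsilon> by simp
    qed
    \<comment> \<open>Any positive rate below \<eta>/4 serves; uniqueness of decaying eigenvectors
      asks only for some decay.\<close>
    ultimately obtain v where v: "exp_decay (\<eta> / 8) v" "\<And>x::real. G (of_real x) = fourier v (of_real x)"
      using fourier_expansion_real[of G "\<eta> / 4" "\<eta> / 8"] \<eta> by auto
    have \<eta>8: "\<eta> / 8 > 0" using \<eta> by simp
    have "fourier (dual_defect lam \<alpha> \<theta> E v) (of_real x) = 0" for x :: real
    proof -
      let ?z = "complex_of_real x"
      have s1: "ec (of_real \<theta>) * G (of_real (x + \<alpha>)) = h (- ?z) * of_real (\<sigma> * P2 (x + \<alpha>))"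
      proof -
        have "h (- of_real (x + \<alpha>)) * h (of_real \<alpha>) = h (- ?z)"
          unfolding h(1) [symmetric] by simp
        then show ?thesis unfolding ec\<theta> G_def H(2) by (simp add: mult_ac)
      qed
      have s2: "ec (- of_real \<theta>) * G (of_real (x - \<alpha>)) = h (- ?z) * of_real (\<sigma> * P2 (x - \<alpha>))"
      proof -
        have "h (- of_real (x - \<alpha>)) * h (- of_real \<alpha>) = h (- ?z)"
          unfolding h(1) [symmetric] by simp
        then show ?thesis unfolding ec\<theta> G_def H(2) by (simp add: mult_ac)
      qed
      have "fourier (dual_defect lam \<alpha> \<theta> E v) ?z =
          of_real lam * (ec ?z + ec (- ?z)) * fourier v ?z
          + ec (of_real \<theta>) * fourier v (?z + of_real \<alpha>) + ec (- of_real \<theta>) * fourier v (?z - of_real \<alpha>)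
          - of_real E * fourier v ?z"
        by (rule fourier_dual_defect[OF v(1) of_real_in_strip[OF \<eta>8]])
      also have "ec ?z + ec (- ?z) = complex_of_real (2 * cos (2 * pi * x))"
        by (rule ec_cos[symmetric])
      also have "?z + of_real \<alpha> = of_real (x + \<alpha>)" by simp
      also have "?z - of_real \<alpha> = of_real (x - \<alpha>)" by simp
      finally have "fourier (dual_defect lam \<alpha> \<theta> E v) ?z =
          of_real (- e x) * G ?z + ec (of_real \<theta>) * G (of_real (x + \<alpha>)) + ec (- of_real \<theta>) * G (of_real (x - \<alpha>))"
        unfolding v(2) [symmetric] by (simp add: e_def algebra_simps)
      also have "\<dots> = h (- ?z) * of_real (- (e x * P2 x) + \<sigma> * (P2 (x + \<alpha>) + P2 (x - \<alpha>)))"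
        unfolding s1 s2 unfolding G_def H(2) by (simp add: algebra_simps)
      also have "\<dots> = 0" unfolding rec2 by simp
      finally show ?thesis .
    qed
    then have ev: "dual_defect lam \<alpha> \<theta> E v j = 0" for j
      using fourier_unique_zero[OF exp_decay_dual_defect[OF v(1)] \<eta>8] \<eta> by simp
    have "exp_decay (\<eta> / 8) u" using exp_decay_mono[OF u(1), of "\<eta> / 8"] \<eta> by simp
    then obtain c1 where c1: "\<And>j. v j = c1 * u j"
      using dual_eigenvector_unique[OF lam \<eta>8 _ v(1) eu ev u(2)] by blast
    have P2f: "complex_of_real (P2 x) = (c1 / \<mu>) * of_real (f x)" for x
    proof -
      let ?z = "complex_of_real x"
      have "fourier v ?z = c1 * fourier u ?z"
        unfolding fourier_def c1 by (simp add: infsum_cmult_right' mult.assoc)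
      then have "h (- ?z) * of_real (P2 x) = c1 * fourier u ?z"
        using v(2)[of x] by (simp add: G_def H(2))
      then have "(h ?z * h (- ?z)) * of_real (P2 x) = h ?z * (c1 * fourier u ?z)" by simp
      then have "of_real (P2 x) = h ?z * (c1 * fourier u ?z)" unfolding h(3) by simp
      also have "\<dots> = (c1 / \<mu>) * F ?z" using \<mu>(1) by (simp add: F_def)
      finally show ?thesis unfolding fF .
    qed
    \<comment> \<open>The second column has become a multiple of the first, against determinant 1; a
      single point suffices.\<close>
    have "complex_of_real (f 0 * Q2 0 - P2 0 * (\<sigma> * f (0 - \<alpha>))) = 0"
      unfolding Q2P2 of_real_diff of_real_mult P2f by simp
    then show False unfolding det2 by simp
  qed
  then show ?thesis using \<sigma>(1) circ ext_B conj by blast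
qed

section \<open>Combining the conjugacies with degrees and rotation numbers\<close>

theorem theorem5p2:
  fixes \<alpha> lam \<theta> E \<eta> :: real and u :: "int \<Rightarrow> complex" and A :: "real \<Rightarrow> real^2^2"
  assumes "\<alpha> \<notin> \<rat>" and "lam \<noteq> 0" and "E \<in> Sigma_AM lam \<alpha>"
    and "A = S_AM lam E"
    and "\<eta> > 0"
    and "\<exists>k. u k \<noteq> 0"
    and "\<forall>k. aubry_dual lam \<alpha> \<theta> u k = complex_of_real E * u k"
    and "\<exists>K. \<forall>k. \<bar>k\<bar> \<ge> K \<longrightarrow> cmod (u k) \<le> exp (- 2 * pi * \<eta> * real_of_int \<bar>k\<bar>)"
  shows
    "(2 * \<theta> \<notin> freq_module \<alpha> \<longrightarrow>
       (\<exists>B. \<exists>s\<in>{1, -1}.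
          circle_to_SL2 B \<and> analytic_in_strip \<eta> B \<and>
          (\<forall>x. matrix_inv (B (x + \<alpha>)) ** A x ** B x = R_rot (s * \<theta>)) \<and>
          [rotation_number \<alpha> A = s * \<theta> + of_int (degree_map B) / 2 * \<alpha>] (rmod 1/2) \<and>
          2 * rotation_number \<alpha> A \<notin> freq_module \<alpha>))
     \<and>
     ((\<exists>k::int. 2 * \<theta> - of_int k * \<alpha> \<in> \<int>) \<and> ereal \<eta> > 8 * beta_freq \<alpha> \<longrightarrow>
       (\<exists>B a. \<exists>s\<in>{1, -1}.
          circle_to_PSL2 B \<and> analytic_in_strip (\<eta> / 4) B \<and> a \<noteq> 0 \<and>
          (\<forall>x. matrix_inv (B (x + \<alpha>)) ** A x ** B x = mat2 s a 0 s) \<and>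
          [2 * rotation_number \<alpha> A = of_int (degree_map B) * \<alpha>] (rmod 1) \<and>
          2 * rotation_number \<alpha> A \<in> freq_module \<alpha>))"
proof -
  obtain k0 where k0: "u k0 \<noteq> 0" using assms(6) by blast
  have u: "exp_decay \<eta> u" by (rule eventual_decay_imp_exp_decay[OF assms(8)])
  have eu: "\<And>j. dual_defect lam \<alpha> \<theta> E u j = 0"
    by (rule aubry_dual_imp_dual_defect[OF assms(2,7)])
  have detA: "\<And>x. det (A x) \<noteq> 0" unfolding assms(4) det_S_AM by simp
  obtain \<Phi> where \<Phi>: "is_angle_lift A \<Phi>" unfolding assms(4) by (rule S_AM_angle_lift)
  have cont: "continuous_on UNIV B" if B: "\<And>i j. strip_ext r (\<lambda>x. B x $ i $ j)" "r > 0"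
    for r and B :: "real \<Rightarrow> real^2^2"
  proof -
    have eq: "B = (\<lambda>x. mat2 (B x $ 1 $ 1) (B x $ 1 $ 2) (B x $ 2 $ 1) (B x $ 2 $ 2))"
      by (rule ext, rule mat2_eqI) simp_all
    show ?thesis
      by (subst eq) (intro continuous_on_mat2 strip_ext_imp_continuous[OF B])
  qed
  \<comment> \<open>Only period 2 is asked of B, so the same fact serves SL-valued and PSL-valued
    conjugacies.\<close>
  have deg: "\<exists>\<beta>. dir_lift B (degree_map B) \<beta>"
    if B: "continuous_on UNIV B" "\<And>x. B x \<in> SL2" "\<And>x. B (x + 2) = B x" for B
  proof -
    obtain m where m: "homotopic_R_2Z B (\<lambda>x. R_rot (of_int m * x / 2))"
      using exists_degree[OF B] by blast
    then show ?thesis unfolding degree_map_eq[OF m] using homotopic_imp_dir_lift by blast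
  qed
  show ?thesis
  proof (intro conjI impI)
    assume nr: "2 * \<theta> \<notin> freq_module \<alpha>"
    obtain B s where B0: "s \<in> {1, -1 :: real}" "circle_to_SL2 B" "\<forall>i j. strip_ext \<eta> (\<lambda>x. B x $ i $ j)"
      "\<forall>x. A x ** B x = B (x + \<alpha>) ** R_rot (s * \<theta>)"
      using nonresonant_conjugacy[OF assms(1,5) u k0 eu nr] unfolding assms(4) by blast
    note B = B0(1,2) B0(3)[rule_format] B0(4)[rule_format]
    have SL: "B x \<in> SL2" "B (x + 1) = B x" for x using B(2) unfolding circle_to_SL2_def by blast+
    have B2: "B (x + 2) = B x" for x using SL(2)[of x] SL(2)[of "x + 1"] by (simp add: add.assoc)
    obtain \<beta> where \<beta>: "dir_lift B (degree_map B) \<beta>"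
      using deg[OF cont[OF B(3) assms(5)] SL(1) B2] by blast
    have rot: "[rotation_number \<alpha> A = s * \<theta> + of_int (degree_map B) / 2 * \<alpha>] (rmod 1/2)"
      by (rule rotation_number_conjugate[OF detA \<Phi> \<beta> B(4) rotation_dir_lift])
    then obtain n where n: "s * \<theta> + of_int (degree_map B) / 2 * \<alpha> = rotation_number \<alpha> A + of_int n * (1/2)"
      unfolding rcong_altdef by blast
    have "2 * rotation_number \<alpha> A \<notin> freq_module \<alpha>"
    proof
      assume "2 * rotation_number \<alpha> A \<in> freq_module \<alpha>"
      then obtain i j :: int where ij: "2 * rotation_number \<alpha> A = of_int i * \<alpha> + of_int j"
        unfolding freq_module_def by blast
      \<comment> \<open>A resonance of the rotation number would be passed on to 2 \<theta>, since m
        \<alpha> is itself in the frequency module; for s = -1 all integers change sign.\<close>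
      have "s * (2 * \<theta>) = of_int (i - degree_map B) * \<alpha> + of_int (j + n)"
        using n ij by (simp add: algebra_simps)
      then have "2 * \<theta> = of_int (i - degree_map B) * \<alpha> + of_int (j + n)
          \<or> 2 * \<theta> = of_int (degree_map B - i) * \<alpha> + of_int (- j - n)"
        using B(1) by (auto simp: algebra_simps)
      then show False using nr unfolding freq_module_def by blast
    qed
    moreover have "matrix_inv (B (x + \<alpha>)) ** A x ** B x = R_rot (s * \<theta>)" for x
      by (rule matrix_inv_conj[OF _ B(4)]) (use SL(1) in \<open>simp add: SL2_def\<close>)
    moreover have "analytic_in_strip \<eta> B" by (rule analytic_in_stripI[OF B(3)])
    ultimately show "\<exists>B. \<exists>s\<in>{1, -1}. circle_to_SL2 B \<and> analytic_in_strip \<eta> B \<and>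
          (\<forall>x. matrix_inv (B (x + \<alpha>)) ** A x ** B x = R_rot (s * \<theta>)) \<and>
          [rotation_number \<alpha> A = s * \<theta> + of_int (degree_map B) / 2 * \<alpha>] (rmod 1/2) \<and>
          2 * rotation_number \<alpha> A \<notin> freq_module \<alpha>"
      using B(1,2) rot by blast
  next
    assume "(\<exists>k::int. 2 * \<theta> - of_int k * \<alpha> \<in> \<int>) \<and> 8 * beta_freq \<alpha> < ereal \<eta>"
    then obtain k where k: "2 * \<theta> - of_int k * \<alpha> \<in> \<int>" and \<beta>f: "8 * beta_freq \<alpha> < ereal \<eta>" by blast
    obtain l :: int where "2 * \<theta> - of_int k * \<alpha> = of_int l" using k by (auto elim: Ints_cases)
    then have res: "2 * \<theta> = of_int k * \<alpha> + of_int l" by simp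
    obtain B a s where B0: "s \<in> {1, -1 :: real}" "circle_to_PSL2 B"
      "\<forall>i j. strip_ext (\<eta> / 4) (\<lambda>x. B x $ i $ j)" "a \<noteq> 0"
      "\<forall>x. A x ** B x = B (x + \<alpha>) ** mat2 s a 0 s"
      using resonant_conjugacy[OF assms(1,2,5) \<beta>f u k0 eu res] unfolding assms(4) by blast
    note B = B0(1,2) B0(3)[rule_format] B0(4) B0(5)[rule_format]
    have SL: "B x \<in> SL2" for x using B(2) unfolding circle_to_PSL2_def by blast
    obtain c :: real where c: "c \<in> {1, -1}" "\<And>x. B (x + 1) = c *\<^sub>R B x"
      using B(2) unfolding circle_to_PSL2_def by blast
    have B2: "B (x + 2) = B x" for x
    proof -
      have "B (x + 2) = B (x + 1 + 1)" by (simp add: add.assoc)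
      also have "\<dots> = (c * c) *\<^sub>R B x" unfolding c(2) by simp
      also have "c * c = 1" using c(1) by auto
      finally show ?thesis by simp
    qed
    have \<eta>4: "\<eta> / 4 > 0" using assms(5) by simp
    obtain \<beta> where \<beta>: "dir_lift B (degree_map B) \<beta>"
      using deg[OF cont[OF B(3) \<eta>4] SL B2] by blast
    obtain \<gamma> where \<gamma>: "continuous_on UNIV \<gamma>" "\<And>\<phi>. acts_dir (mat2 s a 0 s) \<phi> (\<gamma> \<phi>)"
      "\<And>n \<phi>. \<bar>(\<gamma> ^^ n) \<phi> - \<phi>\<bar> \<le> 1/2"
      using parabolic_dir_lift[OF B(1)] by blast
    \<comment> \<open>The triangular matrix contributes drift \<kappa> = 0, so only the degree is
      left in the rotation number.\<close>
    have \<gamma>': "\<bar>(\<gamma> ^^ n) \<phi> - \<phi> - real n * 0\<bar> \<le> 1/2" for n \<phi> using \<gamma>(3) by simp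
    have "[rotation_number \<alpha> A = 0 + of_int (degree_map B) / 2 * \<alpha>] (rmod 1/2)"
      by (rule rotation_number_conjugate[OF detA \<Phi> \<beta> B(5) \<gamma>(1,2) \<gamma>'])
    then obtain n where n: "0 + of_int (degree_map B) / 2 * \<alpha> = rotation_number \<alpha> A + of_int n * (1/2)"
      unfolding rcong_altdef by blast
    \<comment> \<open>Doubling turns the congruence modulo 1/2 into one modulo 1.\<close>
    have "of_int (degree_map B) * \<alpha> = 2 * rotation_number \<alpha> A + of_int n * 1" using n by (simp add: algebra_simps)
    then have rot: "[2 * rotation_number \<alpha> A = of_int (degree_map B) * \<alpha>] (rmod 1)"
      unfolding rcong_altdef by blast
    have "2 * rotation_number \<alpha> A = of_int (degree_map B) * \<alpha> + of_int (- n)" using n by (simp add: algebra_simps)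
    then have "2 * rotation_number \<alpha> A \<in> freq_module \<alpha>" unfolding freq_module_def by blast
    moreover have "matrix_inv (B (x + \<alpha>)) ** A x ** B x = mat2 s a 0 s" for x
      by (rule matrix_inv_conj[OF _ B(5)]) (use SL in \<open>simp add: SL2_def\<close>)
    moreover have "analytic_in_strip (\<eta> / 4) B" by (rule analytic_in_stripI[OF B(3)])
    ultimately show "\<exists>B a. \<exists>s\<in>{1, -1}.
          circle_to_PSL2 B \<and> analytic_in_strip (\<eta> / 4) B \<and> a \<noteq> 0 \<and>
          (\<forall>x. matrix_inv (B (x + \<alpha>)) ** A x ** B x = mat2 s a 0 s) \<and>
          [2 * rotation_number \<alpha> A = of_int (degree_map B) * \<alpha>] (rmod 1) \<and>
          2 * rotation_number \<alpha> A \<in> freq_module \<alpha>"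
      using B(1,2,4) rot by blast
  qed
qed

end
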